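(* Let $p(\cdot):\mathbb{R}^n\to[1,\infty]$ be a measurable function with $p_->1$ and $p_+<\infty$, and let $p'(x):=\frac{p(x)}{p(x)-1}$. Then the Hardy--Littlewood maximal operator $M$ is bounded on $L^{p(\cdot)}$ if and only if both $p(\cdot)\in\mathcal{A}_\infty$ and $p'(\cdot)\in\mathcal{A}_\infty$.
   Context: Cubes are cubes in $\mathbb{R}^n$ with sides parallel to the coordinate axes. For a measurable exponent $p(\cdot):\mathbb{R}^n\to[1,\infty]$, write $p_-:=\operatorname{ess\,inf}_{\mathbb{R}^n}p$ and $p_+:=\operatorname{ess\,sup}_{\mathbb{R}^n}p$. The space $L^{p(\cdot)}$ consists of the real-valued measurable functions $f$ on $\mathbb{R}^n$ with $$\|f\|_{L^{p(\cdot)}}:=\inf\Big\{\lambda>0:\int_{\mathbb{R}^n}\big(|f(x)|/\lambda\big)^{p(x)}dx\le 1\Big\}<\infty .$$ The Hardy--Littlewood maximal operator is $Mf(x):=\sup_{Q\ni x}\frac{1}{|Q|}\int_Q|f|$, the supremum being over all cubes $Q$ containing $x$. "Bounded on $L^{p(\cdot)}$" means that there is a constant $C>0$ with $\|Mf\|_{L^{p(\cdot)}}\le C\|f\|_{L^{p(\cdot)}}$ for all $f\in L^{p(\cdot)}$. Definition of $\mathcal{A}_\infty$: $p(\cdot)\in\mathcal{A}_\infty$ if there exist $\lambda\in(0,1)$ and $C>0$ such that for any family $\mathcal{F}$ of pairwise disjoint cubes, any non-negative sequence $\{t_Q\}_{Q\in\mathcal{F}}$, and any measurable subsets $E_Q\subset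 Q$, $Q\in\mathcal{F}$, with $|E_Q|\ge\lambda|Q|$, $$\Big\|\sum_{Q\in\mathcal{F}}t_Q\chi_Q\Big\|_{L^{p(\cdot)}}\le C\Big\|\sum_{Q\in\mathcal{F}}t_Q\chi_{E_Q}\Big\|_{L^{p(\cdot)}} .$$ The condition $p'(\cdot)\in\mathcal{A}_\infty$ is the same condition with $p'(\cdot)$ in place of $p(\cdot)$. *)

theory Defs
  imports "HOL-Analysis.Analysis" "HOL-Probability.Essential_Supremum"
begin

text \<open>A cube is a product of intervals of one common positive length, parallel to the axes.  The
  intervals may be open, closed or half-open: in Euclidean space, \<^const>\<open>is_interval\<close> says
  precisely that a set is a product of one-dimensional intervals.\<close>

definition is_cube :: "(real ^ 'n) set \<Rightarrow> bool" where
  "is_cube Q \<longleftrightarrow> is_interval Q \<and>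
     (\<exists>a l. 0 < l \<and> box a (a + (\<chi> i. l)) \<subseteq> Q \<and> Q \<subseteq> cbox a (a + (\<chi> i. l)))"

text \<open>The library has the essential supremum only.\<close>

definition essinf :: "'a measure \<Rightarrow> ('a \<Rightarrow> ennreal) \<Rightarrow> ennreal" where
  "essinf M f = Sup {z. AE x in M. z \<le> f x}"

text \<open>The power \<open>t ^ q\<close> for \<open>t \<in> [0, \<infinity>]\<close> and \<open>q \<in> [1, \<infinity>]\<close>, with the convention of
  variable Lebesgue spaces that \<open>t ^ \<infinity>\<close> is \<open>0\<close> for \<open>t \<le> 1\<close> and \<open>\<infinity>\<close> for \<open>t > 1\<close>.\<close>

definition ennpow :: "ennreal \<Rightarrow> ennreal \<Rightarrow> ennreal" where
  "ennpow t q =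
     (if q = \<infinity> then (if t \<le> 1 then 0 else \<infinity>)
      else if t = \<infinity> then \<infinity>
      else ennreal (enn2real t powr enn2real q))"

text \<open>The norm is taken of \<open>[0, \<infinity>]\<close>-valued functions, because a maximal function
  may take the value \<open>\<infinity>\<close>; a real-valued \<open>f\<close> enters through \<open>\<bar>f\<bar>\<close>.
  It is \<open>\<infinity>\<close> when no \<open>c\<close> is admissible.\<close>

definition Lp_norm :: "(real ^ 'n \<Rightarrow> ennreal) \<Rightarrow> (real ^ 'n \<Rightarrow> ennreal) \<Rightarrow> ennreal" where
  "Lp_norm p g =
     Inf {ennreal c | c. 0 < c \<and> (\<integral>\<^sup>+x. ennpow (g x / ennreal c) (p x) \<partial>lebesgue) \<le> 1}"

definition Lp_space :: "(real ^ 'n \<Rightarrow> ennreal) \<Rightarrow> (real ^ 'n \<Rightarrow> real) set" where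
  "Lp_space p = {f. f \<in> borel_measurable lebesgue \<and> Lp_norm p (\<lambda>x. ennreal \<bar>f x\<bar>) < \<infinity>}"

definition maximal :: "(real ^ 'n \<Rightarrow> real) \<Rightarrow> real ^ 'n \<Rightarrow> ennreal" where
  "maximal f x =
     (SUP Q\<in>{Q. is_cube Q \<and> x \<in> Q}.
        (\<integral>\<^sup>+y\<in>Q. ennreal \<bar>f y\<bar> \<partial>lebesgue) / emeasure lebesgue Q)"

definition maximal_bounded :: "(real ^ 'n \<Rightarrow> ennreal) \<Rightarrow> bool" where
  "maximal_bounded p \<longleftrightarrow>
     (\<exists>C::real. 0 < C \<and>
        (\<forall>f\<in>Lp_space p. Lp_norm p (maximal f) \<le> ennreal C * Lp_norm p (\<lambda>x. ennreal \<bar>f x\<bar>)))"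

definition A_infty :: "(real ^ 'n \<Rightarrow> ennreal) \<Rightarrow> bool" where
  "A_infty p \<longleftrightarrow>
     (\<exists>l C::real. 0 < l \<and> l < 1 \<and> 0 < C \<and>
        (\<forall>(F::(real ^ 'n) set set) (t::(real ^ 'n) set \<Rightarrow> real) (E::(real ^ 'n) set \<Rightarrow> (real ^ 'n) set).
           (\<forall>Q\<in>F. is_cube Q) \<longrightarrow> disjoint F \<longrightarrow> (\<forall>Q\<in>F. 0 \<le> t Q) \<longrightarrow>
           (\<forall>Q\<in>F. E Q \<in> sets lebesgue \<and> E Q \<subseteq> Q \<and> measure lebesgue (E Q) \<ge> l * measure lebesgue Q) \<longrightarrow>
           Lp_norm p (\<lambda>x. \<Sum>\<^sub>\<infinity>Q\<in>F. ennreal (t Q) * indicator Q x)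
             \<le> ennreal C * Lp_norm p (\<lambda>x. \<Sum>\<^sub>\<infinity>Q\<in>F. ennreal (t Q) * indicator (E Q) x)))"

text \<open>In \<^typ>\<open>ennreal\<close>, \<open>1 / 0 = \<infinity>\<close> gives the right value at exponent \<open>1\<close>, but
  \<open>\<infinity> / \<infinity> = 0\<close>, so exponent \<open>\<infinity>\<close> is treated separately.\<close>

definition conj_exponent :: "(real ^ 'n \<Rightarrow> ennreal) \<Rightarrow> real ^ 'n \<Rightarrow> ennreal" where
  "conj_exponent p x = (if p x = \<infinity> then 1 else p x / (p x - 1))"

end

theory Submission
  imports Defs
begin

text \<open>If \<open>M\<close> is bounded, then so are the averaging operators over families of disjoint cubes.  These are self-adjoint, hence
  bounded on the dual space too, and \<open>\<Sum> t\<^sub>Q \<chi>\<^sub>Q\<close> is at most a constant times the average of \<open>\<Sum> t\<^sub>Q \<chi>\<^bsub>E\<^sub>Q\<^esub>\<close>; this gives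
  both \<open>A\<^sub>\<infinity>\<close> conditions.

  Conversely, \<open>A\<^sub>\<infinity>\<close> with some \<open>\<lambda> < 1\<close> improves itself in two directions.  Growing cubes in which \<open>E\<close> is dense shows that
  \<open>\<lambda>\<close> may be any positive number, so that \<open>t\<^bsup>p(x)\<^esup>\<close> is controlled on \<open>Q\<close> by its value at the median \<open>m\<close> of \<open>p\<close>.  A stopping time
  argument shows that the modular over a set of small relative measure decays geometrically, which is a reverse Hoelder
  inequality: the average over \<open>Q\<close> of \<open>t\<^bsup>s(p(x) - m)\<^esup>\<close> is bounded for some \<open>s > 1\<close>, except when \<open>t\<^bsup>m\<^esup>\<close> is below a
  threshold \<open>\<beta>\<^sub>Q\<close>, where \<open>\<Sum> \<bar>Q\<bar> \<beta>\<^sub>Q\<close> is bounded over disjoint families.  Since \<open>m / (m - 1)\<close> is a median of \<open>p'\<close>, Young's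
  inequality and the reverse Hoelder inequalities for \<open>p\<close> and \<open>p'\<close> bound the average over \<open>Q\<close> of \<open>\<langle>f\<rangle>\<^sub>Q\<^bsup>p(x)\<^esup>\<close> by
  \<open>(\<langle>f\<^bsup>p/s\<^esup>\<rangle>\<^sub>Q)\<^sup>s + \<beta>\<^sub>Q\<^sup>s\<close> with a new \<open>s > 1\<close>.  Summed over the level sets of a dyadic maximal function, the first term is
  handled by the maximal theorem in \<open>L\<^sup>s\<close>; the second because \<open>sup \<beta>\<^sub>Q\<close> is bounded and in weak \<open>L\<^sup>1\<close>.\<close>

text \<open>Modulars are not homogeneous, and only the unit balls of norm and modular correspond.
  Hence estimates are stated as \<open>modular ... \<le> 1\<close> with the constant inside the
  function. The same obstacle shapes the reverse Hoelder inequality: it is available only for those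
  \<open>t\<close> that a function of modular at most 1 can produce, and the sums over bad cubes are
  bounded by showing that they can never lie between 1 and 2.

  Young's inequality is applied with the exponent \<open>r / s1\<close> rather than
  \<open>r\<close>, to leave room for the maximal theorem in \<open>L^s1\<close>. Its conjugate
  \<open>r / (r - s1)\<close> is not \<open>r'\<close>, but its deviation from the median value is
  at most a multiple of that of \<open>r'\<close>, and the multiple tends to 1 as \<open>s1\<close>
  does. This is why a reverse Hoelder exponent \<open>s > 1\<close> is indispensable.

  The dyadic bounds depend neither on the grid nor on the number of generations, so that grids
  growing with \<open>N\<close> and Fatou's lemma lead to the full maximal function.\<close>

section \<open>Integrals over disjoint unions\<close>

lemma nn_integral_Union_mono:
  assumes "countable F" "disjoint F" "\<And>Q. Q \<in> F \<Longrightarrow> Q \<in> sets M"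
    and u[measurable]: "u \<in> borel_measurable M" and v[measurable]: "v \<in> borel_measurable M"
    and le: "\<And>Q. Q \<in> F \<Longrightarrow> (\<integral>\<^sup>+x\<in>Q. u x \<partial>M) \<le> (\<integral>\<^sup>+x\<in>Q. v x \<partial>M)"
  shows "(\<integral>\<^sup>+x\<in>\<Union>F. u x \<partial>M) \<le> (\<integral>\<^sup>+x\<in>\<Union>F. v x \<partial>M)"
proof -
  have UF: "\<Union>F \<in> sets M"
    using assms(1,3) by (meson sets.countable_Union subsetI)
  \<comment> \<open>Countable additivity of the measure with density \<open>w\<close>; it turns
    cubewise comparisons into global ones.\<close>
  have *: "(\<integral>\<^sup>+x\<in>\<Union>F. w x \<partial>M) = (\<integral>\<^sup>+Q. (\<integral>\<^sup>+x\<in>Q. w x \<partial>M) \<partial>count_space F)"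
    if [measurable]: "w \<in> borel_measurable M" for w
  proof -
    have "(\<integral>\<^sup>+x\<in>\<Union>F. w x \<partial>M) = emeasure (density M w) (\<Union>((\<lambda>Q. Q) ` F))"
      using UF by (simp add: emeasure_density)
    also have "\<dots> = (\<integral>\<^sup>+Q. emeasure (density M w) Q \<partial>count_space F)"
      using assms(1-3) by (intro emeasure_UN_countable) (auto simp: disjoint_family_on_def disjoint_def)
    also have "\<dots> = (\<integral>\<^sup>+Q. (\<integral>\<^sup>+x\<in>Q. w x \<partial>M) \<partial>count_space F)"
      by (intro nn_integral_cong) (simp add: emeasure_density assms(3))
    finally show ?thesis .
  qed
  show ?thesis
    unfolding *[OF u] *[OF v] by (rule nn_integral_mono) (simp only: space_count_space le)
qed

lemma nn_integral_set_add:
  assumes [measurable]: "u \<in> borel_measurable M" "A \<in> sets M" "B \<in> sets M" and "A \<inter> B = {}"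
  shows "(\<integral>\<^sup>+x\<in>A \<union> B. u x \<partial>M) = (\<integral>\<^sup>+x\<in>A. u x \<partial>M) + (\<integral>\<^sup>+x\<in>B. u x \<partial>M)"
proof -
  have "(\<integral>\<^sup>+x\<in>A \<union> B. u x \<partial>M) = (\<integral>\<^sup>+x. u x * indicator A x + u x * indicator B x \<partial>M)"
    using assms(4) by (intro nn_integral_cong) (auto simp: indicator_def)
  also have "\<dots> = (\<integral>\<^sup>+x\<in>A. u x \<partial>M) + (\<integral>\<^sup>+x\<in>B. u x \<partial>M)"
    by (rule nn_integral_add) auto
  finally show ?thesis .
qed

lemma nn_integral_set_mono:
  assumes "A \<subseteq> B" "\<And>x. x \<in> A \<Longrightarrow> u x \<le> v x"
  shows "(\<integral>\<^sup>+x\<in>A. u x \<partial>M) \<le> (\<integral>\<^sup>+x\<in>B. v x \<partial>M)"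
  using assms by (intro nn_integral_mono) (auto simp: indicator_def)

lemma nn_integral_set_Un_le:
  assumes [measurable]: "u \<in> borel_measurable M" "A \<in> sets M" "B \<in> sets M"
  shows "(\<integral>\<^sup>+x\<in>A \<union> B. u x \<partial>M) \<le> (\<integral>\<^sup>+x\<in>A. u x \<partial>M) + (\<integral>\<^sup>+x\<in>B. u x \<partial>M)"
proof -
  have "(\<integral>\<^sup>+x\<in>A \<union> B. u x \<partial>M) \<le> (\<integral>\<^sup>+x. u x * indicator A x + u x * indicator B x \<partial>M)"
    by (intro nn_integral_mono) (auto simp: indicator_def)
  also have "\<dots> = (\<integral>\<^sup>+x\<in>A. u x \<partial>M) + (\<integral>\<^sup>+x\<in>B. u x \<partial>M)"
    by (rule nn_integral_add) auto
  finally show ?thesis .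
qed

section \<open>Cubes\<close>

abbreviation cbx :: "real ^ 'n \<Rightarrow> real \<Rightarrow> (real ^ 'n) set" where
  "cbx a l \<equiv> box a (a + (\<chi> i. l))"

abbreviation vol :: "(real ^ 'n) set \<Rightarrow> real" where
  "vol \<equiv> measure lebesgue"

lemma measure_cbx:
  fixes a :: "real ^ 'n"
  assumes "0 \<le> l"
  shows "vol (cbx a l) = l ^ CARD('n)" "vol (cbox a (a + (\<chi> i. l))) = l ^ CARD('n)"
proof -
  have "cbox a (a + (\<chi> i. l)) \<noteq> {}"
    using assms by (auto simp: interval_ne_empty_cart)
  then show "vol (cbox a (a + (\<chi> i. l))) = l ^ CARD('n)"
    by (simp add: content_cbox_cart)
  then show "vol (cbx a l) = l ^ CARD('n)"
    by (simp add: measure_completion measure_lborel_box_eq measure_lborel_cbox_eq)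
qed

text \<open>All boundary conventions are interchangeable: a cube and the open box inside it differ
  by part of the frontier of the box, a null set.\<close>

lemma is_cube_obtain:
  fixes Q :: "(real ^ 'n) set"
  assumes "is_cube Q"
  obtains a l where "0 < l" "cbx a l \<subseteq> Q" "Q \<subseteq> cbox a (a + (\<chi> i. l))"
    "Q \<in> lmeasurable" "vol Q = l ^ CARD('n)" "negligible (Q - cbx a l)"
proof -
  obtain a l where *: "0 < l" "cbx a l \<subseteq> Q" "Q \<subseteq> cbox a (a + (\<chi> i. l))"
    using assms unfolding is_cube_def by blast
  have neg: "negligible (Q - cbx a l)"
    by (rule negligible_subset[OF negligible_frontier_interval[of a "a + (\<chi> i. l)"]]) (use * in auto)
  have Q: "Q = cbx a l \<union> (Q - cbx a l)" using * by auto
  have "Q \<in> lmeasurable"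
    by (subst Q, intro fmeasurable.Un lmeasurable_box negligible_imp_measurable neg)
  moreover have "vol Q = l ^ CARD('n)"
  proof -
    have "vol Q = vol (cbx a l)"
      by (rule measure_negligible_symdiff) (use neg in \<open>simp_all add: Diff_eq_empty_iff[THEN iffD2] *\<close>)
    then show ?thesis using *(1) measure_cbx(1)[of l a] by simp
  qed
  ultimately show ?thesis using that * neg by blast
qed

lemma is_cubeD:
  fixes Q :: "(real ^ 'n) set"
  assumes "is_cube Q"
  shows "Q \<in> sets lebesgue" "Q \<in> lmeasurable" "0 < vol Q"
    "emeasure lebesgue Q = ennreal (vol Q)"
  using is_cube_obtain[OF assms]
  by (metis zero_less_power fmeasurableD, metis, metis zero_less_power, metis emeasure_eq_measure2)

lemma is_cube_cbx: "0 < l \<Longrightarrow> is_cube (cbx a l)"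
  unfolding is_cube_def by (meson box_subset_cbox is_interval_box order_refl)

lemma is_cube_has_point: "is_cube Q \<Longrightarrow> \<exists>q. q \<in> Q \<and> q \<in> interior Q"
proof -
  assume "is_cube Q"
  then obtain a l where *: "0 < l" "cbx a l \<subseteq> Q" unfolding is_cube_def by blast
  have "a + (\<chi> i. l/2) \<in> cbx a l" using * by (auto simp: mem_box_cart)
  then show ?thesis using * by (meson interior_maximal open_box subsetD)
qed

text \<open>The interiors are disjoint nonempty open sets, of which Euclidean space holds only
  countably many; nonemptiness makes \<open>interior\<close> injective on the family.\<close>

lemma countable_cubes:
  assumes "\<And>Q. Q \<in> F \<Longrightarrow> is_cube Q" "disjoint F"
  shows "countable F"
proof -
  have "countable (interior ` F)"
  proof (rule countable_disjoint_open_subsets)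
    show "disjoint (interior ` F)"
      using assms(2) interior_subset unfolding disjoint_def by fast
  qed auto
  moreover have "inj_on interior F"
  proof (rule inj_onI)
    fix P Q assume "P \<in> F" "Q \<in> F" and eq: "interior P = interior Q"
    obtain q where "q \<in> interior P" using is_cube_has_point assms(1) \<open>P \<in> F\<close> by blast
    then have "q \<in> P \<inter> Q" using eq interior_subset by auto
    then show "P = Q" using assms(2) \<open>P \<in> F\<close> \<open>Q \<in> F\<close> unfolding disjoint_def by blast
  qed
  ultimately show ?thesis by (rule countable_image_inj_on)
qed

lemma sets_Union_cubes:
  assumes "\<And>Q. Q \<in> F \<Longrightarrow> is_cube Q" "disjoint F"
  shows "\<Union>F \<in> sets lebesgue"
  using countable_cubes[OF assms] is_cubeD(1) assms(1) by (meson sets.countable_Union subsetI)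

section \<open>Dyadic cubes\<close>

text \<open>A cube is addressed by any of its points rather than by its corner. Two cubes of one
  generation are thus equal as soon as they meet, and statements about the cubes around a moving
  point need no choice.\<close>

definition dcube :: "real ^ 'n \<Rightarrow> real \<Rightarrow> nat \<Rightarrow> real ^ 'n \<Rightarrow> (real ^ 'n) set" where
  "dcube a L k x = {y. \<forall>i. \<lfloor>(y $ i - a $ i) * 2 ^ k / L\<rfloor> = \<lfloor>(x $ i - a $ i) * 2 ^ k / L\<rfloor>}"

lemma dcube_self: "x \<in> dcube a L k x"
  by (simp add: dcube_def)

lemma dcube_eq: "y \<in> dcube a L k x \<Longrightarrow> dcube a L k y = dcube a L k x"
  by (simp add: dcube_def)

lemma dcube_mono:
  assumes "j \<le> k" shows "dcube a L k x \<subseteq> dcube a L j x"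
proof -
  \<comment> \<open>The coarse index is the fine index divided by \<open>2 ^ (k - j)\<close> and
    rounded down, so the fine index determines it.\<close>
  have *: "\<lfloor>u * 2 ^ j / L\<rfloor> = \<lfloor>u * 2 ^ k / L\<rfloor> div 2 ^ (k - j)" for u :: real
  proof -
    have "(2::real) ^ k = 2 ^ j * 2 ^ (k - j)" using assms by (simp flip: power_add)
    then have "u * 2 ^ j / L = (u * 2 ^ k / L) / real_of_int (2 ^ (k - j))" by simp
    then show ?thesis by (metis floor_divide_real_eq_div zero_le_numeral zero_le_power)
  qed
  show ?thesis unfolding dcube_def * by auto
qed

lemma dcube_nested: "j \<le> k \<Longrightarrow> z \<in> dcube a L k x \<Longrightarrow> z \<in> dcube a L j y \<Longrightarrow> dcube a L k x \<subseteq> dcube a L j y"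
  by (metis dcube_eq dcube_mono)

lemma dcube_halfopen:
  assumes "0 < L"
  shows "dcube a L k x = {y. \<forall>i. a $ i + L / 2 ^ k * \<lfloor>(x $ i - a $ i) * 2 ^ k / L\<rfloor> \<le> y $ i \<and>
           y $ i < a $ i + L / 2 ^ k * \<lfloor>(x $ i - a $ i) * 2 ^ k / L\<rfloor> + L / 2 ^ k}"
proof -
  have "(\<lfloor>(y - b) * 2 ^ k / L\<rfloor> = z) \<longleftrightarrow> b + L / 2 ^ k * z \<le> y \<and> y < b + L / 2 ^ k * z + L / 2 ^ k" for y b :: real and z :: int
    using assms unfolding floor_eq_iff by (simp add: field_simps)
  then show ?thesis unfolding dcube_def by simp
qed

definition dcorner :: "real ^ 'n \<Rightarrow> real \<Rightarrow> nat \<Rightarrow> real ^ 'n \<Rightarrow> real ^ 'n" where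
  "dcorner a L k x = (\<chi> i. a $ i + L / 2 ^ k * \<lfloor>(x $ i - a $ i) * 2 ^ k / L\<rfloor>)"

lemma dcube_boxes:
  assumes "0 < L"
  shows "cbx (dcorner a L k x) (L / 2 ^ k) \<subseteq> dcube a L k x"
    "dcube a L k x \<subseteq> cbox (dcorner a L k x) (dcorner a L k x + (\<chi> i. L / 2 ^ k))"
  unfolding dcube_halfopen[OF assms] by (auto simp: mem_box_cart dcorner_def less_imp_le)

lemma is_cube_dcube: "0 < L \<Longrightarrow> is_cube (dcube a L k x)"
  unfolding is_cube_def
proof (intro conjI exI[of _ "dcorner a L k x"] exI[of _ "L / 2 ^ k"])
  assume L: "0 < L"
  show "is_interval (dcube a L k x)"
    unfolding dcube_halfopen[OF L] is_interval_def
    by (auto simp: Basis_vec_def inner_axis) (smt (verit))+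
qed (auto simp: dcube_boxes)

lemma measure_dcube:
  fixes a :: "real ^ 'n"
  assumes "0 < L" shows "vol (dcube a L k x) = (L / 2 ^ k) ^ CARD('n)"
proof (rule antisym)
  have m: "dcube a L k x \<in> lmeasurable" by (rule is_cubeD[OF is_cube_dcube[OF assms]])
  have "vol (dcube a L k x) \<le> vol (cbox (dcorner a L k x) (dcorner a L k x + (\<chi> i. L / 2 ^ k)))"
    by (rule measure_mono_fmeasurable[OF dcube_boxes(2)[OF assms]]) (use m in \<open>auto simp: fmeasurableD\<close>)
  also have "\<dots> = (L / 2 ^ k) ^ CARD('n)" using assms by (intro measure_cbx) simp
  finally show "vol (dcube a L k x) \<le> (L / 2 ^ k) ^ CARD('n)" .
  have "(L / 2 ^ k) ^ CARD('n) = vol (cbx (dcorner a L k x) (L / 2 ^ k))"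
    using assms by (intro measure_cbx[symmetric]) simp
  also have "\<dots> \<le> vol (dcube a L k x)"
    by (rule measure_mono_fmeasurable[OF dcube_boxes(1)[OF assms]]) (use m in \<open>auto simp: fmeasurableD\<close>)
  finally show "(L / 2 ^ k) ^ CARD('n) \<le> vol (dcube a L k x)" .
qed

lemma measure_dcube_Suc:
  fixes a :: "real ^ 'n"
  assumes "0 < L" shows "vol (dcube a L k x) = 2 ^ CARD('n) * vol (dcube a L (Suc k) y)"
  unfolding measure_dcube[OF assms] by (simp add: power_divide power_mult_distrib)

text \<open>The cube depends on \<open>x\<close> only through its vector of floors, which has
  countable range. With the discrete sigma-algebra on the sets, every function of the cube around
  \<open>x\<close> becomes measurable in \<open>x\<close>.\<close>

lemma measurable_dcube [measurable]:
  fixes a :: "real ^ 'n"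
  shows "(\<lambda>x. dcube a L k x) \<in> measurable lebesgue (count_space UNIV)"
proof -
  define c where "c x = (\<chi> i. \<lfloor>(x $ i - a $ i) * 2 ^ k / L\<rfloor>)" for x :: "real ^ 'n"
  have "c \<in> measurable borel (count_space UNIV)"
    unfolding measurable_count_space_eq2_countable
  proof (intro conjI ballI)
    fix z :: "int ^ 'n"
    have "c -` {z} \<inter> space borel = (\<Inter>i. {x. \<lfloor>(x $ i - a $ i) * 2 ^ k / L\<rfloor> = z $ i})"
      by (auto simp: c_def vec_eq_iff)
    also have "\<dots> \<in> sets borel"
      by (rule sets.finite_INT[OF finite_class.finite_UNIV UNIV_not_empty]) auto
    finally show "c -` {z} \<inter> space borel \<in> sets borel" .
  qed simp
  then have "c \<in> measurable lebesgue (count_space UNIV)"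
    by (simp add: measurable_completion)
  moreover have "dcube a L k x = (\<lambda>z. {y. \<forall>i. \<lfloor>(y $ i - a $ i) * 2 ^ k / L\<rfloor> = z $ i}) (c x)" for x
    by (simp add: dcube_def c_def)
  ultimately show ?thesis by simp
qed

lemma dcube_in_open:
  fixes U :: "(real ^ 'n) set"
  assumes "0 < L" "open U" "x \<in> U"
  obtains k where "k \<ge> K" "dcube a L k x \<subseteq> U"
proof -
  obtain e where e: "0 < e" "ball x e \<subseteq> U" using assms openE by blast
  have "(\<lambda>k. real CARD('n) * (L / 2 ^ k)) \<longlonglongrightarrow> real CARD('n) * 0"
    by (intro tendsto_mult tendsto_const LIMSEQ_divide_realpow_zero) auto
  then have "\<forall>\<^sub>F k in sequentially. CARD('n) * (L / 2 ^ k) < e"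
    using e(1) by (simp add: order_tendstoD)
  then have "\<forall>\<^sub>F k in sequentially. CARD('n) * (L / 2 ^ k) < e \<and> k \<ge> K"
    using eventually_ge_at_top by (rule eventually_conj)
  then obtain k where k: "k \<ge> K" "CARD('n) * (L / 2 ^ k) < e"
    by (auto simp: eventually_sequentially)
  have "dcube a L k x \<subseteq> ball x e"
  proof
    fix y assume y: "y \<in> dcube a L k x"
    have "\<bar>x $ i - y $ i\<bar> \<le> L / 2 ^ k" for i
      using y dcube_self[of x a L k] unfolding dcube_halfopen[OF assms(1)] mem_Collect_eq
      by (smt (verit))
    then have "norm (x - y) \<le> (\<Sum>i\<in>(UNIV::'n set). L / 2 ^ k)"
      by (intro order.trans[OF norm_le_l1_cart] sum_mono) simp
    then show "y \<in> ball x e" using k by (simp add: dist_norm)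
  qed
  then show ?thesis using that k e by blast
qed

section \<open>Stopping cubes\<close>

text \<open>\<open>P\<close> may depend on the generation, which serves both to start late
  (\<open>k \<ge> K\<close>) and to stop early (\<open>k \<le> N\<close>). Since generations are
  counted from 0, a first one exists wherever \<open>P\<close> holds at all, without any decay
  condition on large cubes.\<close>

definition stop_cubes :: "real ^ 'n \<Rightarrow> real \<Rightarrow> (nat \<Rightarrow> (real ^ 'n) set \<Rightarrow> bool) \<Rightarrow> (real ^ 'n) set set" where
  "stop_cubes a L P = {dcube a L k x | k x. P k (dcube a L k x) \<and> (\<forall>j<k. \<not> P j (dcube a L j x))}"

lemma stop_cubes_is_cube: "0 < L \<Longrightarrow> Q \<in> stop_cubes a L P \<Longrightarrow> is_cube Q"
  by (auto simp: stop_cubes_def is_cube_dcube)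

lemma disjoint_stop_cubes: "disjoint (stop_cubes a L P)"
  unfolding disjoint_def
proof (intro ballI impI)
  fix Q R assume Q: "Q \<in> stop_cubes a L P" and R: "R \<in> stop_cubes a L P" and ne: "Q \<noteq> R"
  obtain k x where k: "Q = dcube a L k x" "P k (dcube a L k x)" "\<forall>j<k. \<not> P j (dcube a L j x)"
    using Q unfolding stop_cubes_def by blast
  obtain j y where j: "R = dcube a L j y" "P j (dcube a L j y)" "\<forall>i<j. \<not> P i (dcube a L i y)"
    using R unfolding stop_cubes_def by blast
  show "Q \<inter> R = {}"
  proof (rule ccontr)
    assume "Q \<inter> R \<noteq> {}"
    then obtain z where z: "z \<in> dcube a L k x" "z \<in> dcube a L j y" using k j by auto
    \<comment> \<open>Up to generation \<open>k\<close> the cubes around \<open>z\<close> are those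
      around \<open>x\<close>, and up to \<open>j\<close> those around \<open>y\<close>; so both
      \<open>k\<close> and \<open>j\<close> are the first generation at which \<open>P\<close> holds
      along \<open>z\<close>.\<close>
    have kz: "dcube a L i z = dcube a L i x" if "i \<le> k" for i
      using dcube_mono[OF that] z(1) dcube_eq by blast
    have jz: "dcube a L i z = dcube a L i y" if "i \<le> j" for i
      using dcube_mono[OF that] z(2) dcube_eq by blast
    have "k = j" using k(2,3) j(2,3) kz jz by (metis linorder_neqE_nat order_refl less_imp_le)
    then show False using ne k(1) j(1) kz jz by auto
  qed
qed

lemma Union_stop_cubes: "\<Union>(stop_cubes a L P) = {x. \<exists>k. P k (dcube a L k x)}"
proof (intro set_eqI iffI)
  fix z assume "z \<in> \<Union>(stop_cubes a L P)"
  then show "z \<in> {x. \<exists>k. P k (dcube a L k x)}" unfolding stop_cubes_def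
    using dcube_eq by (smt (verit) Union_iff mem_Collect_eq)
next
  fix z assume "z \<in> {x. \<exists>k. P k (dcube a L k x)}"
  then have "\<exists>k. P k (dcube a L k z)" by simp
  then have "\<exists>k. P k (dcube a L k z) \<and> (\<forall>j<k. \<not> P j (dcube a L j z))"
    by (rule exists_least_iff[THEN iffD1])
  then show "z \<in> \<Union>(stop_cubes a L P)" unfolding stop_cubes_def using dcube_self by blast
qed

lemma stop_cubes_props:
  assumes "Q \<in> stop_cubes a L P"
  obtains k x where "Q = dcube a L k x" "x \<in> Q" "P k Q" "\<And>j. j < k \<Longrightarrow> \<not> P j (dcube a L j x)"
  using assms unfolding stop_cubes_def using dcube_self by blast

text \<open>A weak form of Lebesgue's density theorem: cover \<open>B\<close> by an open set of almost the same
  measure and split the latter into maximal dyadic cubes.\<close>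

lemma dyadic_density:
  fixes B :: "(real ^ 'n) set"
  assumes L: "0 < L" and B: "B \<in> lmeasurable" and \<tau>: "0 < \<tau>" "\<tau> < 1"
    and *: "\<And>x k. x \<in> B \<Longrightarrow> k \<ge> K \<Longrightarrow> vol (B \<inter> dcube a L k x) \<le> \<tau> * vol (dcube a L k x)"
  shows "vol B = 0"
proof (rule ccontr)
  assume "vol B \<noteq> 0"
  then have pos: "0 < vol B" using measure_nonneg[of lebesgue B] by linarith
  \<comment> \<open>Chosen so that \<open>\<tau> * (vol B + e) = (1 + \<tau>) / 2 * vol B\<close>,
    which is below \<open>vol B\<close>.\<close>
  define e where "e = (1 - \<tau>) / (2 * \<tau>) * vol B"
  have e: "0 < e" using \<tau> pos by (simp add: e_def)
  obtain U where U: "open U" "B \<subseteq> U" "U - B \<in> lmeasurable" "emeasure lebesgue (U - B) < ennreal e"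
    using sets_lebesgue_outer_open[OF fmeasurableD[OF B] e] by blast
  have UU: "U = B \<union> (U - B)" using U by auto
  have Um: "U \<in> lmeasurable" by (subst UU) (intro fmeasurable.Un B U)
  have mU: "vol U \<le> vol B + e"
  proof -
    have "vol (U - B) < e" using U(3,4) e by (simp add: emeasure_eq_measure2 ennreal_less_iff)
    moreover have "vol U = vol B + vol (U - B)"
      using measure_Un2[OF B Um] U(2) by (simp add: Un_absorb1)
    ultimately show ?thesis by simp
  qed
  define F where "F = stop_cubes a L (\<lambda>k R. k \<ge> K \<and> R \<subseteq> U)"
  have UF: "\<Union>F = U"
  proof
    show "\<Union>F \<subseteq> U" unfolding F_def Union_stop_cubes using dcube_self by blast
    show "U \<subseteq> \<Union>F" unfolding F_def Union_stop_cubes using dcube_in_open[OF L U(1)] by blast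
  qed
  have cF: "\<And>Q. Q \<in> F \<Longrightarrow> is_cube Q" using stop_cubes_is_cube[OF L] by (auto simp: F_def)
  have dF: "disjoint F" by (simp add: F_def disjoint_stop_cubes)
  have Bs[measurable]: "B \<in> sets lebesgue" using B by auto
  have "(\<integral>\<^sup>+x\<in>\<Union>F. indicator B x \<partial>lebesgue) \<le> (\<integral>\<^sup>+x\<in>\<Union>F. ennreal \<tau> \<partial>lebesgue)"
  proof (rule nn_integral_Union_mono[OF countable_cubes[OF cF dF] dF])
    fix Q assume Q: "Q \<in> F"
    note Qm = is_cubeD[OF cF[OF Q]]
    have "(\<integral>\<^sup>+x\<in>Q. indicator B x \<partial>lebesgue) = emeasure lebesgue (B \<inter> Q)"
      using Qm(1) by (simp add: indicator_inter_arith[symmetric])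
    also have "\<dots> = ennreal (vol (B \<inter> Q))"
      using Qm(1) B by (intro emeasure_eq_measure2 fmeasurable_Int_fmeasurable) auto
    also have "\<dots> \<le> ennreal (\<tau> * vol Q)"
    proof (cases "B \<inter> Q = {}")
      case True then show ?thesis using \<tau> by simp
    next
      case False
      then obtain z where z: "z \<in> B" "z \<in> Q" by blast
      obtain k x where "Q = dcube a L k x" "k \<ge> K" using Q unfolding F_def stop_cubes_def by blast
      then show ?thesis using *[OF z(1)] z dcube_eq by (metis ennreal_leI)
    qed
    also have "\<dots> = (\<integral>\<^sup>+x\<in>Q. ennreal \<tau> \<partial>lebesgue)"
      using Qm \<tau> by (simp add: nn_integral_cmult_indicator ennreal_mult)
    finally show "(\<integral>\<^sup>+x\<in>Q. indicator B x \<partial>lebesgue) \<le> (\<integral>\<^sup>+x\<in>Q. ennreal \<tau> \<partial>lebesgue)" .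
  qed (use cF is_cubeD(1) in auto)
  moreover have "(\<integral>\<^sup>+x\<in>\<Union>F. indicator B x \<partial>lebesgue) = ennreal (vol B)"
  proof -
    have "(\<integral>\<^sup>+x\<in>\<Union>F. indicator B x \<partial>lebesgue) = emeasure lebesgue (B \<inter> U)"
      unfolding UF using Um by (simp add: indicator_inter_arith[symmetric] fmeasurableD)
    moreover have "B \<inter> U = B" using U(2) by auto
    ultimately show ?thesis using B by (simp add: emeasure_eq_measure2)
  qed
  moreover have "(\<integral>\<^sup>+x\<in>\<Union>F. ennreal \<tau> \<partial>lebesgue) = ennreal (\<tau> * vol U)"
    unfolding UF using Um \<tau> by (simp add: nn_integral_cmult_indicator fmeasurableD ennreal_mult emeasure_eq_measure2)
  ultimately have "vol B \<le> \<tau> * vol U"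
    using \<tau> by (simp add: ennreal_le_iff)
  also have "\<dots> \<le> \<tau> * (vol B + e)" using mU \<tau> by simp
  also have "\<dots> = (1 + \<tau>) / 2 * vol B" using \<tau> by (simp add: e_def field_simps)
  also have "\<dots> < vol B" using \<tau> pos by simp
  finally show False by simp
qed

section \<open>Filling a cube by subcubes dense in a set\<close>

definition cube_family :: "(real ^ 'n) set set \<Rightarrow> bool" where
  "cube_family F \<longleftrightarrow> (\<forall>Q\<in>F. is_cube Q) \<and> disjoint F"

lemma cube_familyD:
  assumes "cube_family F"
  shows "Q \<in> F \<Longrightarrow> is_cube Q" "disjoint F" "countable F" "\<Union>F \<in> sets lebesgue"
    "Q \<in> F \<Longrightarrow> Q \<in> sets lebesgue"
proof -
  have *: "\<And>Q. Q \<in> F \<Longrightarrow> is_cube Q" and d: "disjoint F" using assms unfolding cube_family_def by blast+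
  show "is_cube Q" if "Q \<in> F" using * that .
  show "Q \<in> sets lebesgue" if "Q \<in> F" using is_cubeD(1) * that .
  show "disjoint F" by (rule d)
  show "countable F" using countable_cubes * d by metis
  show "\<Union>F \<in> sets lebesgue" using sets_Union_cubes * d by metis
qed

lemma cube_family_subset: "cube_family F \<Longrightarrow> G \<subseteq> F \<Longrightarrow> cube_family G"
  unfolding cube_family_def disjoint_def by (meson subsetD)

lemma fmeasurable_Int_fmeasurable2: "E \<in> sets M \<Longrightarrow> T \<in> fmeasurable M \<Longrightarrow> E \<inter> T \<in> fmeasurable M"
  by (metis Int_commute fmeasurable_Int_fmeasurable)

lemma UN_Int_cube:
  assumes F: "cube_family F" and Q: "Q \<in> F" and A: "\<And>Q. Q \<in> F \<Longrightarrow> A Q \<subseteq> Q"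
  shows "(\<Union>Q\<in>F. A Q) \<inter> Q = A Q"
proof
  show "(\<Union>Q\<in>F. A Q) \<inter> Q \<subseteq> A Q"
  proof
    fix x assume "x \<in> (\<Union>Q\<in>F. A Q) \<inter> Q"
    then obtain R where R: "R \<in> F" "x \<in> A R" "x \<in> Q" by blast
    then have "x \<in> R" using A by blast
    then have "R \<inter> Q \<noteq> {}" using R(3) by blast
    then have "R = Q" using Q R(1) cube_familyD(2)[OF F] unfolding disjoint_def by metis
    then show "x \<in> A Q" using R(2) by simp
  qed
qed (use A[OF Q] Q in blast)

lemma cube_family_stop_cubes: "0 < L \<Longrightarrow> cube_family (stop_cubes a L P)"
  by (simp add: cube_family_def disjoint_stop_cubes stop_cubes_is_cube)

lemma measure_Int_dcube:
  assumes "0 < L" "E \<in> sets lebesgue"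
  shows "vol (E \<inter> dcube a L k x) = vol (E \<inter> cbx (dcorner a L k x) (L / 2 ^ k))"
proof (rule measure_negligible_symdiff)
  show "E \<inter> cbx (dcorner a L k x) (L / 2 ^ k) \<in> lmeasurable"
    by (rule fmeasurable_Int_fmeasurable2) (use assms in auto)
  show "negligible (E \<inter> cbx (dcorner a L k x) (L / 2 ^ k) - E \<inter> dcube a L k x \<union>
      (E \<inter> dcube a L k x - E \<inter> cbx (dcorner a L k x) (L / 2 ^ k)))"
    by (rule negligible_subset[OF negligible_frontier_interval])
      (use dcube_boxes[OF assms(1), of a k x] in blast)
qed

text \<open>Intermediate value theorem along the linear interpolation of corner and side. The cubes
  increase, so the measure of their intersection with \<open>E\<close> moves no faster than their
  volume; this gives continuity for an arbitrary measurable \<open>E\<close>.\<close>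

lemma growing_cube:
  fixes c d :: "real ^ 'n"
  assumes h: "0 < h1" "h1 \<le> h2" and cd: "\<And>i. d $ i \<le> c $ i" "\<And>i. c $ i + h1 \<le> d $ i + h2"
    and E: "E \<in> sets lebesgue"
    and le: "l * vol (cbx c h1) \<le> vol (E \<inter> cbx c h1)"
    and ge: "vol (E \<inter> cbx d h2) \<le> l * vol (cbx d h2)"
  shows "\<exists>e h. h1 \<le> h \<and> h \<le> h2 \<and> cbx e h \<subseteq> cbx d h2 \<and> vol (E \<inter> cbx e h) = l * vol (cbx e h)"
proof -
  define e where "e s = (1 - s) *\<^sub>R c + s *\<^sub>R d" for s
  define h where "h s = (1 - s) * h1 + s * h2" for s
  have hs: "h1 \<le> h s" "h s \<le> h2" if "s \<in> {0..1}" for s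
  proof -
    have "0 \<le> s * (h2 - h1)" "0 \<le> (1 - s) * (h2 - h1)" using that h by (auto intro!: mult_nonneg_nonneg)
    then show "h1 \<le> h s" "h s \<le> h2" by (auto simp: h_def algebra_simps)
  qed
  have sub: "cbx (e s) (h s) \<subseteq> cbx (e s') (h s')" if "s \<le> s'" for s s'
  proof (rule subset_box_imp, intro ballI)
    fix b :: "real ^ 'n" assume "b \<in> Basis"
    then obtain i where b: "b = axis i 1" by (auto simp: Basis_vec_def)
    have "0 \<le> (s' - s) * (c $ i - d $ i)" "0 \<le> (s' - s) * (d $ i + h2 - (c $ i + h1))"
      using that cd[of i] by auto
    then show "e s' \<bullet> b \<le> e s \<bullet> b \<and> (e s + (\<chi> i. h s)) \<bullet> b \<le> (e s' + (\<chi> i. h s')) \<bullet> b"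
      by (simp add: b inner_axis e_def h_def algebra_simps)
  qed
  define V where "V s = vol (cbx (e s) (h s))" for s
  define W where "W s = vol (E \<inter> cbx (e s) (h s))" for s
  have V: "V s = h s ^ CARD('n)" if "s \<in> {0..1}" for s
    unfolding V_def using hs[OF that] h by (intro measure_cbx) auto
  have Vc: "continuous_on {0..1} V"
    by (subst continuous_on_cong[OF refl V]) (auto intro!: continuous_intros simp: h_def)
  have WV: "W s \<le> W s' \<and> W s' - W s \<le> V s' - V s" if "s \<le> s'" for s s'
  proof -
    let ?A = "cbx (e s) (h s)" and ?B = "cbx (e s') (h s')"
    have m: "E \<inter> ?A \<in> lmeasurable" "E \<inter> ?B \<in> lmeasurable"
      by (rule fmeasurable_Int_fmeasurable2; use E in auto)+
    have "W s' - W s = vol (E \<inter> ?B - E \<inter> ?A)"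
      unfolding W_def using m sub[OF that] by (subst measurable_measure_Diff) auto
    also have "\<dots> \<le> vol (?B - ?A)"
      by (rule measure_mono_fmeasurable) (use m in \<open>auto intro: fmeasurable.Diff\<close>)
    also have "\<dots> = V s' - V s"
      unfolding V_def using sub[OF that] by (subst measurable_measure_Diff) auto
    finally have "W s' - W s \<le> V s' - V s" .
    moreover have "W s \<le> W s'" unfolding W_def
      by (rule measure_mono_fmeasurable) (use m sub[OF that] in auto)
    ultimately show ?thesis by simp
  qed
  have "continuous_on {0..1} W"
    unfolding continuous_on_iff
  proof (intro ballI allI impI)
    fix x \<epsilon> :: real assume "x \<in> {0..1}" "0 < \<epsilon>"
    then obtain \<delta> where \<delta>: "0 < \<delta>" "\<forall>y\<in>{0..1}. dist y x < \<delta> \<longrightarrow> dist (V y) (V x) < \<epsilon>"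
      using Vc unfolding continuous_on_iff by blast
    have "dist (W y) (W x) \<le> dist (V y) (V x)" for y
      using WV[of x y] WV[of y x] by (cases "x \<le> y") (auto simp: dist_real_def)
    then show "\<exists>\<delta>>0. \<forall>y\<in>{0..1}. dist y x < \<delta> \<longrightarrow> dist (W y) (W x) < \<epsilon>"
      using \<delta> by (meson le_less_trans)
  qed
  then have "continuous_on {0..1} (\<lambda>s. W s - l * V s)"
    by (intro continuous_intros Vc)
  moreover have "W 1 - l * V 1 \<le> 0" "0 \<le> W 0 - l * V 0"
    using le ge by (simp_all add: W_def V_def e_def h_def)
  ultimately obtain s where s: "0 \<le> s" "s \<le> 1" "W s - l * V s = 0"
    using IVT2'[of "\<lambda>s. W s - l * V s" 1 0 0] by auto
  show ?thesis
  proof (intro exI[of _ "e s"] exI[of _ "h s"] conjI)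
    show "cbx (e s) (h s) \<subseteq> cbx d h2" using sub[of s 1] s by (simp add: e_def h_def)
  qed (use s hs[of s] in \<open>auto simp: W_def V_def\<close>)
qed

text \<open>The subcubes are grown, by continuity, from dyadic cubes in which \<open>E\<close> is too dense
  towards their parents, in which it is not.\<close>

lemma dense_subcubes:
  fixes Q :: "(real ^ 'n) set"
  assumes Q: "is_cube Q" and E[measurable]: "E \<in> sets lebesgue" and l: "0 < l" "l < 1"
    and less: "vol (E \<inter> Q) < l * vol Q"
  obtains \<P> where "cube_family \<P>" "\<Union>\<P> \<subseteq> Q" "\<And>P. P \<in> \<P> \<Longrightarrow> l * vol P \<le> vol (E \<inter> P)"
    "(1 - l) / 2 ^ CARD('n) * vol (E \<inter> Q) \<le> vol (\<Union>\<P> - E)"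
proof -
  obtain a L where L: "0 < L" and aQ: "cbx a L \<subseteq> Q" "Q \<subseteq> cbox a (a + (\<chi> i. L))"
    and Qm: "Q \<in> lmeasurable" "vol Q = L ^ CARD('n)" "negligible (Q - cbx a L)"
    using is_cube_obtain[OF Q] by metis
  \<comment> \<open>The grid is generated by \<open>Q\<close> itself: \<open>T\<close> is the
    half-open copy of \<open>Q\<close>.\<close>
  define T where "T = dcube a L 0 a"
  have dc0: "dcorner a L 0 a = a" by (simp add: dcorner_def vec_eq_iff)
  have T: "cbx a L \<subseteq> T" "T \<subseteq> cbox a (a + (\<chi> i. L))"
    using dcube_boxes[OF L, of a 0 a] by (simp_all add: T_def dc0)
  have mT: "vol T = L ^ CARD('n)" using measure_dcube[OF L, of a 0 a] by (simp add: T_def)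
  \<comment> \<open>Restriction to the open box common to \<open>Q\<close> and \<open>T\<close>
    loses only a null set.\<close>
  define E0 where "E0 = E \<inter> cbx a L"
  have E0m: "E0 \<in> lmeasurable" unfolding E0_def by (rule fmeasurable_Int_fmeasurable2) auto
  then have E0[measurable]: "E0 \<in> sets lebesgue" by auto
  have mE0: "vol E0 = vol (E \<inter> Q)"
    by (rule measure_negligible_symdiff[symmetric, OF E0m])
      (rule negligible_subset[OF Qm(3)], use aQ in \<open>auto simp: E0_def\<close>)
  \<comment> \<open>\<open>B\<close> asks for a child of \<open>R\<close> that is too dense, so that
    stopping happens at the parent. A parent chosen first is not too dense itself, and growing can
    start at the child and end at the parent.\<close>
  define B where "B j R \<longleftrightarrow> R \<subseteq> T \<and> (\<exists>y\<in>R. l * vol (dcube a L (Suc j) y) <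
      vol (E0 \<inter> dcube a L (Suc j) y))" for j R
  define S where "S = stop_cubes a L B"
  have S: "cube_family S" unfolding S_def by (rule cube_family_stop_cubes[OF L])
  have "\<exists>P. is_cube P \<and> P \<subseteq> R \<and> P \<subseteq> cbx a L \<and> l * vol P = vol (E \<inter> P) \<and>
      (1 - l) / 2 ^ CARD('n) * vol R \<le> vol (P - E)" if RS: "R \<in> S" for R
  proof -
    obtain j x where R: "R = dcube a L j x" "x \<in> R" "B j R" and min: "\<And>i. i < j \<Longrightarrow> \<not> B i (dcube a L i x)"
      using stop_cubes_props[OF RS[unfolded S_def]] by blast
    obtain y where y: "y \<in> R" "l * vol (dcube a L (Suc j) y) < vol (E0 \<inter> dcube a L (Suc j) y)"
      and RT: "R \<subseteq> T" using R(3) unfolding B_def by blast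
    have x0: "dcube a L 0 x = T" using RT R(2) dcube_eq unfolding T_def by blast
    \<comment> \<open>Either \<open>R\<close> is \<open>T\<close>, where the density is low by
      assumption, or it is a child of the preceding cube, which by minimality has no dense
      child.\<close>
    have Rle: "vol (E0 \<inter> R) \<le> l * vol R"
    proof (cases j)
      case 0
      then have "R = T" using R(1) x0 by simp
      then have "E0 \<inter> R = E0" using T by (auto simp: E0_def)
      then show ?thesis using mE0 less \<open>R = T\<close> mT Qm(2) by simp
    next
      case (Suc i)
      have "dcube a L i x \<subseteq> T" using dcube_mono[of 0 i a L x] x0 by simp
      then show ?thesis using min[of i] dcube_self[of x a L i] Suc R(1) unfolding B_def by force
    qed
    define d where "d = dcorner a L j x"
    define c where "c = dcorner a L (Suc j) y"
    define h2 where "h2 = L / 2 ^ j"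
    define h1 where "h1 = L / 2 ^ Suc j"
    have h: "0 < h1" "h1 \<le> h2" "h1 = h2 / 2" using L by (auto simp: h1_def h2_def field_simps)
    have "cbx c h1 \<subseteq> dcube a L (Suc j) y" unfolding c_def h1_def by (rule dcube_boxes[OF L])
    also have "\<dots> \<subseteq> R" using y(1) R(1) dcube_eq[of y a L j x] dcube_mono[of j "Suc j" a L y] by simp
    also have "R \<subseteq> cbox d (d + (\<chi> i. h2))" unfolding R(1) d_def h2_def by (rule dcube_boxes[OF L])
    finally have sub: "cbx c h1 \<subseteq> cbox d (d + (\<chi> i. h2))" .
    have cd: "d $ i \<le> c $ i" "c $ i + h1 \<le> d $ i + h2" for i
    proof -
      have "\<forall>i. c $ i < (c + (\<chi> i. h1)) $ i" using h by simp
      then have "\<forall>i. d $ i \<le> c $ i \<and> (c + (\<chi> i. h1)) $ i \<le> (d + (\<chi> i. h2)) $ i"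
        using sub unfolding subset_interval_cart by blast
      then show "d $ i \<le> c $ i" "c $ i + h1 \<le> d $ i + h2" by auto
    qed
    have "l * vol (cbx c h1) \<le> vol (E0 \<inter> cbx c h1)"
      using y(2) h measure_Int_dcube[OF L E0, of a "Suc j" y] measure_dcube[OF L, of a "Suc j" y] measure_cbx(1)[of h1 c]
      by (simp add: c_def h1_def)
    moreover have "vol (E0 \<inter> cbx d h2) \<le> l * vol (cbx d h2)"
      using Rle h measure_Int_dcube[OF L E0, of a j x] measure_dcube[OF L, of a j x] measure_cbx(1)[of h2 d] R(1)
      by (simp add: d_def h2_def)
    ultimately obtain e g where g: "h1 \<le> g" "g \<le> h2" "cbx e g \<subseteq> cbx d h2"
      and eq: "vol (E0 \<inter> cbx e g) = l * vol (cbx e g)"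
      using growing_cube[OF h(1,2) cd E0] by blast
    have PR: "cbx e g \<subseteq> R" using g(3) dcube_boxes(1)[OF L, of a j x] R(1) by (auto simp: d_def h2_def)
    have Pa: "cbx e g \<subseteq> cbx a L"
    proof -
      have "cbx e g \<subseteq> cbox a (a + (\<chi> i. L))" using PR RT T by blast
      then have "cbx e g \<subseteq> interior (cbox a (a + (\<chi> i. L)))" by (rule interior_maximal[OF _ open_box])
      then show ?thesis by (simp only: interior_cbox)
    qed
    have eqE: "vol (E \<inter> cbx e g) = l * vol (cbx e g)"
      using eq Pa by (simp add: E0_def Int_assoc Int_absorb1)
    \<comment> \<open>The density is exactly \<open>l\<close> and the side at least half that of
      \<open>R\<close>, so the part outside \<open>E\<close> is at least
      \<open>(1 - l) / 2 ^ CARD('n)\<close> of the volume of \<open>R\<close>.\<close>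
    have "vol (cbx e g - E) = vol (cbx e g) - vol (E \<inter> cbx e g)"
    proof -
      have "cbx e g - E = cbx e g - E \<inter> cbx e g" by blast
      moreover have "E \<inter> cbx e g \<in> lmeasurable" by (rule fmeasurable_Int_fmeasurable2) auto
      ultimately show ?thesis by (metis Int_lower2 lmeasurable_box measurable_measure_Diff fmeasurableD)
    qed
    also have "\<dots> = (1 - l) * g ^ CARD('n)"
      using eqE measure_cbx(1)[of g e] g h by (simp add: algebra_simps)
    also have "\<dots> \<ge> (1 - l) * (h2 / 2) ^ CARD('n)"
      using g h l by (intro mult_left_mono power_mono) auto
    finally have "(1 - l) / 2 ^ CARD('n) * vol R \<le> vol (cbx e g - E)"
      using measure_dcube[OF L, of a j x] R(1) by (simp add: h2_def power_divide mult.commute)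
    then show ?thesis
      using is_cube_cbx[of g e] g h PR Pa eqE by (intro exI[of _ "cbx e g"]) auto
  qed
  then obtain P where P: "\<And>R. R \<in> S \<Longrightarrow> is_cube (P R)" "\<And>R. R \<in> S \<Longrightarrow> P R \<subseteq> R" "\<And>R. R \<in> S \<Longrightarrow> P R \<subseteq> cbx a L"
    "\<And>R. R \<in> S \<Longrightarrow> l * vol (P R) = vol (E \<inter> P R)"
    "\<And>R. R \<in> S \<Longrightarrow> (1 - l) / 2 ^ CARD('n) * vol R \<le> vol (P R - E)"
    by metis
  have fam: "cube_family (P ` S)"
    unfolding cube_family_def
  proof
    show "disjoint (P ` S)"
      unfolding disjoint_def
    proof (intro ballI impI)
      fix A B assume "A \<in> P ` S" "B \<in> P ` S" "A \<noteq> B"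
      then obtain R R' where R: "R \<in> S" "R' \<in> S" "A = P R" "B = P R'" by blast
      then have "R \<inter> R' = {}" using cube_familyD(2)[OF S] \<open>A \<noteq> B\<close> unfolding disjoint_def by metis
      then show "A \<inter> B = {}" using P(2)[OF R(1)] P(2)[OF R(2)] R by blast
    qed
  qed (use P(1) in blast)
  have PQ: "\<Union>(P ` S) \<subseteq> cbx a L" using P(3) by blast
  note UP = cube_familyD(4)[OF fam] and US = cube_familyD(4)[OF S]
  have UPm: "\<Union>(P ` S) - E \<in> lmeasurable"
    by (rule fmeasurableI2[of "cbx a L"]) (use PQ UP in auto)
  have USm: "\<Union>S \<in> lmeasurable"
  proof (rule fmeasurableI2[of "cbox a (a + (\<chi> i. L))"])
    show "\<Union>S \<subseteq> cbox a (a + (\<chi> i. L))" unfolding S_def Union_stop_cubes B_def using T dcube_self by blast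
  qed (use US in auto)
  \<comment> \<open>A point of \<open>E0\<close> outside all stopping cubes lies in no dense cube of
    generation at least 1, which by density happens only on a null set. Generation 0 is excluded
    because \<open>B\<close> tests children.\<close>
  have null: "vol (E0 - \<Union>S) = 0"
  proof (rule dyadic_density[OF L _ l])
    show "E0 - \<Union>S \<in> lmeasurable" using E0m US by (rule fmeasurable_Diff)
    fix x k assume x: "x \<in> E0 - \<Union>S" and k: "k \<ge> (1::nat)"
    then obtain j where j: "k = Suc j" by (cases k) auto
    have "x \<in> T" using x T by (auto simp: E0_def)
    then have "dcube a L 0 x = T" unfolding T_def by (rule dcube_eq)
    then have "dcube a L j x \<subseteq> T" using dcube_mono[of 0 j a L x] by simp
    moreover have "\<not> B j (dcube a L j x)" using x unfolding S_def Union_stop_cubes by blast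
    ultimately have "vol (E0 \<inter> dcube a L k x) \<le> l * vol (dcube a L k x)"
      unfolding B_def j using dcube_self by (meson not_less)
    moreover have "vol ((E0 - \<Union>S) \<inter> dcube a L k x) \<le> vol (E0 \<inter> dcube a L k x)"
      by (rule measure_mono_fmeasurable)
        (use E0m US is_cubeD(1)[OF is_cube_dcube[OF L]] in \<open>auto intro!: fmeasurable_Int_fmeasurable\<close>)
    ultimately show "vol ((E0 - \<Union>S) \<inter> dcube a L k x) \<le> l * vol (dcube a L k x)"
      by simp
  qed
  have E0S: "vol E0 \<le> vol (\<Union>S)"
  proof -
    have "vol E0 \<le> vol (\<Union>S \<union> (E0 - \<Union>S))"
      by (rule measure_mono_fmeasurable) (use E0m USm in auto)
    also have "\<dots> \<le> vol (\<Union>S) + vol (E0 - \<Union>S)"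
      by (rule measure_Un_le) (use US in auto)
    finally show ?thesis using null by simp
  qed
  define \<kappa> where "\<kappa> = (1 - l) / 2 ^ CARD('n)"
  have \<kappa>: "0 \<le> \<kappa>" using l by (simp add: \<kappa>_def)
  have vm: "\<Union>(P ` S) - E \<in> sets lebesgue" using UP by auto
  have "(\<integral>\<^sup>+x\<in>\<Union>S. ennreal \<kappa> \<partial>lebesgue) \<le> (\<integral>\<^sup>+x\<in>\<Union>S. indicator (\<Union>(P ` S) - E) x \<partial>lebesgue)"
  proof (rule nn_integral_Union_mono[OF cube_familyD(3,2)[OF S]])
    fix R assume R: "R \<in> S"
    note Rm = is_cubeD[OF cube_familyD(1)[OF S R]]
    have PRm: "P R - E \<in> lmeasurable" using is_cubeD(2)[OF P(1)[OF R]] E by (rule fmeasurable_Diff)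
    have "(\<integral>\<^sup>+x\<in>R. ennreal \<kappa> \<partial>lebesgue) = ennreal (\<kappa> * vol R)"
      using Rm \<kappa> by (simp add: nn_integral_cmult_indicator ennreal_mult)
    also have "\<dots> \<le> ennreal (vol (P R - E))"
      using P(5)[OF R] by (intro ennreal_leI) (simp add: \<kappa>_def)
    also have "\<dots> = (\<integral>\<^sup>+x. indicator (P R - E) x \<partial>lebesgue)"
      using PRm by (simp add: emeasure_eq_measure2 fmeasurableD)
    also have "\<dots> \<le> (\<integral>\<^sup>+x\<in>R. indicator (\<Union>(P ` S) - E) x \<partial>lebesgue)"
      by (rule nn_integral_mono) (use R P(2)[OF R] in \<open>auto simp: indicator_def\<close>)
    finally show "(\<integral>\<^sup>+x\<in>R. ennreal \<kappa> \<partial>lebesgue) \<le> (\<integral>\<^sup>+x\<in>R. indicator (\<Union>(P ` S) - E) x \<partial>lebesgue)" .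
  qed (use vm cube_familyD(5)[OF S] in auto)
  also have "\<dots> \<le> (\<integral>\<^sup>+x. indicator (\<Union>(P ` S) - E) x \<partial>lebesgue)"
    by (rule nn_integral_mono) (auto simp: indicator_def)
  also have "\<dots> = ennreal (vol (\<Union>(P ` S) - E))"
    using UPm vm by (simp add: emeasure_eq_measure2)
  also have "(\<integral>\<^sup>+x\<in>\<Union>S. ennreal \<kappa> \<partial>lebesgue) = ennreal (\<kappa> * vol (\<Union>S))"
    using USm US \<kappa> by (simp add: nn_integral_cmult_indicator ennreal_mult emeasure_eq_measure2)
  finally have "\<kappa> * vol (\<Union>S) \<le> vol (\<Union>(P ` S) - E)"
    by (simp add: ennreal_le_iff)
  then have "\<kappa> * vol (E \<inter> Q) \<le> vol (\<Union>(P ` S) - E)"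
    using mult_left_mono[OF E0S[unfolded mE0] \<kappa>] by linarith
  then show ?thesis
    using PQ aQ P(4) by (intro that[OF fam]) (auto simp: \<kappa>_def)
qed

section \<open>Modulars and the condition \<open>A\<^sub>\<infinity>\<close>\<close>

definition modular :: "(real ^ 'n \<Rightarrow> real) \<Rightarrow> (real ^ 'n) set \<Rightarrow> (real ^ 'n \<Rightarrow> real) \<Rightarrow> ennreal" where
  "modular r S f = (\<integral>\<^sup>+x\<in>S. ennreal (f x powr r x) \<partial>lebesgue)"

text \<open>A sum over \<open>Q \<in> F\<close> of \<open>t\<^sub>Q \<chi>\<^sub>Q\<close> is represented by a function \<open>t\<close> of the points
  that is constant on each \<open>Q\<close>.\<close>

definition step_fun :: "(real ^ 'n) set set \<Rightarrow> (real ^ 'n \<Rightarrow> real) \<Rightarrow> bool" where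
  "step_fun F t \<longleftrightarrow> cube_family F \<and> t \<in> borel_measurable lebesgue \<and> (\<forall>x. 0 \<le> t x) \<and>
     (\<forall>Q\<in>F. \<forall>x\<in>Q. \<forall>y\<in>Q. t x = t y)"

text \<open>The condition \<open>A_infty\<close> transferred from norms to modulars, where only the
  comparison with 1 carries over; the constant therefore sits inside the function. The sets
  \<open>E_Q\<close> are merged into one \<open>E\<close>, which loses nothing because the cubes are
  disjoint.\<close>

definition A_mod :: "(real ^ 'n \<Rightarrow> real) \<Rightarrow> real \<Rightarrow> real \<Rightarrow> bool" where
  "A_mod r l C \<longleftrightarrow> (\<forall>F t E. step_fun F t \<longrightarrow> E \<in> sets lebesgue \<longrightarrow>
     (\<forall>Q\<in>F. l * vol Q \<le> vol (E \<inter> Q)) \<longrightarrow>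
     modular r (E \<inter> \<Union>F) t \<le> 1 \<longrightarrow> modular r (\<Union>F) (\<lambda>x. t x / C) \<le> 1)"

lemma step_funD:
  assumes "step_fun F t"
  shows "cube_family F" "t \<in> borel_measurable lebesgue" "\<And>x. 0 \<le> t x"
  using assms by (simp_all add: step_fun_def)

lemma step_fun_const: "step_fun F t \<Longrightarrow> Q \<in> F \<Longrightarrow> x \<in> Q \<Longrightarrow> y \<in> Q \<Longrightarrow> t x = t y"
  unfolding step_fun_def by blast

lemma step_fun_scale:
  assumes "step_fun F t" "0 \<le> c"
  shows "step_fun F (\<lambda>x. c * t x)"
proof -
  have "t \<in> borel_measurable lebesgue" using assms by (simp add: step_fun_def)
  then have "(\<lambda>x. c * t x) \<in> borel_measurable lebesgue" by (rule borel_measurable_times[OF borel_measurable_const])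
  moreover have "\<forall>Q\<in>F. \<forall>x\<in>Q. \<forall>y\<in>Q. c * t x = c * t y"
    by (intro ballI arg_cong[where f = "(*) c"]) (rule step_fun_const[OF assms(1)])
  ultimately show ?thesis
    unfolding step_fun_def using step_funD(1,3)[OF assms(1)] assms(2) by (intro conjI allI mult_nonneg_nonneg)
qed

lemma step_fun_divide:
  assumes "step_fun F t" "0 \<le> c"
  shows "step_fun F (\<lambda>x. t x / c)"
  using step_fun_scale[OF assms(1), of "1 / c"] assms(2) by (simp add: field_simps)

lemma step_fun_refine:
  assumes "step_fun F t" "cube_family G" "\<And>R. R \<in> G \<Longrightarrow> \<exists>Q\<in>F. R \<subseteq> Q"
  shows "step_fun G t"
  using assms unfolding step_fun_def by (meson subsetD)

lemma A_modD:
  assumes "A_mod r l C" "step_fun F t" "E \<in> sets lebesgue"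
    "\<And>Q. Q \<in> F \<Longrightarrow> l * vol Q \<le> vol (E \<inter> Q)" "modular r (E \<inter> \<Union>F) t \<le> 1"
  shows "modular r (\<Union>F) (\<lambda>x. t x / C) \<le> 1"
  using assms unfolding A_mod_def by blast

lemma modular_mono_set: "A \<subseteq> B \<Longrightarrow> modular r A f \<le> modular r B f"
  unfolding modular_def by (rule nn_integral_set_mono) auto

text \<open>A finite exponent with bounds at every point. The given \<open>p\<close> has such bounds
  only almost everywhere and will be tied to \<open>r\<close> by an equality almost everywhere; the
  conjugate exponent is another instance.\<close>

locale exponent =
  fixes r :: "real ^ 'n \<Rightarrow> real" and pm pp :: real
  assumes r_meas [measurable]: "r \<in> borel_measurable lebesgue"
    and pm: "1 < pm" and r_ge: "pm \<le> r x" and r_le: "r x \<le> pp"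
begin

lemma pm_le_pp: "pm \<le> pp"
  using r_ge r_le order.trans by blast

lemma r_pos: "0 < r x" "1 < r x" and pp: "1 < pp"
  using pm r_ge[of x] r_le[of x] pm_le_pp by auto

lemma modular_mono: "(\<And>x. x \<in> S \<Longrightarrow> 0 \<le> f x \<and> f x \<le> g x) \<Longrightarrow> modular r S f \<le> modular r S g"
  unfolding modular_def using r_pos(1)
  by (intro nn_integral_set_mono ennreal_leI powr_mono2) (auto intro: less_imp_le)

text \<open>As \<open>r \<ge> 1\<close>, a factor \<open>c \<le> 1\<close> satisfies
  \<open>c powr r x \<le> c\<close>. Together with the bound \<open>c powr pp\<close> for
  \<open>c \<ge> 1\<close> this is the substitute for homogeneity.\<close>

lemma modular_shrink:
  assumes [measurable]: "f \<in> borel_measurable lebesgue" "S \<in> sets lebesgue" and "\<And>x. 0 \<le> f x" "0 \<le> c" "c \<le> 1"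
  shows "modular r S (\<lambda>x. c * f x) \<le> ennreal c * modular r S f"
proof -
  have le: "c powr r x \<le> c" for x
    using assms(4,5) r_pos(2)[of x] powr_mono'[of 1 "r x" c] by (cases "c = 0") (auto simp: less_imp_le)
  have "modular r S (\<lambda>x. c * f x) \<le> (\<integral>\<^sup>+x. ennreal c * (ennreal (f x powr r x) * indicator S x) \<partial>lebesgue)"
    unfolding modular_def
  proof (rule nn_integral_mono)
    fix x
    have "(c * f x) powr r x = c powr r x * f x powr r x" using assms by (simp add: powr_mult)
    also have "\<dots> \<le> c * f x powr r x" by (intro mult_right_mono le) simp
    finally have "ennreal ((c * f x) powr r x) \<le> ennreal c * ennreal (f x powr r x)"
      using assms(4) by (simp add: ennreal_leI flip: ennreal_mult)
    then show "ennreal ((c * f x) powr r x) * indicator S x \<le> ennreal c * (ennreal (f x powr r x) * indicator S x)"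
      by (simp add: indicator_def)
  qed
  also have "\<dots> = ennreal c * modular r S f"
    unfolding modular_def by (rule nn_integral_cmult) measurable
  finally show ?thesis .
qed

lemma modular_stretch:
  assumes [measurable]: "f \<in> borel_measurable lebesgue" "S \<in> sets lebesgue" and "\<And>x. 0 \<le> f x" "1 \<le> c"
  shows "modular r S (\<lambda>x. c * f x) \<le> ennreal (c powr pp) * modular r S f"
proof -
  have le: "c powr r x \<le> c powr pp" for x
    using assms(4) r_le[of x] by (intro powr_mono) auto
  have "modular r S (\<lambda>x. c * f x) \<le> (\<integral>\<^sup>+x. ennreal (c powr pp) * (ennreal (f x powr r x) * indicator S x) \<partial>lebesgue)"
    unfolding modular_def
  proof (rule nn_integral_mono)
    fix x
    have "(c * f x) powr r x = c powr r x * f x powr r x" using assms by (simp add: powr_mult)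
    also have "\<dots> \<le> c powr pp * f x powr r x" by (intro mult_right_mono le) simp
    finally have "ennreal ((c * f x) powr r x) \<le> ennreal (c powr pp) * ennreal (f x powr r x)"
      by (simp add: ennreal_leI flip: ennreal_mult)
    then show "ennreal ((c * f x) powr r x) * indicator S x \<le> ennreal (c powr pp) * (ennreal (f x powr r x) * indicator S x)"
      by (simp add: indicator_def)
  qed
  also have "\<dots> = ennreal (c powr pp) * modular r S f"
    unfolding modular_def by (rule nn_integral_cmult) measurable
  finally show ?thesis .
qed

lemma modular_split:
  assumes [measurable]: "f \<in> borel_measurable lebesgue" "A \<in> sets lebesgue" "B \<in> sets lebesgue" and "A \<inter> B = {}"
  shows "modular r (A \<union> B) f = modular r A f + modular r B f"
  unfolding modular_def by (rule nn_integral_set_add) (use assms in auto)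

lemma modular_Un_le:
  assumes [measurable]: "f \<in> borel_measurable lebesgue" "A \<in> sets lebesgue" "B \<in> sets lebesgue"
  shows "modular r (A \<union> B) f \<le> modular r A f + modular r B f"
  unfolding modular_def by (rule nn_integral_set_Un_le) (use assms in auto)

lemma A_mod_mono: "A_mod r l C \<Longrightarrow> l \<le> l' \<Longrightarrow> A_mod r l' C"
  unfolding A_mod_def by (meson measure_nonneg mult_right_mono order.trans)

section \<open>Lowering the density constant\<close>

text \<open>In the cubes where \<open>E\<close> has density below \<open>l\<close>, add subcubes in
  which it has density at least \<open>l\<close>. The condition with \<open>l\<close> controls the
  added cubes by \<open>E\<close>, and the enlarged set has at least
  \<open>1 + (1 - l) / 2 ^ CARD('n)\<close> times the measure of \<open>E\<close> in each such cube,
  so that the condition with \<open>l1\<close> applies to it. The factor 2 makes room for the sum of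
  two modulars.\<close>

lemma A_mod_step:
  assumes A: "A_mod r l C" and l: "0 < l" "l < 1" and C: "1 \<le> C"
    and A1: "A_mod r l1 C1" and l1: "0 < l1" "l1 \<le> l" and C1: "1 \<le> C1"
  shows "A_mod r (l1 / (1 + (1 - l) / 2 ^ CARD('n))) (2 * C * C1)"
  unfolding A_mod_def
proof (intro allI impI)
  fix F t E
  define \<kappa> where "\<kappa> = (1 - l) / 2 ^ CARD('n)"
  have \<kappa>: "0 < \<kappa>" using l by (simp add: \<kappa>_def)
  assume t: "step_fun F t" and E[measurable]: "E \<in> sets lebesgue"
    and EQ: "\<forall>Q\<in>F. l1 / (1 + (1 - l) / 2 ^ CARD('n)) * vol Q \<le> vol (E \<inter> Q)"
    and le1: "modular r (E \<inter> \<Union>F) t \<le> 1"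
  note F = step_funD(1)[OF t] and tm[measurable] = step_funD(2)[OF t] and t0 = step_funD(3)[OF t]
  \<comment> \<open>The other cubes have density at least \<open>l \<ge> l1\<close> and need no
    enlargement.\<close>
  define F0 where "F0 = {Q \<in> F. vol (E \<inter> Q) < l * vol Q}"
  have "\<forall>Q\<in>F0. \<exists>\<P>. cube_family \<P> \<and> \<Union>\<P> \<subseteq> Q \<and> (\<forall>P\<in>\<P>. l * vol P \<le> vol (E \<inter> P)) \<and>
    \<kappa> * vol (E \<inter> Q) \<le> vol (\<Union>\<P> - E)"
  proof
    fix Q assume "Q \<in> F0"
    then have Q: "is_cube Q" "vol (E \<inter> Q) < l * vol Q"
      using cube_familyD(1)[OF F] by (auto simp: F0_def)
    from dense_subcubes[OF Q(1) E l Q(2)] show "\<exists>\<P>. cube_family \<P> \<and> \<Union>\<P> \<subseteq> Q \<and> (\<forall>P\<in>\<P>. l * vol P \<le> vol (E \<inter> P)) \<and>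
    \<kappa> * vol (E \<inter> Q) \<le> vol (\<Union>\<P> - E)"
      unfolding \<kappa>_def by metis
  qed
  then obtain \<P> where P: "\<And>Q. Q \<in> F0 \<Longrightarrow> cube_family (\<P> Q)" "\<And>Q. Q \<in> F0 \<Longrightarrow> \<Union>(\<P> Q) \<subseteq> Q"
    "\<And>Q P. Q \<in> F0 \<Longrightarrow> P \<in> \<P> Q \<Longrightarrow> l * vol P \<le> vol (E \<inter> P)"
    "\<And>Q. Q \<in> F0 \<Longrightarrow> \<kappa> * vol (E \<inter> Q) \<le> vol (\<Union>(\<P> Q) - E)"
    by metis
  define G where "G = (\<Union>Q\<in>F0. \<P> Q)"
  have GF: "\<exists>Q\<in>F. R \<subseteq> Q" if "R \<in> G" for R
    using that P(2) unfolding G_def F0_def by blast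
  have G: "cube_family G"
    unfolding cube_family_def
  proof
    show "\<forall>R\<in>G. is_cube R" using P(1) cube_familyD(1) unfolding G_def by blast
    show "disjoint G"
      unfolding disjoint_def
    proof (intro ballI impI)
      fix R S assume "R \<in> G" "S \<in> G" and ne: "R \<noteq> S"
      then obtain Q Q' where Q: "Q \<in> F0" "Q' \<in> F0" "R \<in> \<P> Q" "S \<in> \<P> Q'" unfolding G_def by blast
      show "R \<inter> S = {}"
      proof (cases "Q = Q'")
        case True
        then show ?thesis using cube_familyD(2)[OF P(1)[OF Q(1)]] Q ne unfolding disjoint_def by blast
      next
        case False
        then have "Q \<inter> Q' = {}" using cube_familyD(2)[OF F] Q unfolding F0_def disjoint_def by blast
        then show ?thesis using P(2)[OF Q(1)] P(2)[OF Q(2)] Q by blast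
      qed
    qed
  qed
  note UG[measurable] = cube_familyD(4)[OF G] and UF[measurable] = cube_familyD(4)[OF F]
  have UGF: "\<Union>G \<subseteq> \<Union>F" using GF by blast
  have tG: "step_fun G t" by (rule step_fun_refine[OF t G GF])
  have "modular r (E \<inter> \<Union>G) t \<le> 1"
    using le1 modular_mono_set[of "E \<inter> \<Union>G" "E \<inter> \<Union>F" r t] UGF by (meson Int_mono order.refl order.trans)
  then have m1: "modular r (\<Union>G) (\<lambda>x. t x / C) \<le> 1"
    using P(3) by (intro A_modD[OF A tG E]) (auto simp: G_def)
  define E' where "E' = E \<union> \<Union>G"
  have E'[measurable]: "E' \<in> sets lebesgue" by (auto simp: E'_def)
  have "modular r (E' \<inter> \<Union>F) (\<lambda>x. t x / (2 * C)) \<le> modular r (E \<inter> \<Union>F \<union> \<Union>G) (\<lambda>x. t x / (2 * C))"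
    by (rule modular_mono_set) (auto simp: E'_def)
  also have "\<dots> \<le> modular r (E \<inter> \<Union>F) (\<lambda>x. t x / (2 * C)) + modular r (\<Union>G) (\<lambda>x. t x / (2 * C))"
    by (rule modular_Un_le) auto
  also have "\<dots> \<le> ennreal (1 / 2) * 1 + ennreal (1 / 2) * 1"
  proof (intro add_mono)
    have "modular r (E \<inter> \<Union>F) (\<lambda>x. (1 / (2 * C)) * t x) \<le> ennreal (1 / (2 * C)) * modular r (E \<inter> \<Union>F) t"
      by (rule modular_shrink) (use C t0 in auto)
    also have "\<dots> \<le> ennreal (1 / 2) * 1"
      using C le1 by (intro mult_mono ennreal_leI) (auto simp: field_simps)
    finally show "modular r (E \<inter> \<Union>F) (\<lambda>x. t x / (2 * C)) \<le> ennreal (1 / 2) * 1" by simp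
    have "modular r (\<Union>G) (\<lambda>x. (1 / 2) * (t x / C)) \<le> ennreal (1 / 2) * modular r (\<Union>G) (\<lambda>x. t x / C)"
      by (rule modular_shrink) (use C t0 in auto)
    also have "\<dots> \<le> ennreal (1 / 2) * 1" using m1 by (intro mult_mono) auto
    finally show "modular r (\<Union>G) (\<lambda>x. t x / (2 * C)) \<le> ennreal (1 / 2) * 1" by (simp add: mult.commute)
  qed
  also have "\<dots> = ennreal (1 / 2 + 1 / 2)" by (subst ennreal_plus) auto
  also have "\<dots> = 1" by simp
  finally have m2: "modular r (E' \<inter> \<Union>F) (\<lambda>x. t x / (2 * C)) \<le> 1" .
  have "modular r (\<Union>F) (\<lambda>x. t x / (2 * C) / C1) \<le> 1"
  proof (rule A_modD[OF A1 step_fun_divide[OF t] E' _ m2])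
    show "0 \<le> 2 * C" using C by simp
    fix Q assume Q: "Q \<in> F"
    note Qm = is_cubeD(1-3)[OF cube_familyD(1)[OF F Q]]
    have m': "E' \<inter> Q \<in> lmeasurable" by (rule fmeasurable_Int_fmeasurable2[OF E' Qm(2)])
    show "l1 * vol Q \<le> vol (E' \<inter> Q)"
    proof (cases "Q \<in> F0")
      case False
      then have "l1 * vol Q \<le> vol (E \<inter> Q)"
        using Q l1 mult_right_mono[OF l1(2), of "vol Q"] by (auto simp: F0_def)
      also have "\<dots> \<le> vol (E' \<inter> Q)"
        by (rule measure_mono_fmeasurable) (use m' Qm in \<open>auto simp: E'_def\<close>)
      finally show ?thesis .
    next
      case True
      have UP: "\<Union>(\<P> Q) \<in> sets lebesgue" by (rule cube_familyD(4)[OF P(1)[OF True]])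
      have s: "E \<inter> Q \<union> (\<Union>(\<P> Q) - E) \<subseteq> E' \<inter> Q" using True P(2)[OF True] by (auto simp: E'_def G_def)
      have a: "E \<inter> Q \<in> lmeasurable" "\<Union>(\<P> Q) - E \<in> lmeasurable"
        by (rule fmeasurableI2[OF m']; use s UP Qm E in blast)+
      have "l1 / (1 + \<kappa>) * vol Q \<le> vol (E \<inter> Q)" using EQ Q by (simp add: \<kappa>_def)
      then have "l1 * vol Q \<le> (1 + \<kappa>) * vol (E \<inter> Q)"
        using \<kappa> by (simp add: field_simps)
      also have "\<dots> \<le> vol (E \<inter> Q) + vol (\<Union>(\<P> Q) - E)"
        using P(4)[OF True] by (simp add: algebra_simps)
      also have "\<dots> = vol (E \<inter> Q \<union> (\<Union>(\<P> Q) - E))"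
      proof -
        have "(E \<inter> Q) \<inter> (\<Union>(\<P> Q) - E) = {}" by blast
        then show ?thesis using measure_Un3[OF a] by simp
      qed
      also have "\<dots> \<le> vol (E' \<inter> Q)"
        by (rule measure_mono_fmeasurable[OF s]) (use a m' in auto)
      finally show ?thesis .
    qed
  qed
  then show "modular r (\<Union>F) (\<lambda>x. t x / (2 * C * C1)) \<le> 1" by simp
qed

text \<open>The dense subcubes are always taken at the original \<open>l\<close>, so every step
  divides the admissible density by the same factor \<open>1 + \<kappa>\<close>.\<close>

lemma A_mod_improve:
  assumes A: "A_mod r l C" and l: "0 < l" "l < 1" and C: "1 \<le> C" and \<eta>: "0 < \<eta>"
  shows "\<exists>C'\<ge>1. A_mod r \<eta> C'"
proof -
  define \<kappa> where "\<kappa> = (1 - l) / 2 ^ CARD('n)"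
  have \<kappa>: "0 < \<kappa>" using l by (simp add: \<kappa>_def)
  have it: "\<exists>C'\<ge>1. A_mod r (l / (1 + \<kappa>) ^ k) C'" for k
  proof (induction k)
    case 0 then show ?case using A C by auto
  next
    case (Suc k)
    then obtain C1 where C1: "C1 \<ge> 1" "A_mod r (l / (1 + \<kappa>) ^ k) C1" by blast
    have "l / (1 + \<kappa>) ^ k \<le> l" using \<kappa> l one_le_power[of "1 + \<kappa>" k] by (simp add: field_simps)
    moreover have "0 < l / (1 + \<kappa>) ^ k" using \<kappa> l by simp
    ultimately have "A_mod r (l / (1 + \<kappa>) ^ k / (1 + \<kappa>)) (2 * C * C1)"
      using A_mod_step[OF A l C C1(2) _ _ C1(1), folded \<kappa>_def] by blast
    moreover have "1 \<le> 2 * C * C1"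
      using C C1 mult_mono[of 1 "2 * C" 1 C1] by simp
    ultimately show ?case by (intro exI[of _ "2 * C * C1"]) (simp add: mult.commute)
  qed
  obtain k where "l / \<eta> < (1 + \<kappa>) ^ k" using real_arch_pow[of "1 + \<kappa>"] \<kappa> by auto
  then have "l / (1 + \<kappa>) ^ k \<le> \<eta>" using \<kappa> \<eta> by (simp add: field_simps)
  then show ?thesis using it[of k] A_mod_mono by blast
qed

text \<open>If \<open>E\<close> fills at most half of each cube, then the modular over \<open>E\<close> is smaller by a fixed factor:
  otherwise the modular over the complement of \<open>E\<close> would be too small for \<open>A\<^sub>\<infinity>\<close>.\<close>

definition contracts :: "real \<Rightarrow> bool" where
  "contracts \<gamma> \<longleftrightarrow> (\<forall>F t E. step_fun F t \<longrightarrow> E \<in> sets lebesgue \<longrightarrow>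
     (\<forall>Q\<in>F. vol (E \<inter> Q) \<le> vol Q / 2) \<longrightarrow>
     modular r (\<Union>F) t \<le> 1 \<longrightarrow> modular r (E \<inter> \<Union>F) (\<lambda>x. \<gamma> * t x) \<le> 1)"

lemma ex_contracts:
  assumes A: "A_mod r (1 / 2) C" and C: "1 \<le> C"
  obtains \<gamma> where "1 < \<gamma>" "\<gamma> \<le> 2" "contracts \<gamma>"
proof
  \<comment> \<open>If the complement of \<open>E\<close> carries modular at most
    \<open>\<epsilon>\<close>, then \<open>2 * C * t\<close> has modular at most 1 there;
    \<open>A_mod\<close> gives modular at most 1 to \<open>2 * t\<close> on all of
    \<open>\<Union>F\<close>, hence at most 1 / 2 to \<open>t\<close>.\<close>
  define \<epsilon> where "\<epsilon> = (2 * C) powr (- pp)"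
  have C2: "(2 * C) powr pp \<ge> 2 powr 1" using C pp by (intro powr_mono_both) auto
  have \<epsilon>: "0 < \<epsilon>" "\<epsilon> \<le> 1 / 2" "(2 * C) powr pp * \<epsilon> = 1"
    using C C2 by (auto simp: \<epsilon>_def powr_minus field_simps)
  \<comment> \<open>Solves \<open>\<gamma> powr pp * (1 - \<epsilon>) = 1\<close>: if
    \<open>\<gamma> * t\<close> had modular above 1 on \<open>E\<close>, then \<open>t\<close> would
    have modular above \<open>1 - \<epsilon>\<close> there, leaving at most
    \<open>\<epsilon>\<close> for the complement.\<close>
  define \<gamma> where "\<gamma> = (1 / (1 - \<epsilon>)) powr (1 / pp)"
  have b: "1 < 1 / (1 - \<epsilon>)" "1 / (1 - \<epsilon>) \<le> 2" using \<epsilon> by (auto simp: field_simps)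
  show \<gamma>: "1 < \<gamma>" unfolding \<gamma>_def using b pp by (intro gr_one_powr) auto
  have "\<gamma> \<le> (1 / (1 - \<epsilon>)) powr 1" unfolding \<gamma>_def using b pp by (intro powr_mono) auto
  also have "\<dots> = 1 / (1 - \<epsilon>)" using \<epsilon> by (intro powr_one) auto
  finally show "\<gamma> \<le> 2" using b by auto
  have \<gamma>p: "\<gamma> powr pp = 1 / (1 - \<epsilon>)" using pp \<epsilon> by (simp add: \<gamma>_def powr_powr)
  show "contracts \<gamma>"
    unfolding contracts_def
  proof (intro allI impI, rule ccontr)
    fix F t E
    assume t: "step_fun F t" and E[measurable]: "E \<in> sets lebesgue"
      and EQ: "\<forall>Q\<in>F. vol (E \<inter> Q) \<le> vol Q / 2"
      and le1: "modular r (\<Union>F) t \<le> 1" and neg: "\<not> modular r (E \<inter> \<Union>F) (\<lambda>x. \<gamma> * t x) \<le> 1"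
    note F = step_funD(1)[OF t] and tm[measurable] = step_funD(2)[OF t] and t0 = step_funD(3)[OF t]
    note UF[measurable] = cube_familyD(4)[OF F]
    have sum: "modular r (\<Union>F) t = modular r (E \<inter> \<Union>F) t + modular r (- E \<inter> \<Union>F) t"
    proof -
      have "\<Union>F = E \<inter> \<Union>F \<union> - E \<inter> \<Union>F" by blast
      moreover have "- E \<inter> \<Union>F \<in> sets lebesgue" using sets.compl_sets[OF E] UF by (auto simp: Compl_eq_Diff_UNIV)
      ultimately show ?thesis using modular_split[of t "E \<inter> \<Union>F" "- E \<inter> \<Union>F"] by auto
    qed
    have nE[measurable]: "- E \<in> sets lebesgue" using sets.compl_sets[OF E] by (simp add: Compl_eq_Diff_UNIV)
    obtain x y where xy: "modular r (E \<inter> \<Union>F) t = ennreal x" "modular r (- E \<inter> \<Union>F) t = ennreal y" "0 \<le> x" "0 \<le> y"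
      "x + y \<le> 1"
    proof -
      have "modular r (E \<inter> \<Union>F) t + modular r (- E \<inter> \<Union>F) t \<le> 1" using sum le1 by simp
      then show ?thesis using that
        by (cases "modular r (E \<inter> \<Union>F) t"; cases "modular r (- E \<inter> \<Union>F) t")
          (auto simp flip: ennreal_plus ennreal_1 simp: top_unique)
    qed
    have "1 < modular r (E \<inter> \<Union>F) (\<lambda>x. \<gamma> * t x)" using neg by simp
    also have "\<dots> \<le> ennreal (\<gamma> powr pp) * modular r (E \<inter> \<Union>F) t"
      by (rule modular_stretch) (use \<gamma> t0 in auto)
    also have "\<dots> = ennreal (x / (1 - \<epsilon>))" using \<epsilon> xy(3) unfolding \<gamma>p xy(1) by (subst ennreal_mult[symmetric]) auto
    finally have "1 - \<epsilon> < x" using \<epsilon> by (simp add: ennreal_1[symmetric] ennreal_less_iff field_simps del: ennreal_1)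
    then have y: "y \<le> \<epsilon>" and x: "1 / 2 < x" using xy \<epsilon> by auto
    have "modular r (- E \<inter> \<Union>F) (\<lambda>x. (2 * C) * t x) \<le> ennreal ((2 * C) powr pp) * modular r (- E \<inter> \<Union>F) t"
      by (rule modular_stretch) (use C t0 in auto)
    also have "\<dots> = ennreal ((2 * C) powr pp * y)" using xy by (simp add: ennreal_mult)
    also have "\<dots> \<le> ennreal ((2 * C) powr pp * \<epsilon>)" using y by (intro ennreal_leI mult_left_mono) auto
    finally have m1: "modular r (- E \<inter> \<Union>F) (\<lambda>x. (2 * C) * t x) \<le> 1" using \<epsilon> by simp
    have "modular r (\<Union>F) (\<lambda>x. (2 * C) * t x / C) \<le> 1"
    proof (rule A_modD[OF A step_fun_scale[OF t] nE _ m1])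
      show "0 \<le> 2 * C" using C by simp
      fix Q assume Q: "Q \<in> F"
      note Qm = is_cubeD(2)[OF cube_familyD(1)[OF F Q]]
      have m: "E \<inter> Q \<in> lmeasurable" by (rule fmeasurable_Int_fmeasurable2[OF E Qm])
      have "- E \<inter> Q = Q - E \<inter> Q" by blast
      then have "vol (- E \<inter> Q) = vol Q - vol (E \<inter> Q)"
        using Qm m by (metis Int_lower2 measurable_measure_Diff fmeasurableD)
      then show "1 / 2 * vol Q \<le> vol (- E \<inter> Q)" using EQ Q by fastforce
    qed
    then have m2: "modular r (\<Union>F) (\<lambda>x. 2 * t x) \<le> 1" using C by simp
    have "ennreal x \<le> modular r (\<Union>F) (\<lambda>x. (1 / 2) * (2 * t x))"
      using xy(1) modular_mono_set[of "E \<inter> \<Union>F" "\<Union>F" r t] by simp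
    also have "\<dots> \<le> ennreal (1 / 2) * modular r (\<Union>F) (\<lambda>x. 2 * t x)"
      by (rule modular_shrink) (use t0 in auto)
    also have "\<dots> \<le> ennreal (1 / 2) * 1" using m2 by (intro mult_mono) auto
    finally have "ennreal x \<le> ennreal (1 / 2)" by (simp only: mult_1_right)
    then have "x \<le> 1 / 2" by (subst (asm) ennreal_le_iff) auto
    then show False using x by simp
  qed
qed

text \<open>Iteration: pass from \<open>E\<close> to the union of the maximal dyadic cubes in which \<open>E\<close> has density above
  \<open>2\<^sup>-\<^sup>n / 2\<close>; by maximality the density is at most \<open>1 / 2\<close> there.\<close>

lemma contracts_iterate:
  assumes \<gamma>: "contracts \<gamma>" "1 < \<gamma>" and L: "0 < L" and t: "step_fun F t"
    and dy: "\<And>Q. Q \<in> F \<Longrightarrow> \<exists>k x. Q = dcube a L k x"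
    and le1: "modular r (\<Union>F) t \<le> 1"
    and E: "E \<in> sets lebesgue"
    and EQ: "\<And>Q. Q \<in> F \<Longrightarrow> vol (E \<inter> Q) \<le> (1 / 2 ^ Suc CARD('n)) ^ m * vol Q"
  shows "modular r (E \<inter> \<Union>F) (\<lambda>x. \<gamma> ^ m * t x) \<le> 1"
  using E EQ
proof (induction m arbitrary: E)
  case 0
  then show ?case using le1 modular_mono_set[of "E \<inter> \<Union>F" "\<Union>F" r t] by simp
next
  case (Suc m)
  note E[measurable] = Suc.prems(1)
  note F = step_funD(1)[OF t] and tm[measurable] = step_funD(2)[OF t] and t0 = step_funD(3)[OF t]
  note UF[measurable] = cube_familyD(4)[OF F]
  \<comment> \<open>A cube whose parent has density at most \<open>\<tau>\<close> has density at
    most \<open>2 ^ CARD('n) * \<tau> = 1 / 2\<close>.\<close>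
  define \<tau> :: real where "\<tau> = 1 / 2 ^ Suc CARD('n)"
  have \<tau>: "0 < \<tau>" "\<tau> < 1" unfolding \<tau>_def by (auto simp del: power_Suc)
  define P where "P k R \<longleftrightarrow> (\<exists>Q\<in>F. R \<subseteq> Q) \<and> \<tau> * vol R < vol (E \<inter> R)" for k :: nat and R
  define G where "G = stop_cubes a L P"
  have G: "cube_family G" unfolding G_def by (rule cube_family_stop_cubes[OF L])
  note UG[measurable] = cube_familyD(4)[OF G]
  have GF: "\<exists>Q\<in>F. R \<subseteq> Q" "\<tau> * vol R < vol (E \<inter> R)" if "R \<in> G" for R
    using stop_cubes_props[OF that[unfolded G_def]] unfolding P_def by metis+
  have UGF: "\<Union>G \<subseteq> \<Union>F" using GF by blast
  have half: "vol (E \<inter> R) \<le> vol R / 2" if RG: "R \<in> G" for R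
  proof -
    obtain k x where R: "R = dcube a L k x" "x \<in> R" and min: "\<And>j. j < k \<Longrightarrow> \<not> P j (dcube a L j x)"
      using stop_cubes_props[OF RG[unfolded G_def]] by metis
    obtain Q where Q: "Q \<in> F" "R \<subseteq> Q" using GF(1)[OF RG] by blast
    obtain j z where jz: "Q = dcube a L j z" using dy[OF Q(1)] by blast
    have "x \<in> Q" using Q R by blast
    then have Qx: "Q = dcube a L j x" using jz dcube_eq by blast
    \<comment> \<open>A cube \<open>Q\<close> of the family is never selected itself, since
      \<open>\<tau> ^ Suc m \<le> \<tau>\<close>. Hence the parent of \<open>R\<close> still lies in
      \<open>Q\<close> and was rejected for its density.\<close>
    have "j < k"
    proof (rule ccontr)
      assume "\<not> j < k"
      then have "Q \<subseteq> R" unfolding Qx R(1) by (intro dcube_mono) simp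
      then have "R = Q" using Q by simp
      have "\<tau> ^ Suc m \<le> \<tau>" using \<tau> power_le_one[of \<tau> m] by simp
      then have "vol (E \<inter> Q) \<le> \<tau> * vol Q"
        using Suc.prems(2)[OF Q(1)] unfolding \<tau>_def[symmetric]
        by (meson measure_nonneg mult_right_mono order.trans)
      then show False using GF(2)[OF RG] \<open>R = Q\<close> by simp
    qed
    then obtain i where i: "k = Suc i" "j \<le> i" by (cases k) auto
    have "dcube a L i x \<subseteq> Q" unfolding Qx by (rule dcube_mono[OF i(2)])
    then have "vol (E \<inter> dcube a L i x) \<le> \<tau> * vol (dcube a L i x)"
      using min[of i] Q(1) i unfolding P_def by (meson lessI not_less)
    also have "\<dots> = vol R / 2"
      unfolding R(1) i measure_dcube_Suc[OF L, of a i x x] by (simp add: \<tau>_def)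
    finally have "vol (E \<inter> dcube a L i x) \<le> vol R / 2" .
    moreover have "vol (E \<inter> R) \<le> vol (E \<inter> dcube a L i x)"
    proof (rule measure_mono_fmeasurable)
      show "E \<inter> R \<subseteq> E \<inter> dcube a L i x" unfolding R(1) i using dcube_mono[of i "Suc i" a L x] by auto
      show "E \<inter> dcube a L i x \<in> lmeasurable"
        by (rule fmeasurable_Int_fmeasurable2[OF E is_cubeD(2)[OF is_cube_dcube[OF L]]])
    qed (use is_cubeD(1)[OF is_cube_dcube[OF L]] R(1) E in blast)
    ultimately show ?thesis by simp
  qed
  \<comment> \<open>\<open>E\<close> has density above \<open>\<tau>\<close> in the selected cubes,
    so passing from \<open>E\<close> to their union gives up just one power of
    \<open>\<tau>\<close>.\<close>
  have grow: "vol (\<Union>G \<inter> Q) \<le> \<tau> ^ m * vol Q" if Q: "Q \<in> F" for Q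
  proof -
    note Qm = is_cubeD[OF cube_familyD(1)[OF F Q]]
    define H where "H = {R \<in> G. R \<subseteq> Q}"
    have UH: "\<Union>H = \<Union>G \<inter> Q"
    proof
      show "\<Union>G \<inter> Q \<subseteq> \<Union>H"
      proof
        fix z assume "z \<in> \<Union>G \<inter> Q"
        then obtain R where R: "R \<in> G" "z \<in> R" "z \<in> Q" by blast
        obtain Q' where Q': "Q' \<in> F" "R \<subseteq> Q'" using GF(1)[OF R(1)] by blast
        have "Q' = Q" using cube_familyD(2)[OF F] Q Q' R unfolding disjoint_def by blast
        then show "z \<in> \<Union>H" using R Q' unfolding H_def by blast
      qed
    qed (auto simp: H_def)
    have H: "cube_family H" by (rule cube_family_subset[OF G]) (auto simp: H_def)
    have m: "\<Union>G \<inter> Q \<in> lmeasurable" "E \<inter> Q \<in> lmeasurable"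
      by (rule fmeasurable_Int_fmeasurable2[OF _ Qm(2)]; fact)+
    have "(\<integral>\<^sup>+x\<in>\<Union>H. ennreal \<tau> \<partial>lebesgue) \<le> (\<integral>\<^sup>+x\<in>\<Union>H. indicator E x \<partial>lebesgue)"
    proof (rule nn_integral_Union_mono[OF cube_familyD(3,2)[OF H]])
      fix R assume R: "R \<in> H"
      then have RG: "R \<in> G" by (simp add: H_def)
      note Rm = is_cubeD[OF cube_familyD(1)[OF H R]]
      have "(\<integral>\<^sup>+x\<in>R. ennreal \<tau> \<partial>lebesgue) = ennreal (\<tau> * vol R)"
        using Rm \<tau> by (simp add: nn_integral_cmult_indicator ennreal_mult)
      also have "\<dots> \<le> ennreal (vol (E \<inter> R))"
        using GF(2)[OF RG] by (intro ennreal_leI) simp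
      also have "\<dots> = emeasure lebesgue (E \<inter> R)"
        by (rule emeasure_eq_measure2[symmetric]) (rule fmeasurable_Int_fmeasurable2[OF E Rm(2)])
      also have "\<dots> = (\<integral>\<^sup>+x\<in>R. indicator E x \<partial>lebesgue)"
        using Rm(1) by (simp add: indicator_inter_arith[symmetric])
      finally show "(\<integral>\<^sup>+x\<in>R. ennreal \<tau> \<partial>lebesgue) \<le> (\<integral>\<^sup>+x\<in>R. indicator E x \<partial>lebesgue)" .
    qed (use cube_familyD(5)[OF H] in auto)
    also have "\<dots> = emeasure lebesgue (E \<inter> (\<Union>G \<inter> Q))"
      unfolding UH using Qm(1) UG by (simp add: indicator_inter_arith[symmetric])
    also have "\<dots> \<le> emeasure lebesgue (E \<inter> Q)" by (rule emeasure_mono) (use Qm in auto)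
    also have "\<dots> = ennreal (vol (E \<inter> Q))" by (rule emeasure_eq_measure2[OF m(2)])
    also have "(\<integral>\<^sup>+x\<in>\<Union>H. ennreal \<tau> \<partial>lebesgue) = ennreal (\<tau> * vol (\<Union>G \<inter> Q))"
      unfolding UH using m \<tau> Qm UG by (simp add: nn_integral_cmult_indicator ennreal_mult emeasure_eq_measure2)
    finally have "\<tau> * vol (\<Union>G \<inter> Q) \<le> vol (E \<inter> Q)" by (simp add: ennreal_le_iff)
    also have "\<dots> \<le> \<tau> ^ Suc m * vol Q" using Suc.prems(2)[OF Q] by (simp only: \<tau>_def)
    finally show ?thesis using \<tau> by simp
  qed
  \<comment> \<open>The induction hypothesis yields \<open>\<gamma> ^ m\<close> on
    \<open>\<Union>G\<close>; one more contraction, from the cubes of \<open>G\<close> to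
    \<open>E\<close>, yields the last factor.\<close>
  have "modular r (\<Union>G \<inter> \<Union>F) (\<lambda>x. \<gamma> ^ m * t x) \<le> 1"
    by (rule Suc.IH[OF UG]) (use grow in \<open>simp only: \<tau>_def\<close>)
  moreover have "\<Union>G \<inter> \<Union>F = \<Union>G" using UGF by blast
  ultimately have mG: "modular r (\<Union>G) (\<lambda>x. \<gamma> ^ m * t x) \<le> 1" by simp
  have sG: "step_fun G (\<lambda>x. \<gamma> ^ m * t x)"
    by (rule step_fun_scale[OF step_fun_refine[OF t G GF(1)]]) (use \<gamma> in auto)
  have "modular r (E \<inter> \<Union>G) (\<lambda>x. \<gamma> * (\<gamma> ^ m * t x)) \<le> 1"
    using \<gamma>(1) sG E half mG unfolding contracts_def by blast
  then have fin: "modular r (E \<inter> \<Union>G) (\<lambda>x. \<gamma> ^ Suc m * t x) \<le> 1" by (simp add: mult.assoc)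
  have null: "E \<inter> \<Union>F - \<Union>G \<in> null_sets lebesgue"
  proof -
    have "E \<inter> \<Union>F - \<Union>G = (\<Union>Q\<in>F. E \<inter> Q - \<Union>G)" by blast
    also have "\<dots> \<in> null_sets lebesgue"
    proof (rule null_sets_UN'[OF cube_familyD(3)[OF F]])
      fix Q assume Q: "Q \<in> F"
      note Qm = is_cubeD[OF cube_familyD(1)[OF F Q]]
      obtain j z where jz: "Q = dcube a L j z" using dy[OF Q] by blast
      have EQm: "E \<inter> Q \<in> lmeasurable" by (rule fmeasurable_Int_fmeasurable2[OF E Qm(2)])
      have m: "E \<inter> Q - \<Union>G \<in> lmeasurable" by (rule fmeasurable_Diff[OF EQm UG])
      have "vol (E \<inter> Q - \<Union>G) = 0"
      proof (rule dyadic_density[OF L m \<tau>])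
        fix x k assume x: "x \<in> E \<inter> Q - \<Union>G" and k: "k \<ge> j"
        have "dcube a L k x \<subseteq> Q" unfolding jz by (rule dcube_nested[OF k dcube_self]) (use x jz in auto)
        moreover have "\<not> P k (dcube a L k x)" using x unfolding G_def Union_stop_cubes by blast
        ultimately have "vol (E \<inter> dcube a L k x) \<le> \<tau> * vol (dcube a L k x)"
          using Q unfolding P_def by (meson not_less)
        moreover have "vol ((E \<inter> Q - \<Union>G) \<inter> dcube a L k x) \<le> vol (E \<inter> dcube a L k x)"
          by (rule measure_mono_fmeasurable)
            (use fmeasurable_Int_fmeasurable2[OF E is_cubeD(2)[OF is_cube_dcube[OF L]]]
              sets.Int[OF fmeasurableD[OF m] is_cubeD(1)[OF is_cube_dcube[OF L]]] in auto)
        ultimately show "vol ((E \<inter> Q - \<Union>G) \<inter> dcube a L k x) \<le> \<tau> * vol (dcube a L k x)"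
          by simp
      qed
      then show "E \<inter> Q - \<Union>G \<in> null_sets lebesgue"
        using m by (simp add: null_sets_def emeasure_eq_measure2 fmeasurableD)
    qed
    finally show ?thesis .
  qed
  have "modular r (E \<inter> \<Union>F) (\<lambda>x. \<gamma> ^ Suc m * t x) = modular r (E \<inter> \<Union>G) (\<lambda>x. \<gamma> ^ Suc m * t x)"
    unfolding modular_def
  proof (rule nn_integral_cong_AE)
    show "AE x in lebesgue. ennreal ((\<gamma> ^ Suc m * t x) powr r x) * indicator (E \<inter> \<Union>F) x =
        ennreal ((\<gamma> ^ Suc m * t x) powr r x) * indicator (E \<inter> \<Union>G) x"
      using AE_not_in[OF null] by eventually_elim (use UGF in \<open>auto simp: indicator_def\<close>)
  qed
  then show ?case using fin by simp
qed

end

section \<open>Medians and the reverse Hoelder inequality\<close>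

definition is_median :: "(real ^ 'n \<Rightarrow> real) \<Rightarrow> (real ^ 'n) set \<Rightarrow> real \<Rightarrow> bool" where
  "is_median r Q m \<longleftrightarrow> vol Q / 2 \<le> vol {x \<in> Q. r x \<le> m} \<and>
     vol Q / 2 \<le> vol {x \<in> Q. m \<le> r x}"

lemma nn_integral_finite_Union:
  assumes "finite F" "disjoint F" "\<And>Q. Q \<in> F \<Longrightarrow> Q \<in> sets M" "u \<in> borel_measurable M"
  shows "(\<integral>\<^sup>+x\<in>\<Union>F. u x \<partial>M) = (\<Sum>Q\<in>F. \<integral>\<^sup>+x\<in>Q. u x \<partial>M)"
  using assms
proof (induction F rule: finite_induct)
  case (insert Q F)
  have d: "disjoint F" using insert.prems(1) unfolding disjoint_def by (meson insertCI)
  have "Q \<inter> R = {}" if "R \<in> F" for R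
    using insert.prems(1) insert.hyps(2) that unfolding disjoint_def by (metis insertCI)
  then have "Q \<inter> \<Union>F = {}" by blast
  then have "(\<integral>\<^sup>+x\<in>Q \<union> \<Union>F. u x \<partial>M) = (\<integral>\<^sup>+x\<in>Q. u x \<partial>M) + (\<integral>\<^sup>+x\<in>\<Union>F. u x \<partial>M)"
    using insert by (intro nn_integral_set_add) auto
  then show ?case using insert d by simp
qed simp

text \<open>Measurable because every superlevel set is the union of a subfamily, up to the
  complement of the whole family.\<close>

lemma ex_step_fun:
  assumes F: "cube_family F"
  obtains t where "t \<in> borel_measurable lebesgue" "\<And>Q x. Q \<in> F \<Longrightarrow> x \<in> Q \<Longrightarrow> t x = (g Q :: real)"
    "\<And>x. x \<notin> \<Union>F \<Longrightarrow> t x = 0"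
proof
  define t where "t x = (if x \<in> \<Union>F then g (THE Q. Q \<in> F \<and> x \<in> Q) else 0)" for x
  show t: "t x = g Q" if "Q \<in> F" "x \<in> Q" for Q x
  proof -
    have "(THE Q. Q \<in> F \<and> x \<in> Q) = Q"
      using that cube_familyD(2)[OF F] unfolding disjoint_def by (intro the_equality) blast+
    then show ?thesis using that by (auto simp: t_def)
  qed
  show t0: "t x = 0" if "x \<notin> \<Union>F" for x using that by (simp add: t_def)
  show "t \<in> borel_measurable lebesgue"
    unfolding borel_measurable_iff_greater
  proof
    fix c :: real
    have G: "cube_family {Q \<in> F. c < g Q}" by (rule cube_family_subset[OF F]) auto
    have eq: "{x \<in> space lebesgue. c < t x} = \<Union>{Q \<in> F. c < g Q} \<union> (if c < 0 then space lebesgue - \<Union>F else {})"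
      using t t0 by auto (metis Union_iff)+
    show "{x \<in> space lebesgue. c < t x} \<in> sets lebesgue"
    proof (cases "c < 0")
      case True
      show ?thesis unfolding eq if_P[OF True]
        by (intro sets.Un sets.compl_sets cube_familyD(4)[OF G] cube_familyD(4)[OF F])
    next
      case False
      show ?thesis unfolding eq if_not_P[OF False] using cube_familyD(4)[OF G] by simp
    qed
  qed
qed

context exponent
begin

text \<open>The infimum of the levels whose sublevel set fills half of \<open>Q\<close>; continuity
  of the measure from above and from below gives the two inequalities.\<close>

lemma ex_median:
  assumes Q: "is_cube Q"
  shows "\<exists>m. is_median r Q m"
proof -
  note Qm = is_cubeD[OF Q]
  have Qs[measurable]: "Q \<in> sets lebesgue" by (rule Qm)
  have sm: "{x \<in> Q. r x \<le> c} \<in> sets lebesgue" "{x \<in> Q. r x < c} \<in> sets lebesgue" "{x \<in> Q. c \<le> r x} \<in> sets lebesgue" for c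
  proof -
    have "{x \<in> Q. r x \<le> c} = Q \<inter> {x \<in> space lebesgue. r x \<le> c}" "{x \<in> Q. r x < c} = Q \<inter> {x \<in> space lebesgue. r x < c}"
      "{x \<in> Q. c \<le> r x} = Q \<inter> {x \<in> space lebesgue. c \<le> r x}" by auto
    then show "{x \<in> Q. r x \<le> c} \<in> sets lebesgue" "{x \<in> Q. r x < c} \<in> sets lebesgue" "{x \<in> Q. c \<le> r x} \<in> sets lebesgue"
      using Qs by simp_all
  qed
  have fm: "{x \<in> Q. r x \<le> c} \<in> lmeasurable" "{x \<in> Q. r x < c} \<in> lmeasurable" for c
    by (rule fmeasurableI2[OF Qm(2)]; use sm in auto)+
  define S where "S = {c. vol Q / 2 \<le> vol {x \<in> Q. r x \<le> c}}"
  have "{x \<in> Q. r x \<le> pp} = Q" using r_le by auto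
  then have S1: "pp \<in> S" using Qm(3) by (simp add: S_def)
  have S2: "pm \<le> c" if "c \<in> S" for c
  proof (rule ccontr)
    assume "\<not> pm \<le> c"
    then have "{x \<in> Q. r x \<le> c} = {}" using r_ge by (auto simp: not_le) (meson dual_order.trans not_le)
    then have "vol {x \<in> Q. r x \<le> c} = 0" by (simp only: measure_empty)
    then show False using that Qm(3) by (simp add: S_def)
  qed
  define m where "m = Inf S"
  have bdd: "bdd_below S" using S2 by (intro bdd_belowI)
  have up: "vol Q / 2 \<le> vol {x \<in> Q. r x \<le> c}" if mc: "m < c" for c
  proof -
    obtain c' where c': "c' \<in> S" "c' < c" using mc cInf_lessD[of S c] S1 unfolding m_def by blast
    have "vol {x \<in> Q. r x \<le> c'} \<le> vol {x \<in> Q. r x \<le> c}"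
      by (rule measure_mono_fmeasurable) (use c' sm fm in auto)
    then show ?thesis using c' by (simp add: S_def)
  qed
  have lo: "vol {x \<in> Q. r x \<le> c} \<le> vol Q / 2" if "c < m" for c
  proof -
    have "c \<notin> S" using that cInf_lower[OF _ bdd, of c] unfolding m_def by linarith
    then show ?thesis by (simp add: S_def)
  qed
  have "(\<lambda>k. vol {x \<in> Q. r x \<le> m + 1 / Suc k}) \<longlonglongrightarrow> vol (\<Inter>k. {x \<in> Q. r x \<le> m + 1 / Suc k})"
  proof (rule Lim_measure_decseq)
    show "decseq (\<lambda>k. {x \<in> Q. r x \<le> m + 1 / Suc k})"
    proof (rule decseq_SucI)
      fix k
      have "1 / real (Suc (Suc k)) \<le> 1 / real (Suc k)" by (simp add: field_simps)
      then show "{x \<in> Q. r x \<le> m + 1 / Suc (Suc k)} \<le> {x \<in> Q. r x \<le> m + 1 / Suc k}" by auto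
    qed
    show "emeasure lebesgue {x \<in> Q. r x \<le> m + 1 / Suc k} \<noteq> \<infinity>" for k
      unfolding infinity_ennreal_def by (rule fmeasurableD2[OF fm(1)])
  qed (use sm in blast)
  moreover have "(\<Inter>k. {x \<in> Q. r x \<le> m + 1 / Suc k}) = {x \<in> Q. r x \<le> m}"
  proof -
    have "r x \<le> m" if "\<forall>k. r x \<le> m + 1 / Suc k" for x
    proof (rule field_le_epsilon)
      fix e :: real assume "0 < e"
      then obtain k where "1 / real (Suc k) < e" using nat_approx_posE by blast
      then show "r x \<le> m + e" using that[rule_format, of k] by simp
    qed
    moreover have "r x \<le> m + 1 / Suc k" if "r x \<le> m" for x k using that by (simp add: add_increasing2)
    ultimately show ?thesis by blast
  qed
  ultimately have 1: "vol Q / 2 \<le> vol {x \<in> Q. r x \<le> m}"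
    by (intro LIMSEQ_le_const) (use up in auto)
  have "(\<lambda>k. vol {x \<in> Q. r x \<le> m - 1 / Suc k}) \<longlonglongrightarrow> vol (\<Union>k. {x \<in> Q. r x \<le> m - 1 / Suc k})"
  proof (rule Lim_measure_incseq)
    show "incseq (\<lambda>k. {x \<in> Q. r x \<le> m - 1 / Suc k})"
    proof (rule incseq_SucI)
      fix k
      have "1 / real (Suc (Suc k)) \<le> 1 / real (Suc k)" by (simp add: field_simps)
      then show "{x \<in> Q. r x \<le> m - 1 / Suc k} \<le> {x \<in> Q. r x \<le> m - 1 / Suc (Suc k)}" by auto
    qed
    have "(\<Union>k. {x \<in> Q. r x \<le> m - 1 / Suc k}) \<in> lmeasurable"
      by (rule fmeasurableI2[OF Qm(2)]) (use sm in auto)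
    then show "emeasure lebesgue (\<Union>k. {x \<in> Q. r x \<le> m - 1 / Suc k}) \<noteq> \<infinity>"
      unfolding infinity_ennreal_def by (rule fmeasurableD2)
  qed (use sm in blast)
  moreover have "(\<Union>k. {x \<in> Q. r x \<le> m - 1 / Suc k}) = {x \<in> Q. r x < m}"
  proof -
    have "\<exists>k. r x \<le> m - 1 / Suc k" if "r x < m" for x
    proof -
      have "0 < m - r x" using that by simp
      then obtain k where "1 / real (Suc k) < m - r x" using nat_approx_posE by blast
      then show ?thesis by (intro exI[of _ k]) linarith
    qed
    moreover have "r x < m" if "r x \<le> m - 1 / Suc k" for x k
    proof -
      have "0 < 1 / real (Suc k)" by simp
      then show ?thesis using that by linarith
    qed
    ultimately show ?thesis by blast
  qed
  ultimately have "vol {x \<in> Q. r x < m} \<le> vol Q / 2"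
    by (intro LIMSEQ_le_const2) (use lo in auto)
  moreover have "vol {x \<in> Q. m \<le> r x} = vol Q - vol {x \<in> Q. r x < m}"
  proof -
    have "{x \<in> Q. m \<le> r x} = Q - {x \<in> Q. r x < m}" by auto
    then show ?thesis using measurable_measure_Diff[of Q lebesgue "{x \<in> Q. r x < m}"] Qm(2) sm by auto
  qed
  ultimately show ?thesis using 1 unfolding is_median_def by auto
qed

lemma median_bounds:
  assumes Q: "is_cube Q" and m: "is_median r Q m"
  shows "pm \<le> m" "m \<le> pp"
proof -
  have "{x \<in> Q. r x \<le> m} \<noteq> {}" "{x \<in> Q. m \<le> r x} \<noteq> {}"
    using m is_cubeD(3)[OF Q] unfolding is_median_def by (auto simp del: Collect_empty_eq)
  then show "pm \<le> m" "m \<le> pp" using r_ge r_le order.trans by blast+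
qed

text \<open>On at least half of each cube, \<open>t\<^bsup>r(x)\<^esup>\<close> is at most its value with \<open>r(x)\<close> replaced by the median.\<close>

lemma A_mod_median:
  assumes A: "A_mod r (1 / 2) C" and t: "step_fun F t" and \<nu>[measurable]: "\<nu> \<in> borel_measurable lebesgue"
    and med: "\<And>Q x. Q \<in> F \<Longrightarrow> x \<in> Q \<Longrightarrow> is_median r Q (\<nu> x)"
    and \<nu>c: "\<And>Q x y. Q \<in> F \<Longrightarrow> x \<in> Q \<Longrightarrow> y \<in> Q \<Longrightarrow> \<nu> x = \<nu> y"
    and le1: "modular \<nu> (\<Union>F) t \<le> 1"
  shows "modular r (\<Union>F) (\<lambda>x. t x / C) \<le> 1"
proof -
  note F = step_funD(1)[OF t] and tm[measurable] = step_funD(2)[OF t] and t0 = step_funD(3)[OF t]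
  define E where "E = {x \<in> space lebesgue. t x powr r x \<le> t x powr \<nu> x}"
  have E[measurable]: "E \<in> sets lebesgue" unfolding E_def by measurable
  show ?thesis
  proof (rule A_modD[OF A t E])
    fix Q assume Q: "Q \<in> F"
    note Qc = cube_familyD(1)[OF F Q] note Qm = is_cubeD[OF Qc]
    obtain q where q: "q \<in> Q" using is_cube_has_point[OF Qc] by blast
    have m: "E \<inter> Q \<in> lmeasurable" by (rule fmeasurable_Int_fmeasurable2[OF E Qm(2)])
    have tq: "t x = t q" "\<nu> x = \<nu> q" if "x \<in> Q" for x
      using step_fun_const[OF t Q that q] \<nu>c[OF Q that q] by auto
    have sm: "{x \<in> Q. r x \<le> c} \<in> sets lebesgue" "{x \<in> Q. c \<le> r x} \<in> sets lebesgue" for c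
    proof -
      have "{x \<in> Q. r x \<le> c} = Q \<inter> {x \<in> space lebesgue. r x \<le> c}"
        "{x \<in> Q. c \<le> r x} = Q \<inter> {x \<in> space lebesgue. c \<le> r x}" by auto
      then show "{x \<in> Q. r x \<le> c} \<in> sets lebesgue" "{x \<in> Q. c \<le> r x} \<in> sets lebesgue"
        using Qm(1) by simp_all
    qed
    \<comment> \<open>For \<open>t \<ge> 1\<close> the good half is where \<open>r\<close> is below
      the median, for \<open>t < 1\<close> where it is above.\<close>
    have "vol Q / 2 \<le> vol (E \<inter> Q)"
    proof (cases "1 \<le> t q")
      case True
      have "{x \<in> Q. r x \<le> \<nu> q} \<subseteq> E \<inter> Q"
        using True tq by (auto simp: E_def intro!: powr_mono)
      then have "vol {x \<in> Q. r x \<le> \<nu> q} \<le> vol (E \<inter> Q)"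
        using sm m by (intro measure_mono_fmeasurable) auto
      then show ?thesis using med[OF Q q] by (simp add: is_median_def)
    next
      case False
      have "t q powr r x \<le> t q powr \<nu> q" if "\<nu> q \<le> r x" for x
        using False t0[of q] that by (cases "t q = 0") (auto intro!: powr_mono')
      then have "{x \<in> Q. \<nu> q \<le> r x} \<subseteq> E \<inter> Q"
        using tq by (auto simp: E_def)
      then have "vol {x \<in> Q. \<nu> q \<le> r x} \<le> vol (E \<inter> Q)"
        using sm m by (intro measure_mono_fmeasurable) auto
      then show ?thesis using med[OF Q q] by (simp add: is_median_def)
    qed
    then show "1 / 2 * vol Q \<le> vol (E \<inter> Q)" by simp
  next
    have "modular r (E \<inter> \<Union>F) t \<le> modular \<nu> (\<Union>F) t"
      unfolding modular_def by (rule nn_integral_set_mono) (auto simp: E_def intro: ennreal_leI)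
    then show "modular r (E \<inter> \<Union>F) t \<le> 1" using le1 by simp
  qed
qed

section \<open>Cubes on which the exponent oscillates too much\<close>

text \<open>Failure, at some height, of geometric decay of the distribution function of
  \<open>t powr (r x - m)\<close>. On a cube that is not bad this function has a controlled power
  above 1, provided \<open>\<theta> * \<tau> < 1\<close>.\<close>

definition bad :: "real \<Rightarrow> real \<Rightarrow> real \<Rightarrow> real \<Rightarrow> (real ^ 'n) set \<Rightarrow> real \<Rightarrow> bool" where
  "bad A \<theta> \<tau> m Q t \<longleftrightarrow> (\<exists>j::nat. \<tau> ^ j * vol Q < vol {x \<in> Q. A * \<theta> ^ j < t powr (r x - m)})"

lemma sets_superlevel: "Q \<in> sets lebesgue \<Longrightarrow> {x \<in> Q. c < t powr (r x - m)} \<in> sets lebesgue"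
proof -
  assume Q: "Q \<in> sets lebesgue"
  have "{x \<in> Q. c < t powr (r x - m)} = Q \<inter> {x \<in> space lebesgue. c < t powr (r x - m)}" by auto
  then show ?thesis using Q by simp
qed

text \<open>The sum over a bad family cannot lie between 1 and 2. Sort the cubes by the
  \<open>k\<close> for which the exceptional set has relative measure between
  \<open>\<tau> ^ Suc k\<close> and \<open>\<tau> ^ k\<close>. Iterated contraction gains
  \<open>g ^ (2 * k)\<close> on these sets, while \<open>t powr r x\<close> exceeds
  \<open>A * \<theta> ^ Suc k * t powr \<mu> Q\<close> there. As
  \<open>\<tau> * \<theta> = 1 / g\<close>, the cubes of index \<open>k\<close> contribute at most a
  multiple of \<open>(1 / g) ^ k / A\<close>, and the size of \<open>A\<close> makes the geometric
  series smaller than 1.\<close>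

lemma bad_family:
  assumes A: "A_mod r (1 / 2) C" and C: "1 \<le> C" and g: "contracts (g ^ 2)" "1 < g"
    and \<tau>: "\<tau> = 1 / 2 ^ Suc CARD('n)" and \<theta>: "1 \<le> \<theta>" "\<tau> * \<theta> = 1 / g"
    and Abig: "(2 * C) powr pp * g / (1 - 1 / g) < A"
    and L: "0 < L" and F: "cube_family F" "finite F" and dy: "\<And>Q. Q \<in> F \<Longrightarrow> \<exists>k x. Q = dcube a L k x"
    and med: "\<And>Q. Q \<in> F \<Longrightarrow> is_median r Q (\<mu> Q)" and t0: "\<And>Q. Q \<in> F \<Longrightarrow> 0 < t Q"
    and bad: "\<And>Q. Q \<in> F \<Longrightarrow> bad A \<theta> \<tau> (\<mu> Q) Q (t Q)"
    and sum: "(\<Sum>Q\<in>F. vol Q * t Q powr \<mu> Q) \<le> 2"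
  shows "(\<Sum>Q\<in>F. vol Q * t Q powr \<mu> Q) < 1"
proof -
  have \<tau>01: "0 < \<tau>" "\<tau> < 1" unfolding \<tau> by (auto simp del: power_Suc)
  have A0: "0 < A" 
  proof -
    have "0 \<le> (2 * C) powr pp * g / (1 - 1 / g)" using g C by simp
    then show ?thesis using Abig by linarith
  qed
  note Qc = cube_familyD(1)[OF F(1)]
  obtain T where Tm[measurable]: "T \<in> borel_measurable lebesgue" and T: "\<And>Q x. Q \<in> F \<Longrightarrow> x \<in> Q \<Longrightarrow> T x = t Q"
    and T0: "\<And>x. x \<notin> \<Union>F \<Longrightarrow> T x = 0"
    using ex_step_fun[OF F(1)] by metis
  obtain \<nu> where \<nu>m[measurable]: "\<nu> \<in> borel_measurable lebesgue" and \<nu>: "\<And>Q x. Q \<in> F \<Longrightarrow> x \<in> Q \<Longrightarrow> \<nu> x = \<mu> Q"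
    using ex_step_fun[OF F(1)] by metis
  have Tpos: "0 \<le> T x" for x
    using T t0 T0 by (cases "x \<in> \<Union>F") (auto intro: less_imp_le)
  have sT: "step_fun F T"
    unfolding step_fun_def using F(1) T Tpos by auto
  have sT2: "step_fun F (\<lambda>x. T x / 2)" by (rule step_fun_divide[OF sT]) simp
  \<comment> \<open>Halving \<open>T\<close> turns the bound 2 for the sum into the bound 1 for the
    modular with the median exponent, as \<open>\<mu> Q \<ge> 1\<close>; from there the median lemma
    passes to \<open>r\<close>.\<close>
  have "modular \<nu> (\<Union>F) (\<lambda>x. T x / 2) = (\<Sum>Q\<in>F. \<integral>\<^sup>+x\<in>Q. ennreal ((T x / 2) powr \<nu> x) \<partial>lebesgue)"
    unfolding modular_def by (rule nn_integral_finite_Union) (use F cube_familyD(2,5)[OF F(1)] in auto)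
  also have "\<dots> \<le> (\<Sum>Q\<in>F. ennreal (vol Q * t Q powr \<mu> Q / 2))"
  proof (rule sum_mono)
    fix Q assume Q: "Q \<in> F"
    note Qm = is_cubeD[OF Qc[OF Q]]
    have m1: "1 \<le> \<mu> Q" using median_bounds(1)[OF Qc[OF Q] med[OF Q]] pm by simp
    have "(t Q / 2) powr \<mu> Q = t Q powr \<mu> Q / 2 powr \<mu> Q" using t0[OF Q] by (simp add: powr_divide)
    also have "\<dots> \<le> t Q powr \<mu> Q / 2 powr 1" using m1 by (intro divide_left_mono powr_mono) auto
    finally have le: "(t Q / 2) powr \<mu> Q \<le> t Q powr \<mu> Q / 2" by simp
    have "(\<integral>\<^sup>+x\<in>Q. ennreal ((T x / 2) powr \<nu> x) \<partial>lebesgue) = (\<integral>\<^sup>+x\<in>Q. ennreal ((t Q / 2) powr \<mu> Q) \<partial>lebesgue)"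
      using T[OF Q] \<nu>[OF Q] by (intro nn_integral_cong) (auto simp: indicator_def)
    also have "\<dots> = ennreal ((t Q / 2) powr \<mu> Q * vol Q)"
      using Qm by (simp add: nn_integral_cmult_indicator ennreal_mult)
    also have "\<dots> \<le> ennreal (vol Q * t Q powr \<mu> Q / 2)"
      using mult_right_mono[OF le, of "vol Q"] by (intro ennreal_leI) (simp add: mult.commute)
    finally show "(\<integral>\<^sup>+x\<in>Q. ennreal ((T x / 2) powr \<nu> x) \<partial>lebesgue) \<le> ennreal (vol Q * t Q powr \<mu> Q / 2)" .
  qed
  also have "\<dots> = ennreal ((\<Sum>Q\<in>F. vol Q * t Q powr \<mu> Q) / 2)"
    by (simp add: sum_ennreal sum_divide_distrib)
  also have "\<dots> \<le> ennreal 1" using sum by (intro ennreal_leI) simp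
  finally have "modular \<nu> (\<Union>F) (\<lambda>x. T x / 2) \<le> 1" by simp
  then have "modular r (\<Union>F) (\<lambda>x. T x / 2 / C) \<le> 1"
    by (rule A_mod_median[OF A sT2 \<nu>m, rotated 2]) (use \<nu> med in auto)
  then have TC: "modular r (\<Union>F) (\<lambda>x. T x / (2 * C)) \<le> 1" by simp
  \<comment> \<open>The set is the one at the height \<open>j\<close> of badness, but its index is
    the first power of \<open>\<tau>\<close> below its relative measure. This index is at most
    \<open>j\<close>, so the height \<open>A * \<theta> ^ Suc i\<close> is still exceeded, and it is
    not 0, because \<open>E\<close> is contained in \<open>Q\<close>.\<close>
  have "\<exists>i E. E \<in> sets lebesgue \<and> E \<subseteq> Q \<and> vol E \<le> \<tau> ^ i * vol Q \<and> \<tau> ^ Suc i * vol Q < vol E \<and>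
      (\<forall>x\<in>E. A * \<theta> ^ Suc i < t Q powr (r x - \<mu> Q))" if Q: "Q \<in> F" for Q
  proof -
    note Qm = is_cubeD[OF Qc[OF Q]]
    obtain j where j: "\<tau> ^ j * vol Q < vol {x \<in> Q. A * \<theta> ^ j < t Q powr (r x - \<mu> Q)}"
      using bad[OF Q] unfolding bad_def by blast
    define E where "E = {x \<in> Q. A * \<theta> ^ j < t Q powr (r x - \<mu> Q)}"
    have E: "E \<in> sets lebesgue" unfolding E_def by (rule sets_superlevel[OF Qm(1)])
    have EQ: "vol E \<le> vol Q"
      by (rule measure_mono_fmeasurable[OF _ E Qm(2)]) (auto simp: E_def)
    obtain k where k: "\<tau> ^ k * vol Q < vol E" "\<And>i. i < k \<Longrightarrow> \<not> \<tau> ^ i * vol Q < vol E"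
      using exists_least_iff[of "\<lambda>k. \<tau> ^ k * vol Q < vol E"] j unfolding E_def by blast
    have "k \<le> j" using k(2)[of j] j unfolding E_def by (meson not_le)
    have "k \<noteq> 0" using k(1) EQ by (cases k) auto
    then obtain i where i: "k = Suc i" by (cases k) auto
    have "A * \<theta> ^ Suc i \<le> A * \<theta> ^ j" using \<theta>(1) A0 \<open>k \<le> j\<close> i by (intro mult_left_mono power_increasing) auto
    then have "\<forall>x\<in>E. A * \<theta> ^ Suc i < t Q powr (r x - \<mu> Q)" unfolding E_def by auto
    moreover have "vol E \<le> \<tau> ^ i * vol Q" using k(2)[of i] i by auto
    ultimately show ?thesis using E k(1) i by (intro exI[of _ i] exI[of _ E]) (auto simp: E_def)
  qed
  then obtain i E where iE: "\<And>Q. Q \<in> F \<Longrightarrow> E Q \<in> sets lebesgue" "\<And>Q. Q \<in> F \<Longrightarrow> E Q \<subseteq> Q"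
    "\<And>Q. Q \<in> F \<Longrightarrow> vol (E Q) \<le> \<tau> ^ i Q * vol Q"
    "\<And>Q. Q \<in> F \<Longrightarrow> \<tau> ^ Suc (i Q) * vol Q < vol (E Q)"
    "\<And>Q x. Q \<in> F \<Longrightarrow> x \<in> E Q \<Longrightarrow> A * \<theta> ^ Suc (i Q) < t Q powr (r x - \<mu> Q)"
    by metis
  define U where "U = (\<Union>Q\<in>F. E Q)"
  have U[measurable]: "U \<in> sets lebesgue" unfolding U_def using iE(1) F(2) by (intro sets.finite_UN) auto
  have UQ: "U \<inter> Q = E Q" if "Q \<in> F" for Q
    unfolding U_def by (rule UN_Int_cube[OF F(1) that iE(2)])
  define S where "S = (2 * C) powr pp * g / A"
  have level: "(\<Sum>Q\<in>{Q\<in>F. i Q = k}. vol Q * t Q powr \<mu> Q) \<le> S * (1 / g) ^ k" for k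
  proof -
    define G where "G = {Q\<in>F. i Q = k}"
    have GF: "G \<subseteq> F" by (auto simp: G_def)
    have G: "cube_family G" "finite G" using cube_family_subset[OF F(1) GF] finite_subset[OF GF F(2)] by auto
    have mG: "modular r (\<Union>G) (\<lambda>x. T x / (2 * C)) \<le> 1"
      using TC modular_mono_set[of "\<Union>G" "\<Union>F" r] GF by (meson Union_mono order.trans)
    have sG: "step_fun G (\<lambda>x. T x / (2 * C))"
      by (rule step_fun_divide[OF step_fun_refine[OF sT G(1)]]) (use GF C in auto)
    have "modular r (U \<inter> \<Union>G) (\<lambda>x. (g ^ 2) ^ k * (T x / (2 * C))) \<le> 1"
    proof (rule contracts_iterate[OF g(1) _ L sG _ mG U])
      show "1 < g ^ 2" using g(2) by (simp add: one_less_power)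
      show "vol (U \<inter> Q) \<le> (1 / 2 ^ Suc CARD('n)) ^ k * vol Q" if "Q \<in> G" for Q
        using iE(3)[of Q] UQ[of Q] that unfolding \<tau>[symmetric] G_def by auto
    qed (use GF dy in auto)
    moreover have "modular r (U \<inter> \<Union>G) (\<lambda>x. (g ^ 2) ^ k * (T x / (2 * C))) =
        (\<integral>\<^sup>+x\<in>\<Union>G. ennreal (((g ^ 2) ^ k * (T x / (2 * C))) powr r x) * indicator U x \<partial>lebesgue)"
      unfolding modular_def by (intro nn_integral_cong) (auto simp: indicator_def)
    moreover have "\<dots> = (\<Sum>Q\<in>G. \<integral>\<^sup>+x\<in>Q. ennreal (((g ^ 2) ^ k * (T x / (2 * C))) powr r x) * indicator U x \<partial>lebesgue)"
      by (rule nn_integral_finite_Union) (use G cube_familyD(2,5)[OF G(1)] in auto)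
    moreover have "\<dots> \<ge> (\<Sum>Q\<in>G. ennreal (vol Q * t Q powr \<mu> Q * (g ^ k / S)))"
    proof (rule sum_mono)
      fix Q assume QG: "Q \<in> G"
      then have Q: "Q \<in> F" "i Q = k" by (auto simp: G_def)
      note Qm = is_cubeD[OF Qc[OF Q(1)]]
      have Em: "E Q \<in> lmeasurable" by (rule fmeasurableI2[OF Qm(2) iE(2,1)[OF Q(1)]])
      have lower: "(g ^ 2) ^ k * (2 * C) powr (- pp) * (A * \<theta> ^ Suc k * t Q powr \<mu> Q) \<le> ((g ^ 2) ^ k * (T x / (2 * C))) powr r x"
        if x: "x \<in> E Q" for x
      proof -
        have Tx: "T x = t Q" using T[OF Q(1)] iE(2)[OF Q(1)] x by blast
        have G1: "1 \<le> (g ^ 2) ^ k" using g(2) by (simp add: one_le_power)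
        have *: "(a * (u / d)) powr y = a powr y * (u powr y * d powr (- y))" if "0 \<le> a" "0 \<le> u" "0 < d" for a u d y :: real
          using that by (simp add: powr_mult powr_divide powr_minus_divide)
        have eq: "((g ^ 2) ^ k * (T x / (2 * C))) powr r x = ((g ^ 2) ^ k) powr r x * (t Q powr r x * (2 * C) powr (- r x))"
          unfolding Tx by (rule *) (use G1 C t0[OF Q(1)] in auto)
        have le1: "(g ^ 2) ^ k \<le> ((g ^ 2) ^ k) powr r x"
          using powr_mono[of 1 "r x" "(g ^ 2) ^ k"] G1 r_pos(2)[of x] by simp
        have le2: "(2 * C) powr (- pp) \<le> (2 * C) powr (- r x)" using C r_le[of x] by (intro powr_mono) auto
        have le3: "A * \<theta> ^ Suc k * t Q powr \<mu> Q \<le> t Q powr r x"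
        proof -
          have "A * \<theta> ^ Suc k * t Q powr \<mu> Q \<le> t Q powr (r x - \<mu> Q) * t Q powr \<mu> Q"
            using iE(5)[OF Q(1) x] Q(2) by (intro mult_right_mono) auto
          also have "\<dots> = t Q powr r x" by (simp flip: powr_add)
          finally show ?thesis .
        qed
        have nn: "0 \<le> A * \<theta> ^ Suc k * t Q powr \<mu> Q" using A0 \<theta>(1) by (intro mult_nonneg_nonneg) auto
        have "(g ^ 2) ^ k * (2 * C) powr (- pp) * (A * \<theta> ^ Suc k * t Q powr \<mu> Q) =
            (g ^ 2) ^ k * ((A * \<theta> ^ Suc k * t Q powr \<mu> Q) * (2 * C) powr (- pp))" by (simp only: mult_ac)
        also have "\<dots> \<le> ((g ^ 2) ^ k) powr r x * (t Q powr r x * (2 * C) powr (- r x))"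
          by (intro mult_mono le1 le2 le3 mult_nonneg_nonneg nn powr_ge_zero)
        finally show ?thesis unfolding eq .
      qed
      \<comment> \<open>Balance of powers: \<open>g ^ (2 * k)\<close> from contraction against
        \<open>(\<tau> * \<theta>) ^ Suc k = 1 / g ^ Suc k\<close> leaves \<open>g ^ k / g\<close>;
        the remaining constants are collected in \<open>S\<close>.\<close>
      have "vol Q * t Q powr \<mu> Q * (g ^ k / S) =
          ((g ^ 2) ^ k * (2 * C) powr (- pp) * (A * \<theta> ^ Suc k * t Q powr \<mu> Q)) * (\<tau> ^ Suc k * vol Q)"
      proof -
        have "(\<tau> * \<theta>) ^ Suc k = 1 / (g * g ^ k)" using \<theta>(2) by (simp add: power_divide)
        then have e: "\<theta> ^ Suc k * \<tau> ^ Suc k = 1 / (g * g ^ k)" by (simp only: power_mult_distrib mult.commute)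
        have gg: "(g ^ 2) ^ k = g ^ k * g ^ k" by (simp add: power_mult_distrib power2_eq_square)
        have "((g ^ 2) ^ k * (2 * C) powr (- pp) * (A * \<theta> ^ Suc k * t Q powr \<mu> Q)) * (\<tau> ^ Suc k * vol Q)
          = (g ^ 2) ^ k * (2 * C) powr (- pp) * A * t Q powr \<mu> Q * vol Q * (\<theta> ^ Suc k * \<tau> ^ Suc k)"
          by (simp only: mult_ac)
        also have "\<dots> = vol Q * t Q powr \<mu> Q * (g ^ k / S)"
          unfolding e gg S_def using g(2) A0 C by (simp add: powr_minus field_simps)
        finally show ?thesis by simp
      qed
      also have "\<dots> \<le> ((g ^ 2) ^ k * (2 * C) powr (- pp) * (A * \<theta> ^ Suc k * t Q powr \<mu> Q)) * vol (E Q)"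
        using iE(4)[OF Q(1)] Q(2) A0 \<theta>(1) g(2) by (intro mult_left_mono mult_nonneg_nonneg) auto
      finally have "ennreal (vol Q * t Q powr \<mu> Q * (g ^ k / S)) \<le>
          ennreal (((g ^ 2) ^ k * (2 * C) powr (- pp) * (A * \<theta> ^ Suc k * t Q powr \<mu> Q)) * vol (E Q))"
        by (rule ennreal_leI)
      also have "\<dots> = (\<integral>\<^sup>+x\<in>E Q. ennreal ((g ^ 2) ^ k * (2 * C) powr (- pp) * (A * \<theta> ^ Suc k * t Q powr \<mu> Q)) \<partial>lebesgue)"
        using Em A0 \<theta>(1) g(2) by (simp add: nn_integral_cmult_indicator fmeasurableD emeasure_eq_measure2 ennreal_mult del: power_Suc)
      also have "\<dots> \<le> (\<integral>\<^sup>+x\<in>Q. ennreal (((g ^ 2) ^ k * (T x / (2 * C))) powr r x) * indicator U x \<partial>lebesgue)"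
        using lower iE(2)[OF Q(1)] Q(1) by (intro nn_integral_mono) (auto simp: indicator_def U_def intro!: ennreal_leI)
      finally show "ennreal (vol Q * t Q powr \<mu> Q * (g ^ k / S)) \<le>
          (\<integral>\<^sup>+x\<in>Q. ennreal (((g ^ 2) ^ k * (T x / (2 * C))) powr r x) * indicator U x \<partial>lebesgue)" .
    qed
    moreover have S0: "0 < S" using g A0 C by (simp add: S_def)
    then have "(\<Sum>Q\<in>G. ennreal (vol Q * t Q powr \<mu> Q * (g ^ k / S))) =
        ennreal ((\<Sum>Q\<in>G. vol Q * t Q powr \<mu> Q) * (g ^ k / S))"
      unfolding sum_distrib_right using g(2) by (intro sum_ennreal mult_nonneg_nonneg) auto
    ultimately have "ennreal ((\<Sum>Q\<in>G. vol Q * t Q powr \<mu> Q) * (g ^ k / S)) \<le> ennreal 1"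
      unfolding ennreal_1 by (metis (no_types, lifting) order.trans)
    then have "(\<Sum>Q\<in>G. vol Q * t Q powr \<mu> Q) * (g ^ k / S) \<le> 1" by (subst (asm) ennreal_le_iff) auto
    then show ?thesis using S0 g(2) unfolding G_def[symmetric] by (simp add: field_simps)
  qed
  have "(\<Sum>Q\<in>F. vol Q * t Q powr \<mu> Q) = (\<Sum>k\<in>i ` F. \<Sum>Q\<in>{Q\<in>F. i Q = k}. vol Q * t Q powr \<mu> Q)"
    by (rule sum.image_gen[OF F(2)])
  also have "\<dots> \<le> (\<Sum>k\<in>i ` F. S * (1 / g) ^ k)" by (rule sum_mono) (rule level)
  also have "\<dots> = S * (\<Sum>k\<in>i ` F. (1 / g) ^ k)" by (simp add: sum_distrib_left)
  also have "\<dots> \<le> S * (1 / (1 - 1 / g))"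
  proof (rule mult_left_mono)
    have "summable (\<lambda>k. (1 / g) ^ k)" using g(2) by (intro summable_geometric) auto
    then have "(\<Sum>k\<in>i ` F. (1 / g) ^ k) \<le> (\<Sum>k. (1 / g) ^ k)"
      using F(2) g(2) by (intro sum_le_suminf) auto
    also have "\<dots> = 1 / (1 - 1 / g)" using g(2) by (intro suminf_geometric) auto
    finally show "(\<Sum>k\<in>i ` F. (1 / g) ^ k) \<le> 1 / (1 - 1 / g)" .
    show "0 \<le> S" using g A0 C by (simp add: S_def)
  qed
  also have "\<dots> = (2 * C) powr pp * g / (1 - 1 / g) / A" by (simp add: S_def)
  also have "\<dots> < 1" unfolding divide_less_eq_1_pos[OF A0] by (rule Abig)
  finally show ?thesis .
qed

text \<open>Layer cake over the heights \<open>A * \<theta> ^ j\<close>: the part of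
  \<open>Q\<close> above the height of index \<open>j\<close> has relative measure at most
  \<open>\<tau> ^ j\<close>, and the series of \<open>(\<theta> powr s * \<tau>) ^ j\<close>
  converges.\<close>

lemma not_bad_integral:
  assumes Q: "is_cube Q" and nb: "\<not> bad A \<theta> \<tau> m Q t"
    and A: "0 < A" and \<theta>: "1 < \<theta>" and \<tau>: "0 < \<tau>" and s: "0 < s" "\<theta> powr s * \<tau> < 1"
  shows "(\<integral>\<^sup>+x\<in>Q. ennreal (t powr (s * (r x - m))) \<partial>lebesgue) \<le>
    ennreal ((A powr s + (A * \<theta>) powr s / (1 - \<theta> powr s * \<tau>)) * vol Q)"
proof -
  note Qm = is_cubeD[OF Q]
  define w where "w x = t powr (r x - m)" for x
  have w[measurable]: "w \<in> borel_measurable lebesgue" unfolding w_def by measurable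
  have [measurable]: "Q \<in> sets lebesgue" by (rule Qm)
  define E where "E j = {x \<in> Q. A * \<theta> ^ j < w x}" for j :: nat
  have Es[measurable]: "E j \<in> sets lebesgue" for j unfolding E_def w_def by (rule sets_superlevel[OF Qm(1)])
  have Em: "E j \<in> lmeasurable" for j by (rule fmeasurableI2[OF Qm(2)]) (auto simp: E_def intro: Es[unfolded E_def])
  have mE: "vol (E j) \<le> \<tau> ^ j * vol Q" for j
    using nb unfolding bad_def E_def w_def by (simp add: not_less)
  define c where "c j = (A * \<theta> ^ Suc j) powr s" for j :: nat
  have pw: "ennreal (t powr (s * (r x - m))) * indicator Q x \<le>
      ennreal (A powr s) * indicator Q x + (\<Sum>j. ennreal (c j) * indicator (E j) x)" for x
  proof (cases "x \<in> Q")
    case True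
    have ws: "t powr (s * (r x - m)) = w x powr s" by (simp add: w_def powr_powr mult.commute)
    have w0: "0 \<le> w x" by (simp add: w_def)
    show ?thesis
    proof (cases "w x \<le> A")
      case True
      then have "w x powr s \<le> A powr s" using s w0 by (intro powr_mono2) auto
      then show ?thesis unfolding ws using \<open>x \<in> Q\<close> by (simp add: add_increasing2 ennreal_leI)
    next
      case False
      obtain k0 where "w x / A < \<theta> ^ k0" using real_arch_pow[OF \<theta>] by blast
      then have "w x \<le> A * \<theta> ^ k0" using A by (simp add: field_simps)
      then obtain k where k: "w x \<le> A * \<theta> ^ k" "\<And>i. i < k \<Longrightarrow> \<not> w x \<le> A * \<theta> ^ i"
        using exists_least_iff[of "\<lambda>k. w x \<le> A * \<theta> ^ k"] by blast
      have "k \<noteq> 0" using k(1) False by (cases k) auto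
      then obtain j where j: "k = Suc j" by (cases k) auto
      have "x \<in> E j" using k(2)[of j] j \<open>x \<in> Q\<close> by (auto simp: E_def)
      have "w x powr s \<le> c j" unfolding c_def using k(1) j s w0 by (intro powr_mono2) auto
      then have "ennreal (w x powr s) \<le> ennreal (c j) * indicator (E j) x"
        using \<open>x \<in> E j\<close> by (simp add: ennreal_leI)
      also have "\<dots> \<le> (\<Sum>j. ennreal (c j) * indicator (E j) x)"
      proof -
        define f where "f j = ennreal (c j) * indicator (E j) x" for j
        have "sum f {j} \<le> suminf f" by (rule sum_le_suminf) auto
        then have "f j \<le> suminf f" by simp
        then show ?thesis unfolding f_def .
      qed
      finally show ?thesis unfolding ws using \<open>x \<in> Q\<close> by (simp add: add_increasing)
    qed
  qed simp
  have "(\<integral>\<^sup>+x\<in>Q. ennreal (t powr (s * (r x - m))) \<partial>lebesgue) \<le>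
      (\<integral>\<^sup>+x. ennreal (A powr s) * indicator Q x + (\<Sum>j. ennreal (c j) * indicator (E j) x) \<partial>lebesgue)"
    by (rule nn_integral_mono) (rule pw)
  also have "\<dots> = (\<integral>\<^sup>+x. ennreal (A powr s) * indicator Q x \<partial>lebesgue) + (\<integral>\<^sup>+x. (\<Sum>j. ennreal (c j) * indicator (E j) x) \<partial>lebesgue)"
    by (rule nn_integral_add) measurable
  also have "(\<integral>\<^sup>+x. (\<Sum>j. ennreal (c j) * indicator (E j) x) \<partial>lebesgue) = (\<Sum>j. \<integral>\<^sup>+x. ennreal (c j) * indicator (E j) x \<partial>lebesgue)"
    by (rule nn_integral_suminf) measurable
  also have "\<dots> \<le> (\<Sum>j. ennreal ((A * \<theta>) powr s * vol Q * (\<theta> powr s * \<tau>) ^ j))"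
  proof (rule suminf_le)
    fix j
    have cj: "c j = (A * \<theta>) powr s * (\<theta> powr s) ^ j"
    proof -
      have "A * \<theta> ^ Suc j = (A * \<theta>) * \<theta> ^ j" by simp
      then have "c j = (A * \<theta>) powr s * (\<theta> ^ j) powr s" unfolding c_def using A \<theta> by (simp only: powr_mult)
      also have "(\<theta> ^ j) powr s = (\<theta> powr s) ^ j" using \<theta> by (simp add: powr_powr powr_realpow[symmetric] mult.commute)
      finally show ?thesis .
    qed
    have "(\<integral>\<^sup>+x. ennreal (c j) * indicator (E j) x \<partial>lebesgue) = ennreal (c j * vol (E j))"
      using Em by (simp add: nn_integral_cmult_indicator emeasure_eq_measure2 ennreal_mult c_def)
    also have "\<dots> \<le> ennreal (c j * (\<tau> ^ j * vol Q))"
      using mE by (intro ennreal_leI mult_left_mono) (auto simp: c_def)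
    also have "c j * (\<tau> ^ j * vol Q) = (A * \<theta>) powr s * vol Q * (\<theta> powr s * \<tau>) ^ j"
      unfolding cj by (simp add: power_mult_distrib mult_ac)
    finally show "(\<integral>\<^sup>+x. ennreal (c j) * indicator (E j) x \<partial>lebesgue) \<le> ennreal ((A * \<theta>) powr s * vol Q * (\<theta> powr s * \<tau>) ^ j)" .
  qed auto
  also have "\<dots> = ennreal ((A * \<theta>) powr s * vol Q * (1 / (1 - \<theta> powr s * \<tau>)))"
    using s \<tau> by (intro suminf_ennreal_eq sums_mult geometric_sums) (auto simp: zero_le_mult_iff)
  also have "(\<integral>\<^sup>+x. ennreal (A powr s) * indicator Q x \<partial>lebesgue) = ennreal (A powr s * vol Q)"
    using Qm by (simp add: nn_integral_cmult_indicator ennreal_mult)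
  also have "ennreal (A powr s * vol Q) + ennreal ((A * \<theta>) powr s * vol Q * (1 / (1 - \<theta> powr s * \<tau>)))
    = ennreal ((A powr s + (A * \<theta>) powr s / (1 - \<theta> powr s * \<tau>)) * vol Q)"
    using s by (subst ennreal_plus[symmetric]) (auto simp: algebra_simps)
  finally show ?thesis by (simp add: add_left_mono)
qed

end

text \<open>Adding the terms one at a time, the partial sums cannot jump over the interval from 1 to
  2.\<close>

lemma ex_subfamily_sum:
  fixes f :: "'a \<Rightarrow> real"
  assumes "finite F" "\<And>x. x \<in> F \<Longrightarrow> f x \<le> 1" "1 \<le> sum f F"
  shows "\<exists>G\<subseteq>F. 1 \<le> sum f G \<and> sum f G \<le> 2"
  using assms
proof (induction F rule: finite_induct)
  case (insert x F)
  show ?case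
  proof (cases "1 \<le> sum f F")
    case True
    then obtain G where "G \<subseteq> F" "1 \<le> sum f G" "sum f G \<le> 2" using insert by auto
    then show ?thesis by (intro exI[of _ G]) auto
  next
    case False
    then show ?thesis using insert.hyps insert.prems(1)[of x] insert.prems(2) by (intro exI[of _ "insert x F"]) auto
  qed
qed auto

text \<open>\<open>\<beta> Q\<close> is the threshold below which \<open>t\<^bsup>r\<^esup>\<close> need not be comparable to its median on \<open>Q\<close>.\<close>

definition thresholds :: "(real ^ 'n) set set \<Rightarrow> real \<Rightarrow> ((real ^ 'n) set \<Rightarrow> real) \<Rightarrow> bool" where
  "thresholds \<D> K \<beta> \<longleftrightarrow> (\<forall>Q. 0 \<le> \<beta> Q \<and> \<beta> Q \<le> 1) \<and>
     (\<forall>F. finite F \<longrightarrow> cube_family F \<longrightarrow> F \<subseteq> \<D> \<longrightarrow> (\<Sum>Q\<in>F. vol Q * \<beta> Q) \<le> K)"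

text \<open>The alternatives delimit the \<open>t\<close> that are under control: above 1, those for
  which the constant \<open>t\<close> has modular at most 1 on \<open>Q\<close> with exponent
  \<open>m\<close>; below 1, those exceeding the threshold \<open>b\<close>.\<close>

definition rev_holder :: "(real ^ 'n \<Rightarrow> real) \<Rightarrow> real \<Rightarrow> real \<Rightarrow> (real ^ 'n) set \<Rightarrow> real \<Rightarrow> real \<Rightarrow> bool" where
  "rev_holder r s K Q m b \<longleftrightarrow> (\<forall>t>0. t \<le> 1 \<and> b < t powr m \<or> 1 \<le> t \<and> vol Q * t powr m \<le> 1 \<longrightarrow>
     (\<integral>\<^sup>+x\<in>Q. ennreal (t powr (s * (r x - m))) \<partial>lebesgue) \<le> ennreal (K * vol Q))"

lemma thresholds_nonneg:
  assumes "thresholds \<D> K \<beta>" shows "0 \<le> K"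
proof -
  have "cube_family {}" by (simp add: cube_family_def disjoint_def)
  then have "(\<Sum>Q\<in>{}. vol Q * \<beta> Q) \<le> K" using assms unfolding thresholds_def by blast
  then show ?thesis by simp
qed

text \<open>\<open>s\<close> and \<open>K\<close> come before grid and medians, because they must
  serve all grids at once. \<open>\<beta> Q\<close> is the supremum of \<open>t powr \<mu> Q\<close>
  over bad \<open>t \<le> 1\<close> of median modular at most 1, so its sums over disjoint cubes
  inherit the bound for bad families. Any other bad \<open>t\<close> lies between 1 and the value of
  median modular exactly 1, which is never bad.\<close>

lemma (in exponent) reverse_holder:
  assumes A: "A_mod r (1 / 2) C" and C: "1 \<le> C"
  obtains s K where "1 < s" "1 \<le> K"
    "\<forall>\<mu> a L. 0 < L \<longrightarrow> (\<forall>Q. is_cube Q \<longrightarrow> is_median r Q (\<mu> Q)) \<longrightarrow>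
      (\<exists>\<beta>. thresholds {dcube a L k x | k x. True} 2 \<beta> \<and>
        (\<forall>k x. rev_holder r s K (dcube a L k x) (\<mu> (dcube a L k x)) (\<beta> (dcube a L k x))))"
proof -
  obtain \<gamma> where \<gamma>: "1 < \<gamma>" "\<gamma> \<le> 2" "contracts \<gamma>" using ex_contracts[OF A C] by blast
  \<comment> \<open>The contraction factor \<open>\<gamma>\<close> is spent in two halves: one
    \<open>g\<close> pays for \<open>\<tau> * \<theta> = 1 / g\<close>, the other leaves a
    convergent geometric series. The bound \<open>g < 2\<close> keeps \<open>\<theta>\<close> above
    1.\<close>
  define g where "g = sqrt \<gamma>"
  have g: "1 < g" "g ^ 2 = \<gamma>" "g < 2" using \<gamma> by (auto simp: g_def real_less_rsqrt intro!: real_less_lsqrt)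
  define \<tau> :: real where "\<tau> = 1 / 2 ^ Suc CARD('n)"
  have \<tau>: "0 < \<tau>" "\<tau> < 1" unfolding \<tau>_def by (auto simp del: power_Suc)
  have \<tau>2: "\<tau> \<le> 1 / 2" unfolding \<tau>_def by simp
  define \<theta> where "\<theta> = 1 / (g * \<tau>)"
  have \<theta>: "1 < \<theta>" "\<tau> * \<theta> = 1 / g"
  proof -
    have "g * \<tau> < 2 * (1 / 2)" using g \<tau> \<tau>2 by (intro mult_less_le_imp_less) auto
    then show "1 < \<theta>" using g \<tau> by (simp add: \<theta>_def)
    show "\<tau> * \<theta> = 1 / g" using \<tau> by (simp add: \<theta>_def)
  qed
  define A where "A = (2 * C) powr pp * g / (1 - 1 / g) + 1"
  have A0: "0 < A"
  proof -
    have "0 \<le> (2 * C) powr pp * g / (1 - 1 / g)" using g C by simp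
    then show ?thesis unfolding A_def by linarith
  qed
  \<comment> \<open>Then \<open>\<theta> powr (s - 1) = sqrt g\<close>, hence
    \<open>\<theta> powr s * \<tau> = sqrt g / g < 1\<close>.\<close>
  define s where "s = 1 + ln g / (2 * ln \<theta>)"
  have s: "1 < s" using g \<theta> by (simp add: s_def)
  have "\<theta> powr (ln g / (2 * ln \<theta>)) = exp (ln g / 2)" using \<theta> by (simp add: powr_def)
  also have "\<dots> < exp (ln g)" unfolding exp_less_cancel_iff using g by simp
  finally have "\<theta> powr (ln g / (2 * ln \<theta>)) < g" using g by simp
  then have s\<tau>: "\<theta> powr s * \<tau> < 1"
  proof -
    have "\<theta> powr s * \<tau> = (\<tau> * \<theta>) * \<theta> powr (ln g / (2 * ln \<theta>))" using \<theta>(1) by (simp add: s_def powr_add)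
    also have "\<dots> < (1 / g) * g" unfolding \<theta>(2) using g \<open>\<theta> powr (ln g / (2 * ln \<theta>)) < g\<close> by (intro mult_strict_left_mono) auto
    finally show ?thesis using g by simp
  qed
  define K0 where "K0 = A powr s + (A * \<theta>) powr s / (1 - \<theta> powr s * \<tau>)"
  have K0: "0 \<le> K0" using s\<tau> by (simp add: K0_def)
  show ?thesis
  proof (rule that[of s "1 + K0"], goal_cases)
    case 3
    show ?case
    proof (intro allI impI)
      fix \<mu> and a :: "real ^ 'n" and L :: real
      assume L: "0 < L" and med0: "\<forall>Q. is_cube Q \<longrightarrow> is_median r Q (\<mu> Q)"
      then have med: "\<And>Q. is_cube Q \<Longrightarrow> is_median r Q (\<mu> Q)" by blast
      define \<D> where "\<D> = {dcube a L k x | k x. True}"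
      define B where "B Q t \<longleftrightarrow> 0 < t \<and> vol Q * t powr \<mu> Q \<le> 1 \<and> bad A \<theta> \<tau> (\<mu> Q) Q t" for Q t
      \<comment> \<open>Single terms are at most 1 by \<open>B\<close>, so a sum of at least 1 would
        contain a subfamily with sum between 1 and 2, which \<open>bad_family\<close> rules
        out.\<close>
      have key: "(\<Sum>Q\<in>F. vol Q * t Q powr \<mu> Q) < 1"
        if F: "cube_family F" "finite F" "F \<subseteq> \<D>" and B: "\<And>Q. Q \<in> F \<Longrightarrow> B Q (t Q)" for F t
      proof (rule ccontr)
        assume "\<not> (\<Sum>Q\<in>F. vol Q * t Q powr \<mu> Q) < 1"
        then have "1 \<le> (\<Sum>Q\<in>F. vol Q * t Q powr \<mu> Q)" by simp
        then obtain G where G: "G \<subseteq> F" "1 \<le> (\<Sum>Q\<in>G. vol Q * t Q powr \<mu> Q)" "(\<Sum>Q\<in>G. vol Q * t Q powr \<mu> Q) \<le> 2"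
          using ex_subfamily_sum[OF F(2), of "\<lambda>Q. vol Q * t Q powr \<mu> Q"] B unfolding B_def by blast
        have "(\<Sum>Q\<in>G. vol Q * t Q powr \<mu> Q) < 1"
        proof (rule bad_family[OF assms \<gamma>(3)[folded g(2)] g(1) \<tau>_def _ \<theta>(2) _ L cube_family_subset[OF F(1) G(1)] finite_subset[OF G(1) F(2)]])
          show "(2 * C) powr pp * g / (1 - 1 / g) < A" by (simp add: A_def)
        qed (use G F B \<theta> med cube_familyD(1)[OF F(1)] in \<open>auto simp: \<D>_def B_def\<close>)
        then show False using G by simp
      qed
      \<comment> \<open>The element 0 keeps the supremum meaningful and gives threshold 0 to cubes
        without bad \<open>t\<close>.\<close>
      define X where "X Q = insert 0 {t powr \<mu> Q | t. t \<le> 1 \<and> B Q t}" for Q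
      define \<beta> where "\<beta> Q = (if Q \<in> \<D> then Sup (X Q) else 0)" for Q
      have X: "0 \<le> y" "y \<le> 1" if "y \<in> X Q" "Q \<in> \<D>" for y Q
      proof -
        have "is_cube Q" using that(2) is_cube_dcube[OF L] by (auto simp: \<D>_def)
        then have "0 \<le> \<mu> Q" using median_bounds(1)[OF _ med] pm by force
        then show "0 \<le> y" "y \<le> 1" using that(1) by (auto simp: X_def B_def intro: powr_le1)
      qed
      have bdd: "bdd_above (X Q)" if "Q \<in> \<D>" for Q using X(2)[OF _ that] by (intro bdd_aboveI)
      have \<beta>01: "0 \<le> \<beta> Q" "\<beta> Q \<le> 1" for Q
      proof -
        have "0 \<le> Sup (X Q) \<and> Sup (X Q) \<le> 1" if "Q \<in> \<D>"
        proof
          have "0 \<in> X Q" by (simp add: X_def)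
          then show "0 \<le> Sup (X Q)" using bdd[OF that] by (rule cSup_upper)
          show "Sup (X Q) \<le> 1" using \<open>0 \<in> X Q\<close> X(2)[OF _ that] by (intro cSup_least) auto
        qed
        then show "0 \<le> \<beta> Q" "\<beta> Q \<le> 1" by (auto simp: \<beta>_def)
      qed
      have "thresholds \<D> 2 \<beta>"
        unfolding thresholds_def
      proof (intro conjI allI impI \<beta>01)
        fix F :: "(real ^ 'n) set set" assume F: "finite F" "cube_family F" "F \<subseteq> \<D>"
        define G where "G = {Q \<in> F. 0 < \<beta> Q}"
        have GF: "G \<subseteq> F" by (auto simp: G_def)
        \<comment> \<open>A bad \<open>t\<close> that is extremal up to a factor 2, whence the 2 in
          the bound for the sums of \<open>\<beta>\<close>.\<close>
        have "\<exists>t. B Q t \<and> \<beta> Q / 2 < t powr \<mu> Q" if "Q \<in> G" for Q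
        proof -
          have Q: "Q \<in> \<D>" "0 < \<beta> Q" using that F by (auto simp: G_def)
          then have "\<beta> Q / 2 < Sup (X Q)" by (simp add: \<beta>_def)
          moreover have "X Q \<noteq> {}" by (simp add: X_def)
          ultimately obtain y where "y \<in> X Q" "\<beta> Q / 2 < y" using less_cSupD by metis
          then show ?thesis using Q by (auto simp: X_def)
        qed
        then obtain t where t: "\<And>Q. Q \<in> G \<Longrightarrow> B Q (t Q)" "\<And>Q. Q \<in> G \<Longrightarrow> \<beta> Q / 2 < t Q powr \<mu> Q" by metis
        have "(\<Sum>Q\<in>F. vol Q * \<beta> Q) = (\<Sum>Q\<in>G. vol Q * \<beta> Q)"
        proof (rule sum.mono_neutral_right[OF F(1) GF], intro ballI)
          fix Q assume "Q \<in> F - G"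
          then have "\<beta> Q = 0" using \<beta>01(1)[of Q] by (auto simp: G_def)
          then show "vol Q * \<beta> Q = 0" by simp
        qed
        also have "\<dots> \<le> (\<Sum>Q\<in>G. vol Q * (2 * t Q powr \<mu> Q))"
          using t(2) by (intro sum_mono mult_left_mono) (auto simp: less_imp_le field_simps)
        also have "\<dots> = 2 * (\<Sum>Q\<in>G. vol Q * t Q powr \<mu> Q)" by (simp add: sum_distrib_left mult_ac)
        also have "\<dots> \<le> 2 * 1"
          using key[OF cube_family_subset[OF F(2) GF] finite_subset[OF GF F(1)] order.trans[OF GF F(3)] t(1)]
          by (intro mult_left_mono) auto
        finally show "(\<Sum>Q\<in>F. vol Q * \<beta> Q) \<le> 2" by simp
      qed
      moreover have "rev_holder r s (1 + K0) Q (\<mu> Q) (\<beta> Q)" if Q: "Q \<in> \<D>" for Q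
        unfolding rev_holder_def
      proof (intro allI impI)
        fix t :: real
        assume t0: "0 < t" and t: "t \<le> 1 \<and> \<beta> Q < t powr \<mu> Q \<or> 1 \<le> t \<and> vol Q * t powr \<mu> Q \<le> 1"
        have Qc: "is_cube Q" using Q is_cube_dcube[OF L] by (auto simp: \<D>_def)
        note Qm = is_cubeD[OF Qc]
        have \<mu>: "1 < \<mu> Q" using median_bounds(1)[OF Qc med[OF Qc]] pm by simp
        have int: "(\<integral>\<^sup>+x\<in>Q. ennreal (u powr (s * (r x - \<mu> Q))) \<partial>lebesgue) \<le> ennreal (K0 * vol Q)"
          if "\<not> bad A \<theta> \<tau> (\<mu> Q) Q u" for u
          unfolding K0_def by (rule not_bad_integral[OF Qc that A0 \<theta>(1) \<tau>(1) _ s\<tau>]) (use s in simp)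
        define t1 where "t1 = vol Q powr (- (1 / \<mu> Q))"
        have t1: "0 < t1" "vol Q * t1 powr \<mu> Q = 1"
        proof -
          show "0 < t1" using Qm(3) by (simp add: t1_def)
          have "t1 powr \<mu> Q = vol Q powr (- 1)" using \<mu> unfolding t1_def powr_powr by simp
          then show "vol Q * t1 powr \<mu> Q = 1" using Qm(3) by (simp add: powr_minus)
        qed
        \<comment> \<open>Otherwise \<open>Q\<close> alone would be a family with sum exactly 1,
          against the strict bound in \<open>key\<close>.\<close>
        have nb1: "\<not> bad A \<theta> \<tau> (\<mu> Q) Q t1"
        proof
          assume "bad A \<theta> \<tau> (\<mu> Q) Q t1"
          then have "B Q t1" using t1 by (simp add: B_def)
          then have "(\<Sum>Q\<in>{Q}. vol Q * (\<lambda>_. t1) Q powr \<mu> Q) < 1"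
            using Q Qc by (intro key) (auto simp: cube_family_def disjoint_def)
          then show False using t1 by simp
        qed
        show "(\<integral>\<^sup>+x\<in>Q. ennreal (t powr (s * (r x - \<mu> Q))) \<partial>lebesgue) \<le> ennreal ((1 + K0) * vol Q)"
        proof (cases "bad A \<theta> \<tau> (\<mu> Q) Q t")
          case False
          from int[OF this] show ?thesis
            by (rule order.trans) (use K0 in \<open>auto intro!: ennreal_leI mult_right_mono\<close>)
        next
          case True
          \<comment> \<open>A bad \<open>t \<le> 1\<close> above the threshold must have
            \<open>vol Q * t powr \<mu> Q > 1\<close>, hence \<open>t1 \<le> t\<close>; a
            \<open>t \<ge> 1\<close> of the second kind satisfies \<open>t \<le> t1\<close>. Powers
            of \<open>t\<close> are therefore dominated by those at the ends \<open>1\<close> and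
            \<open>t1\<close>.\<close>
          have between: "t1 \<le> t \<and> t \<le> 1 \<or> 1 \<le> t \<and> t \<le> t1"
          proof (cases "vol Q * t powr \<mu> Q \<le> 1")
            case le: True
            then have "B Q t" using True t0 by (simp add: B_def)
            have "\<not> (t \<le> 1 \<and> \<beta> Q < t powr \<mu> Q)"
            proof
              assume *: "t \<le> 1 \<and> \<beta> Q < t powr \<mu> Q"
              then have "t powr \<mu> Q \<in> X Q" using \<open>B Q t\<close> by (auto simp: X_def)
              then have "t powr \<mu> Q \<le> \<beta> Q" using cSup_upper[OF _ bdd[OF Q]] Q by (simp add: \<beta>_def)
              then show False using * by simp
            qed
            then have "1 \<le> t" using t by blast
            moreover have "t \<le> t1"
            proof (rule ccontr)
              assume "\<not> t \<le> t1"
              then have "t1 powr \<mu> Q < t powr \<mu> Q" using t1 \<mu> by (intro powr_less_mono2) auto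
              then have "vol Q * t1 powr \<mu> Q < vol Q * t powr \<mu> Q" using Qm(3) by simp
              then show False using t1 le by simp
            qed
            ultimately show ?thesis by simp
          next
            case gt: False
            then have "t \<le> 1" using t by blast
            moreover have "t1 \<le> t"
            proof (rule ccontr)
              assume "\<not> t1 \<le> t"
              then have "t powr \<mu> Q < t1 powr \<mu> Q" using t0 \<mu> by (intro powr_less_mono2) auto
              then have "vol Q * t powr \<mu> Q < vol Q * t1 powr \<mu> Q" using Qm(3) by simp
              then show False using t1 gt by simp
            qed
            ultimately show ?thesis by simp
          qed
          have pw: "t powr e \<le> 1 + t1 powr e" for e
          proof -
            have "t powr e \<le> 1 \<or> t powr e \<le> t1 powr e"
            proof (cases "0 \<le> e")
              case True
              then show ?thesis using between t0 powr_mono2[of e t 1] powr_mono2[of e t t1] by auto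
            next
              case False
              then show ?thesis using between t0 t1(1) powr_mono2'[of e 1 t] powr_mono2'[of e t1 t] by auto
            qed
            then show ?thesis using powr_ge_zero[of t1 e] by linarith
          qed
          have [measurable]: "Q \<in> sets lebesgue" by (rule Qm)
          have "(\<integral>\<^sup>+x\<in>Q. ennreal (t powr (s * (r x - \<mu> Q))) \<partial>lebesgue) \<le>
              (\<integral>\<^sup>+x. ennreal 1 * indicator Q x + ennreal (t1 powr (s * (r x - \<mu> Q))) * indicator Q x \<partial>lebesgue)"
          proof (rule nn_integral_mono)
            fix x
            have "ennreal (t powr (s * (r x - \<mu> Q))) \<le> ennreal 1 + ennreal (t1 powr (s * (r x - \<mu> Q)))"
              using pw[of "s * (r x - \<mu> Q)"] by (subst ennreal_plus[symmetric]) (simp_all only: ennreal_leI zero_le_one powr_ge_zero)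
            then show "ennreal (t powr (s * (r x - \<mu> Q))) * indicator Q x \<le>
                ennreal 1 * indicator Q x + ennreal (t1 powr (s * (r x - \<mu> Q))) * indicator Q x"
              by (cases "x \<in> Q") simp_all
          qed
          also have "\<dots> = (\<integral>\<^sup>+x. ennreal 1 * indicator Q x \<partial>lebesgue) + (\<integral>\<^sup>+x\<in>Q. ennreal (t1 powr (s * (r x - \<mu> Q))) \<partial>lebesgue)"
            by (rule nn_integral_add) measurable
          also have "\<dots> \<le> ennreal (vol Q) + ennreal (K0 * vol Q)"
            using int[OF nb1] Qm by (intro add_mono) auto
          also have "\<dots> = ennreal ((1 + K0) * vol Q)"
            using K0 by (subst ennreal_plus[symmetric]) (auto simp: algebra_simps)
          finally show ?thesis .
        qed
      qed
      ultimately show "\<exists>\<beta>. thresholds {dcube a L k x | k x. True} 2 \<beta> \<and>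
          (\<forall>k x. rev_holder r s (1 + K0) (dcube a L k x) (\<mu> (dcube a L k x)) (\<beta> (dcube a L k x)))"
        unfolding \<D>_def by blast
    qed
  qed (use s K0 in auto)
qed

section \<open>A Jensen inequality with error on one cube\<close>

text \<open>Where \<open>y powr d\<close> is at most 1, so is its power, and elsewhere the power
  grows with the exponent. A smaller oscillation exponent is thus absorbed at the price of the
  summand 1.\<close>

lemma powr_le_one_plus:
  fixes y :: real
  assumes "0 \<le> k" "k \<le> s"
  shows "y powr (k * d) \<le> 1 + y powr (s * d)"
proof -
  have e: "y powr (c * d) = (y powr d) powr c" for c by (simp add: powr_powr mult.commute)
  show ?thesis
  proof (cases "y powr d \<le> 1")
    case True
    then have "(y powr d) powr k \<le> 1" using assms by (intro powr_le1) auto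
    then show ?thesis unfolding e by (simp add: add_increasing2)
  next
    case False
    then have "(y powr d) powr k \<le> (y powr d) powr s" using assms by (intro powr_mono) auto
    then show ?thesis unfolding e by simp
  qed
qed

lemma powr_root_powr: "0 < B \<Longrightarrow> e \<noteq> 0 \<Longrightarrow> (B powr (1 / e)) powr e = (B :: real)"
  by (simp add: powr_powr)

lemma young_le:
  fixes a b q q' :: real
  assumes "1 < q" "q' = q / (q - 1)" "0 \<le> a" "0 \<le> b"
  shows "a * b \<le> a powr q + b powr q'"
proof -
  have q': "1 < q'" "1 / q + 1 / q' = 1" using assms(1) by (auto simp: assms(2) field_simps)
  have "a * b \<le> a powr q / q + b powr q' / q'"
    using assms q' by (intro Youngs_inequality) auto
  also have "\<dots> \<le> a powr q / 1 + b powr q' / 1"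
    using assms q' by (intro add_mono divide_left_mono) auto
  finally show ?thesis by simp
qed

lemma rev_holder_bound:
  assumes rh: "rev_holder \<rho> s K Q m b" and Q: "is_cube Q" and [measurable]: "\<rho> \<in> borel_measurable lebesgue"
    and t: "0 < t" "t \<le> 1 \<and> b < t powr m \<or> 1 \<le> t \<and> vol Q * t powr m \<le> 1"
    and c: "0 \<le> c" "0 \<le> K" and g: "\<And>x. g x \<le> c * (1 + t powr (s * (\<rho> x - m)))"
  shows "(\<integral>\<^sup>+x\<in>Q. ennreal (g x) \<partial>lebesgue) \<le> ennreal (c * (1 + K) * vol Q)"
proof -
  note Qm = is_cubeD[OF Q]
  have [measurable]: "Q \<in> sets lebesgue" by (rule Qm)
  have "(\<integral>\<^sup>+x\<in>Q. ennreal (g x) \<partial>lebesgue) \<le>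
      (\<integral>\<^sup>+x. ennreal c * indicator Q x + ennreal c * (ennreal (t powr (s * (\<rho> x - m))) * indicator Q x) \<partial>lebesgue)"
  proof (rule nn_integral_mono)
    fix x
    have "ennreal (g x) \<le> ennreal (c + c * t powr (s * (\<rho> x - m)))"
      using g[of x] by (intro ennreal_leI) (simp add: algebra_simps)
    also have "\<dots> = ennreal c + ennreal c * ennreal (t powr (s * (\<rho> x - m)))"
      using c by (simp add: ennreal_mult)
    finally show "ennreal (g x) * indicator Q x \<le>
        ennreal c * indicator Q x + ennreal c * (ennreal (t powr (s * (\<rho> x - m))) * indicator Q x)"
      by (cases "x \<in> Q") simp_all
  qed
  also have "\<dots> = ennreal c * emeasure lebesgue Q + ennreal c * (\<integral>\<^sup>+x\<in>Q. ennreal (t powr (s * (\<rho> x - m))) \<partial>lebesgue)"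
    by (subst nn_integral_add) (auto simp: nn_integral_cmult nn_integral_cmult_indicator)
  also have "\<dots> \<le> ennreal c * ennreal (vol Q) + ennreal c * ennreal (K * vol Q)"
    using rh t unfolding rev_holder_def Qm(4) by (intro add_mono mult_left_mono) auto
  also have "\<dots> = ennreal (c * (1 + K) * vol Q)"
    using c by (simp add: algebra_simps flip: ennreal_mult ennreal_plus)
  finally show ?thesis .
qed

text \<open>\<open>s1\<close> is the gain in integrability. Young's inequality will be used with
  \<open>r / s1\<close>, whose conjugate is \<open>r / (r - s1)\<close> instead of
  \<open>r / (r - 1)\<close>; the condition linking \<open>s1\<close> and \<open>s\<close> makes the
  reverse Hoelder inequality for the latter strong enough for the former.\<close>

locale good_cube = exponent r pm pp for r :: "real ^ 'n \<Rightarrow> real" and pm pp +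
  fixes s K s1 m b :: real and Q :: "(real ^ 'n) set"
  assumes Q: "is_cube Q" and m: "pm \<le> m" "m \<le> pp" and s1: "1 < s1" "s1 < pm"
    and s1s: "s1 * ((pm - 1) / (pm - s1)) ^ 2 \<le> s" and K: "1 \<le> K" and b: "0 \<le> b" "b \<le> 1"
    and rh: "rev_holder r s K Q m b" and rh': "rev_holder (\<lambda>x. r x / (r x - 1)) s K Q (m / (m - 1)) b"
begin

abbreviation "V \<equiv> vol Q"

lemma Qm [measurable]: "Q \<in> sets lebesgue" and V: "0 < V" and eV: "emeasure lebesgue Q = ennreal V"
  using is_cubeD[OF Q] by auto

lemma s1_le: "s1 \<le> s"
proof -
  have "1 \<le> (pm - 1) / (pm - s1)" using s1 by simp
  then have "s1 * 1 \<le> s1 * ((pm - 1) / (pm - s1)) ^ 2" using s1 by (intro mult_left_mono one_le_power) auto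
  then show ?thesis using s1s by simp
qed

lemma const_integral: "0 \<le> c \<Longrightarrow> (\<integral>\<^sup>+x\<in>Q. ennreal c \<partial>lebesgue) = ennreal (c * V)"
  by (simp add: nn_integral_cmult_indicator eV ennreal_mult)

lemma conj_meas [measurable]: "(\<lambda>x. r x / (r x - 1)) \<in> borel_measurable lebesgue"
  by measurable

text \<open>Both differences are multiples of \<open>m - u\<close>. Their quotient is
  \<open>s1\<close> times \<open>(u - 1) / (u - s1)\<close> and \<open>(m - 1) / (m - s1)\<close>;
  these fractions decrease in \<open>u\<close> and \<open>m\<close>, so \<open>pm\<close> is the
  worst case.\<close>

lemma dual_exponent_ratio:
  assumes "pm \<le> u"
  shows "\<exists>k. 0 \<le> k \<and> k \<le> s \<and> u / (u - s1) - m / (m - s1) = k * (u / (u - 1) - m / (m - 1))"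
proof (intro exI conjI)
  define c where "c = (pm - 1) / (pm - s1)"
  have c: "(v - 1) / (v - s1) \<le> c" "0 \<le> (v - 1) / (v - s1)" if "pm \<le> v" for v
  proof -
    have "(v - 1) / (v - s1) = 1 + (s1 - 1) / (v - s1)" using that s1 by (simp add: field_simps)
    also have "\<dots> \<le> 1 + (s1 - 1) / (pm - s1)" using that s1 by (intro add_left_mono divide_left_mono) auto
    also have "\<dots> = c" using s1 by (simp add: c_def field_simps)
    finally show "(v - 1) / (v - s1) \<le> c" .
    show "0 \<le> (v - 1) / (v - s1)" using that s1 by simp
  qed
  show "0 \<le> s1 * ((u - 1) / (u - s1) * ((m - 1) / (m - s1)))"
    using c(2)[OF assms] c(2)[OF m(1)] s1 by (intro mult_nonneg_nonneg) auto
  have "(u - 1) / (u - s1) * ((m - 1) / (m - s1)) \<le> c * c"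
    using c[OF assms] c[OF m(1)] by (intro mult_mono) auto
  then have "s1 * ((u - 1) / (u - s1) * ((m - 1) / (m - s1))) \<le> s1 * c ^ 2"
    using s1 by (intro mult_left_mono) (auto simp: power2_eq_square)
  then show "s1 * ((u - 1) / (u - s1) * ((m - 1) / (m - s1))) \<le> s" using s1s by (simp add: c_def)
  have nz: "u - s1 \<noteq> 0" "m - s1 \<noteq> 0" "u - 1 \<noteq> 0" "m - 1 \<noteq> 0" using assms s1 m by auto
  have "u / (u - s1) - m / (m - s1) = s1 * (m - u) / ((u - s1) * (m - s1))"
    using nz by (simp add: field_simps)
  moreover have "u / (u - 1) - m / (m - 1) = (m - u) / ((u - 1) * (m - 1))"
    using nz by (simp add: field_simps)
  ultimately show "u / (u - s1) - m / (m - s1) =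
      s1 * ((u - 1) / (u - s1) * ((m - 1) / (m - s1))) * (u / (u - 1) - m / (m - 1))"
    using nz by simp
qed

lemma dual_power_bound1:
  assumes y: "0 < y" "y \<le> 1 \<and> b < y powr (m / (m - 1)) \<or> 1 \<le> y \<and> V * y powr (m / (m - 1)) \<le> 1"
  shows "(\<integral>\<^sup>+x\<in>Q. ennreal (y powr (r x / (r x - s1))) \<partial>lebesgue) \<le> ennreal (y powr (m / (m - s1)) * (1 + K) * V)"
proof (rule rev_holder_bound[OF rh' Q conj_meas y])
  fix x
  obtain k where k: "0 \<le> k" "k \<le> s" "r x / (r x - s1) - m / (m - s1) = k * (r x / (r x - 1) - m / (m - 1))"
    using dual_exponent_ratio[OF r_ge[of x]] by blast
  have "y powr (r x / (r x - s1)) = y powr (m / (m - s1)) * y powr (k * (r x / (r x - 1) - m / (m - 1)))"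
    using y(1) by (simp flip: powr_add k(3))
  also have "\<dots> \<le> y powr (m / (m - s1)) * (1 + y powr (s * (r x / (r x - 1) - m / (m - 1))))"
    by (intro mult_left_mono powr_le_one_plus k) auto
  finally show "y powr (r x / (r x - s1)) \<le> y powr (m / (m - s1)) * (1 + y powr (s * (r x / (r x - 1) - m / (m - 1))))" .
qed (use K in auto)

lemma dual_exponents: "0 < r x / (r x - s1)" "0 < m / (m - s1)" "1 < m / (m - 1)" "m / (m - 1) \<le> m / (m - s1)"
  using r_ge[of x] s1 m by (auto intro: divide_left_mono)

text \<open>At or below the threshold, monotonicity allows replacing \<open>y\<close> by the
  \<open>Y\<close> with \<open>Y powr (m / (m - 1)) = 2 * b\<close>, safely above it. Since
  \<open>Y \<le> 1\<close> and \<open>m / (m - s1) \<ge> m / (m - 1)\<close>, this costs at most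
  \<open>2 * b\<close>. If \<open>2 * b \<ge> 1\<close>, the error term alone suffices.\<close>

lemma dual_power_bound:
  assumes y: "0 \<le> y" "y \<le> 1 \<or> 1 \<le> y \<and> V * y powr (m / (m - 1)) \<le> 1"
  shows "(\<integral>\<^sup>+x\<in>Q. ennreal (y powr (r x / (r x - s1))) \<partial>lebesgue) \<le> ennreal ((1 + K) * (y powr (m / (m - s1)) + 2 * b) * V)"
proof (cases "0 < y \<and> (y \<le> 1 \<and> b < y powr (m / (m - 1)) \<or> 1 \<le> y \<and> V * y powr (m / (m - 1)) \<le> 1)")
  case True
  then have "(\<integral>\<^sup>+x\<in>Q. ennreal (y powr (r x / (r x - s1))) \<partial>lebesgue) \<le> ennreal (y powr (m / (m - s1)) * (1 + K) * V)"
    by (intro dual_power_bound1) auto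
  also have "\<dots> \<le> ennreal ((1 + K) * (y powr (m / (m - s1)) + 2 * b) * V)"
    using b K V by (intro ennreal_leI mult_right_mono) (auto simp: algebra_simps)
  finally show ?thesis .
next
  case False
  show ?thesis
  proof (cases "y = 0")
    case True then show ?thesis by simp
  next
    case y0: False
    then have y01: "0 < y" "y \<le> 1" "y powr (m / (m - 1)) \<le> b" using y False by auto
    show ?thesis
    proof (cases "1 \<le> 2 * b")
      case True
      have "(\<integral>\<^sup>+x\<in>Q. ennreal (y powr (r x / (r x - s1))) \<partial>lebesgue) \<le> (\<integral>\<^sup>+x\<in>Q. ennreal 1 \<partial>lebesgue)"
        using y01 dual_exponents(1) by (intro nn_integral_set_mono ennreal_leI powr_le1) (auto intro: less_imp_le)
      also have "\<dots> = ennreal (1 * V)" by (rule const_integral) simp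
      also have "1 * V \<le> (1 + K) * (y powr (m / (m - s1)) + 2 * b) * V"
        using True K V mult_mono[of 1 "1 + K" 1 "y powr (m / (m - s1)) + 2 * b"]
        by (intro mult_right_mono) (auto simp: add_increasing)
      finally show ?thesis by (simp add: ennreal_leI)
    next
      case False
      have b0: "0 < b" using y01 by (metis less_le_trans powr_gt_zero less_irrefl)
      define Y where "Y = (2 * b) powr (1 / (m / (m - 1)))"
      have Ym: "Y powr (m / (m - 1)) = 2 * b" unfolding Y_def using b0 dual_exponents(3) by (intro powr_root_powr) auto
      have Y: "0 < Y" "Y \<le> 1" unfolding Y_def using b0 False dual_exponents(3) m pm by (auto intro!: powr_le1)
      have "y \<le> Y"
      proof (rule ccontr)
        assume "\<not> y \<le> Y"
        then have "Y powr (m / (m - 1)) < y powr (m / (m - 1))" using Y dual_exponents(3) by (intro powr_less_mono2) auto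
        then show False using y01 Ym b0 by simp
      qed
      then have "(\<integral>\<^sup>+x\<in>Q. ennreal (y powr (r x / (r x - s1))) \<partial>lebesgue) \<le> (\<integral>\<^sup>+x\<in>Q. ennreal (Y powr (r x / (r x - s1))) \<partial>lebesgue)"
        using y01 dual_exponents(1) by (intro nn_integral_set_mono ennreal_leI powr_mono2) (auto intro: less_imp_le)
      also have "\<dots> \<le> ennreal (Y powr (m / (m - s1)) * (1 + K) * V)"
        using Y Ym b0 by (intro dual_power_bound1) auto
      also have "\<dots> \<le> ennreal ((1 + K) * (y powr (m / (m - s1)) + 2 * b) * V)"
      proof (intro ennreal_leI mult_right_mono)
        have "Y powr (m / (m - s1)) \<le> Y powr (m / (m - 1))" using Y dual_exponents(4) by (intro powr_mono') auto
        then have "Y powr (m / (m - s1)) \<le> y powr (m / (m - s1)) + 2 * b" using Ym by (simp add: add_increasing)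
        then show "Y powr (m / (m - s1)) * (1 + K) \<le> (1 + K) * (y powr (m / (m - s1)) + 2 * b)"
          using K by (simp add: mult.commute mult_left_mono)
      qed (use V in auto)
      finally show ?thesis .
    qed
  qed
qed

text \<open>Used with \<open>k = 1\<close> for averages above 1 and with \<open>k = s1\<close>
  below: there a threshold for \<open>t powr m\<close> becomes an error \<open>b powr s1\<close>, a
  power in which the maximal function of the thresholds is integrable.\<close>

lemma power_bound1:
  assumes t: "0 < t" "t \<le> 1 \<and> b < t powr m \<or> 1 \<le> t \<and> V * t powr m \<le> 1" and k: "0 \<le> k" "k \<le> s"
  shows "(\<integral>\<^sup>+x\<in>Q. ennreal ((t powr k) powr r x) \<partial>lebesgue) \<le> ennreal ((t powr k) powr m * (1 + K) * V)"
proof (rule rev_holder_bound[OF rh Q r_meas t])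
  fix x
  have "(t powr k) powr r x = (t powr k) powr m * t powr (k * (r x - m))"
    using t(1) by (simp add: powr_powr algebra_simps flip: powr_add)
  also have "\<dots> \<le> (t powr k) powr m * (1 + t powr (s * (r x - m)))"
    by (intro mult_left_mono powr_le_one_plus k) auto
  finally show "(t powr k) powr r x \<le> (t powr k) powr m * (1 + t powr (s * (r x - m)))" .
qed (use K in auto)

text \<open>Small enough to absorb the dual term of Young's inequality, through
  \<open>(1 + K) * \<epsilon> powr (1 / pp) = 1 / 2\<close>, and to compensate the constants in the
  a priori bounds for averages.\<close>

definition "\<epsilon> = (2 * (1 + K)) powr (- pp)"

lemma \<epsilon>: "0 < \<epsilon>" "\<epsilon> \<le> 1" "(1 + K) * \<epsilon> powr (1 / pp) = 1 / 2" "\<epsilon> * 2 powr pp \<le> 1" "\<epsilon> * (2 + K) powr pp \<le> 1"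
proof -
  show "0 < \<epsilon>" using K by (simp add: \<epsilon>_def)
  have e: "\<epsilon> * (2 * (1 + K)) powr pp = 1" using K by (simp add: \<epsilon>_def flip: powr_add)
  have "2 powr pp \<le> (2 * (1 + K)) powr pp" "(2 + K) powr pp \<le> (2 * (1 + K)) powr pp" "1 \<le> (2 * (1 + K)) powr pp"
    using K pp by (auto intro!: powr_mono2 ge_one_powr_ge_zero)
  then show "\<epsilon> * 2 powr pp \<le> 1" "\<epsilon> * (2 + K) powr pp \<le> 1" "\<epsilon> \<le> 1"
    using e \<open>0 < \<epsilon>\<close> mult_left_mono[of _ "(2 * (1 + K)) powr pp" \<epsilon>] by fastforce+
  show "(1 + K) * \<epsilon> powr (1 / pp) = 1 / 2" 
  proof -
    have "\<epsilon> powr (1 / pp) = (2 * (1 + K)) powr (- 1)" unfolding \<epsilon>_def powr_powr using pp by simp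
    then show ?thesis using K by (simp add: powr_minus field_simps)
  qed
qed

definition "jensen_const = (2 + K) powr pp * (1 + K) * (1 + (8 * (1 + K) / \<epsilon>) powr s1)"

context
  fixes f :: "real ^ 'n \<Rightarrow> real" and x G :: real
  assumes f [measurable]: "f \<in> borel_measurable lebesgue" and f0: "\<And>x. 0 \<le> f x"
    and f1: "(\<integral>\<^sup>+x\<in>Q. ennreal (f x powr r x) \<partial>lebesgue) \<le> 1"
    and x: "0 \<le> x" "(\<integral>\<^sup>+x\<in>Q. ennreal (f x) \<partial>lebesgue) = ennreal (x * V)"
    and G: "0 \<le> G" "(\<integral>\<^sup>+x\<in>Q. ennreal (f x powr (r x / s1)) \<partial>lebesgue) = ennreal (G * V)"
begin

text \<open>\<open>\<sigma> = 1\<close> will give the a priori bounds on the average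
  \<open>x\<close> of \<open>f\<close>, and \<open>\<sigma> = s1\<close> its comparison with the
  average \<open>G\<close> of \<open>f powr (r / s1)\<close>.\<close>

lemma young_integral:
  assumes y: "0 \<le> y" and \<sigma>: "1 \<le> \<sigma>" "\<sigma> < pm"
    and a: "(\<integral>\<^sup>+x\<in>Q. ennreal (f x powr (r x / \<sigma>)) \<partial>lebesgue) \<le> ennreal a" "0 \<le> a"
    and d: "(\<integral>\<^sup>+x\<in>Q. ennreal (y powr (r x / (r x - \<sigma>))) \<partial>lebesgue) \<le> ennreal d" "0 \<le> d"
  shows "y * (x * V) \<le> a + d"
proof -
  have "ennreal (y * (x * V)) = (\<integral>\<^sup>+x. ennreal y * (ennreal (f x) * indicator Q x) \<partial>lebesgue)"
    using x y V by (simp add: nn_integral_cmult ennreal_mult)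
  also have "\<dots> \<le> (\<integral>\<^sup>+x. ennreal (f x powr (r x / \<sigma>)) * indicator Q x + ennreal (y powr (r x / (r x - \<sigma>))) * indicator Q x \<partial>lebesgue)"
  proof (rule nn_integral_mono)
    fix z
    have "f z * y \<le> f z powr (r z / \<sigma>) + y powr (r z / (r z - \<sigma>))"
    proof (rule young_le)
      show "1 < r z / \<sigma>" using \<sigma> r_ge[of z] by simp
      show "r z / (r z - \<sigma>) = r z / \<sigma> / (r z / \<sigma> - 1)" using \<sigma> r_ge[of z] by (simp add: field_simps)
    qed (use f0 y in auto)
    then have "ennreal (f z * y) \<le> ennreal (f z powr (r z / \<sigma>) + y powr (r z / (r z - \<sigma>)))" by (rule ennreal_leI)
    then show "ennreal y * (ennreal (f z) * indicator Q z) \<le>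
        ennreal (f z powr (r z / \<sigma>)) * indicator Q z + ennreal (y powr (r z / (r z - \<sigma>))) * indicator Q z"
      using f0[of z] y by (cases "z \<in> Q") (simp_all add: ennreal_mult mult.commute)
  qed
  also have "\<dots> = (\<integral>\<^sup>+x\<in>Q. ennreal (f x powr (r x / \<sigma>)) \<partial>lebesgue) + (\<integral>\<^sup>+x\<in>Q. ennreal (y powr (r x / (r x - \<sigma>))) \<partial>lebesgue)"
    by (rule nn_integral_add) measurable
  also have "\<dots> \<le> ennreal (a + d)" using a d by (simp add: add_mono)
  finally show ?thesis using a d by (subst (asm) ennreal_le_iff) auto
qed

lemma average_large_cube:
  assumes "1 \<le> V" shows "x \<le> 2"
proof -
  have "1 * (x * V) \<le> 1 + 1 * V"
    by (rule young_integral[of 1 1]) (use f1 pm const_integral[of 1] V in auto)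
  also have "\<dots> \<le> 2 * V" using assms by simp
  finally show ?thesis using V by simp
qed

text \<open>The bound that Hoelder's inequality gives for the constant exponent \<open>m\<close>;
  the reverse Hoelder inequality for the conjugate exponent lets the median stand for
  \<open>r\<close>.\<close>

lemma average_small_cube:
  assumes "V \<le> 1" shows "x powr m * V \<le> (2 + K) powr m"
proof -
  define m' where "m' = m / (m - 1)"
  have m1: "1 < m" using m pm by simp
  have m': "1 < m'" "1 / m + 1 / m' = 1" using m1 by (auto simp: m'_def field_simps)
  \<comment> \<open>The largest \<open>y\<close> that the dual reverse Hoelder inequality admits,
    with \<open>V * y powr m' = 1\<close>; it is at least 1 because the cube is small.\<close>
  define y where "y = V powr (- (1 / m'))"
  have y: "1 \<le> y" unfolding y_def using assms V m' by (simp add: powr_minus_divide powr_le1)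
  have ym: "V * y powr m' = 1"
  proof -
    have "y powr m' = V powr (- 1)" unfolding y_def powr_powr using m' by simp
    then show ?thesis using V by (simp add: powr_minus)
  qed
  have "(\<integral>\<^sup>+x\<in>Q. ennreal (y powr (r x / (r x - 1))) \<partial>lebesgue) \<le> ennreal (y powr m' * (1 + K) * V)"
  proof (rule rev_holder_bound[OF rh' Q conj_meas])
    show "0 < y" "y \<le> 1 \<and> b < y powr (m / (m - 1)) \<or> 1 \<le> y \<and> V * y powr (m / (m - 1)) \<le> 1"
      using y ym unfolding m'_def by auto
    fix z
    have "y powr (r z / (r z - 1)) = y powr m' * y powr (1 * (r z / (r z - 1) - m / (m - 1)))"
      using y by (simp add: m'_def flip: powr_add)
    also have "\<dots> \<le> y powr m' * (1 + y powr (s * (r z / (r z - 1) - m / (m - 1))))"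
      using s1 s1_le by (intro mult_left_mono powr_le_one_plus) auto
    finally show "y powr (r z / (r z - 1)) \<le> y powr m' * (1 + y powr (s * (r z / (r z - 1) - m / (m - 1))))" .
  qed (use K in auto)
  also have "y powr m' * (1 + K) * V = (V * y powr m') * (1 + K)" by simp
  also have "\<dots> = 1 + K" using ym by simp
  finally have d: "(\<integral>\<^sup>+x\<in>Q. ennreal (y powr (r x / (r x - 1))) \<partial>lebesgue) \<le> ennreal (1 + K)" .
  have "y * (x * V) \<le> 1 + (1 + K)"
    by (rule young_integral[of y 1]) (use f1 pm d K y in auto)
  moreover have "y * V = V powr (1 / m)"
  proof -
    have "y * V = V powr (- (1 / m')) * V powr 1" using V by (simp add: y_def)
    also have "\<dots> = V powr (- (1 / m') + 1)" by (rule powr_add[symmetric])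
    also have "- (1 / m') + 1 = 1 / m" using m' by linarith
    finally show ?thesis .
  qed
  ultimately have "x * V powr (1 / m) \<le> 2 + K" by (simp add: mult.left_commute mult.commute)
  then have "(x * V powr (1 / m)) powr m \<le> (2 + K) powr m"
    using x(1) m1 by (intro powr_mono2) auto
  then show ?thesis using x(1) m1 V by (simp add: powr_mult powr_powr)
qed

text \<open>With \<open>q = m / s1\<close>, the choice
  \<open>y = \<epsilon> * x powr (q - 1)\<close> is extremal in Young's inequality: the product
  \<open>y * x\<close> and the dual term are both multiples of \<open>x powr q\<close>. The dual
  term carries a higher power of \<open>\<epsilon>\<close> and can be absorbed.\<close>

lemma jensen_with_error: "x powr (m / s1) \<le> 4 * (1 + K) / \<epsilon> * (G + b)"
proof -
  define q where "q = m / s1"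
  have q: "1 < q" using s1 m by (simp add: q_def)
  have m1: "1 < m" using m pm by simp
  define y where "y = \<epsilon> * x powr (q - 1)"
  have y0: "0 \<le> y" using \<epsilon> by (simp add: y_def)
  \<comment> \<open>Admissibility of \<open>y\<close>: if \<open>y > 1\<close> then
    \<open>x > 1\<close>; large cubes are excluded because \<open>x \<le> 2\<close> there, and on
    small cubes \<open>x powr m * V\<close> is bounded. \<open>\<epsilon>\<close> beats the
    constants in both cases.\<close>
  have "y \<le> 1 \<or> 1 \<le> y \<and> V * y powr (m / (m - 1)) \<le> 1"
  proof (cases "y \<le> 1")
    case False
    have x1: "1 < x"
    proof (rule ccontr)
      assume "\<not> 1 < x"
      then have "x powr (q - 1) \<le> 1" using x q by (intro powr_le1) auto
      then have "y \<le> 1" unfolding y_def using \<epsilon> mult_mono[of \<epsilon> 1 "x powr (q - 1)" 1] by simp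
      then show False using False by simp
    qed
    have qpp: "q - 1 \<le> pp"
    proof -
      have "q \<le> m / 1" unfolding q_def using s1 m1 by (intro divide_left_mono) auto
      then show ?thesis using m by simp
    qed
    have V1: "V \<le> 1"
    proof (rule ccontr)
      assume "\<not> V \<le> 1"
      then have "x \<le> 2" using average_large_cube by simp
      then have "x powr (q - 1) \<le> 2 powr (q - 1)" using x q by (intro powr_mono2) auto
      also have "\<dots> \<le> 2 powr pp" using qpp by (intro powr_mono) auto
      finally have "y \<le> \<epsilon> * 2 powr pp" unfolding y_def using \<epsilon> by (intro mult_left_mono) auto
      then show False using \<epsilon> False by simp
    qed
    have "y powr (m / (m - 1)) = \<epsilon> powr (m / (m - 1)) * x powr ((q - 1) * (m / (m - 1)))"
      using \<epsilon> by (simp add: y_def powr_mult powr_powr)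
    also have "\<dots> \<le> \<epsilon> powr 1 * x powr m"
    proof (intro mult_mono)
      show "\<epsilon> powr (m / (m - 1)) \<le> \<epsilon> powr 1" using \<epsilon> dual_exponents(3) by (intro powr_mono') auto
      have "q - 1 \<le> m - 1" unfolding q_def using s1 m1 by (simp add: field_simps)
      then have "(q - 1) * (m / (m - 1)) \<le> (m - 1) * (m / (m - 1))" using m1 by (intro mult_right_mono) auto
      then have "(q - 1) * (m / (m - 1)) \<le> m" using m1 by simp
      then show "x powr ((q - 1) * (m / (m - 1))) \<le> x powr m" using x1 by (intro powr_mono) auto
    qed (use \<epsilon> x1 in auto)
    finally have "V * y powr (m / (m - 1)) \<le> V * (\<epsilon> * x powr m)" using V \<epsilon> by (intro mult_left_mono) auto
    also have "\<dots> = \<epsilon> * (x powr m * V)" by simp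
    also have "\<dots> \<le> \<epsilon> * (2 + K) powr m" using average_small_cube[OF V1] \<epsilon> by (intro mult_left_mono) auto
    also have "\<dots> \<le> \<epsilon> * (2 + K) powr pp" using \<epsilon> m K by (intro mult_left_mono powr_mono) auto
    also have "\<dots> \<le> 1" by (rule \<epsilon>)
    finally show ?thesis using False by simp
  qed simp
  then have d: "(\<integral>\<^sup>+x\<in>Q. ennreal (y powr (r x / (r x - s1))) \<partial>lebesgue) \<le> ennreal ((1 + K) * (y powr (m / (m - s1)) + 2 * b) * V)"
    by (rule dual_power_bound[OF y0])
  have "y * (x * V) \<le> G * V + (1 + K) * (y powr (m / (m - s1)) + 2 * b) * V"
    by (rule young_integral[OF y0 _ _ _ _ d]) (use s1 G K b V in auto)
  then have "(y * x) * V \<le> (G + (1 + K) * (y powr (m / (m - s1)) + 2 * b)) * V" by (simp add: algebra_simps)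
  then have main: "y * x \<le> G + (1 + K) * (y powr (m / (m - s1)) + 2 * b)" using V by (simp add: mult_le_cancel_right)
  have yx: "y * x = \<epsilon> * x powr q"
    using x(1) q by (cases "x = 0") (auto simp: y_def powr_diff)
  have mm: "m / (m - s1) = 1 + s1 / (m - s1)" using m s1 by (simp add: field_simps)
  have "(q - 1) * (m / (m - s1)) = q" using s1 m by (simp add: q_def field_simps)
  then have "y powr (m / (m - s1)) = \<epsilon> powr (m / (m - s1)) * x powr q"
    using \<epsilon> by (simp add: y_def powr_mult powr_powr)
  also have "\<epsilon> powr (m / (m - s1)) = \<epsilon> * \<epsilon> powr (s1 / (m - s1))" unfolding mm powr_add using \<epsilon> by simp
  \<comment> \<open>\<open>s1 / (m - s1) \<ge> 1 / pp\<close> bounds the surplus power of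
    \<open>\<epsilon>\<close> uniformly in \<open>m\<close>.\<close>
  also have "\<epsilon> powr (s1 / (m - s1)) \<le> \<epsilon> powr (1 / pp)"
    using \<epsilon> s1 m by (intro powr_mono' frac_le) auto
  finally have "y powr (m / (m - s1)) \<le> \<epsilon> * \<epsilon> powr (1 / pp) * x powr q" using \<epsilon> by (simp add: mult_right_mono)
  then have "(1 + K) * y powr (m / (m - s1)) \<le> (1 + K) * (\<epsilon> * \<epsilon> powr (1 / pp) * x powr q)"
    using K by (intro mult_left_mono) auto
  also have "\<dots> = ((1 + K) * \<epsilon> powr (1 / pp)) * (\<epsilon> * x powr q)" by simp
  also have "\<dots> = \<epsilon> * x powr q / 2" unfolding \<epsilon>(3) by simp
  finally have "\<epsilon> * x powr q / 2 \<le> G + 2 * (1 + K) * b" using main yx by (simp add: algebra_simps)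
  also have "\<dots> \<le> 2 * (1 + K) * (G + b)" using K G(1) mult_right_mono[of 1 "2 * (1 + K)" G] by (simp add: algebra_simps)
  finally show ?thesis using \<epsilon>(1) unfolding q_def[symmetric] by (simp add: field_simps)
qed

text \<open>For \<open>x \<le> 1\<close> the reverse Hoelder inequality is applied to
  \<open>t = x powr (1 / s1)\<close>, so that the error is \<open>b powr s1\<close> and not
  \<open>b\<close>. For \<open>x > 1\<close> the a priori bounds either make
  \<open>x / (2 + K)\<close> admissible or bound \<open>x\<close> by a constant, which
  \<open>x powr m \<ge> 1\<close> dominates.\<close>

lemma average_power_bound:
  "(\<integral>\<^sup>+z\<in>Q. ennreal (x powr r z) \<partial>lebesgue) \<le> ennreal ((2 + K) powr pp * (1 + K) * (x powr m + b powr s1) * V)"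
proof -
  define c where "c = (2 + K) powr pp * (1 + K)"
  have K2: "2 powr pp \<le> (2 + K) powr pp" "1 \<le> (2 + K) powr pp" "0 < (2 + K) powr pp"
    using K pp by (auto intro!: powr_mono2 ge_one_powr_ge_zero)
  have c: "(2 + K) powr pp \<le> c" "1 + K \<le> c" "1 \<le> c" "2 powr pp \<le> c"
  proof -
    show "(2 + K) powr pp \<le> c" "1 + K \<le> c"
      unfolding c_def using K K2 mult_left_mono[of 1 "1 + K" "(2 + K) powr pp"] mult_right_mono[of 1 "(2 + K) powr pp" "1 + K"] by auto
    then show "1 \<le> c" "2 powr pp \<le> c" using K K2 by linarith+
  qed
  have m1: "1 < m" using m pm by simp
  have const: "(\<integral>\<^sup>+z\<in>Q. ennreal (x powr r z) \<partial>lebesgue) \<le> ennreal (d powr pp * V)" if "x \<le> d" "1 \<le> d" for d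
  proof -
    have "x powr r z \<le> d powr pp" for z
    proof -
      have "x powr r z \<le> d powr r z" using that x r_pos(1)[of z] by (intro powr_mono2) auto
      also have "\<dots> \<le> d powr pp" using that r_le by (intro powr_mono) auto
      finally show ?thesis .
    qed
    then have "(\<integral>\<^sup>+z\<in>Q. ennreal (x powr r z) \<partial>lebesgue) \<le> (\<integral>\<^sup>+z\<in>Q. ennreal (d powr pp) \<partial>lebesgue)"
      by (intro nn_integral_set_mono ennreal_leI) auto
    then show ?thesis by (simp add: const_integral)
  qed
  have "\<exists>v. (\<integral>\<^sup>+z\<in>Q. ennreal (x powr r z) \<partial>lebesgue) \<le> ennreal (v * V) \<and> v \<le> c * (x powr m + b powr s1)"
  proof (cases "x = 0")
    case True
    then show ?thesis using c by (intro exI[of _ 0]) auto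
  next
    case x0: False
    show ?thesis
    proof (cases "x \<le> 1")
      case x1: True
      define t where "t = x powr (1 / s1)"
      have t: "0 < t" "t \<le> 1" "t powr s1 = x" using x x0 x1 s1 by (auto simp: t_def powr_powr intro!: powr_le1)
      show ?thesis
      proof (cases "b < t powr m")
        case True
        have "(\<integral>\<^sup>+z\<in>Q. ennreal ((t powr s1) powr r z) \<partial>lebesgue) \<le> ennreal ((t powr s1) powr m * (1 + K) * V)"
          using t True s1 s1_le by (intro power_bound1) auto
        moreover have "x powr m * (1 + K) \<le> (x powr m + b powr s1) * c"
          using c K by (intro mult_mono) auto
        ultimately show ?thesis unfolding t(3)
          by (intro exI[of _ "x powr m * (1 + K)"] conjI) (auto simp: mult.commute)
      next
        case False
        have b0: "0 < b" using False t by (metis less_le_trans not_less powr_gt_zero less_irrefl)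
        have bs2: "2 powr s1 * b powr s1 * (1 + K) \<le> c * (x powr m + b powr s1)"
        proof -
          have "2 powr s1 \<le> (2 + K) powr pp"
            using K2 powr_mono[of s1 pp 2] s1 pm_le_pp by linarith
          then have "2 powr s1 * (1 + K) \<le> c" unfolding c_def using K by (intro mult_right_mono) auto
          then have "2 powr s1 * (1 + K) * b powr s1 \<le> c * b powr s1" by (intro mult_right_mono) auto
          also have "\<dots> \<le> c * (x powr m + b powr s1)" using c by (intro mult_left_mono) auto
          finally show ?thesis by (simp add: mult_ac)
        qed
        show ?thesis
        proof (cases "1 \<le> 2 * b")
          case True
          have "1 \<le> (2 * b) powr s1" using True s1 by (intro ge_one_powr_ge_zero) auto
          then have "1 \<le> 2 powr s1 * b powr s1 * (1 + K)"
            using b0 K mult_mono[of 1 "2 powr s1 * b powr s1" 1 "1 + K"] by (simp add: powr_mult)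
          then show ?thesis using const[of 1] x1 bs2 by (intro exI[of _ 1]) auto
        next
          case 2: False
          \<comment> \<open>\<open>T powr m\<close> is twice the threshold, hence strictly above it;
            monotonicity then replaces \<open>t\<close> by \<open>T\<close>.\<close>
          define T where "T = (2 * b) powr (1 / m)"
          have T: "0 < T" "T \<le> 1" "T powr m = 2 * b"
            using b0 2 m1 by (auto simp: T_def powr_powr intro!: powr_le1)
          have "t \<le> T"
          proof (rule ccontr)
            assume "\<not> t \<le> T"
            then have "T powr m < t powr m" using T m1 by (intro powr_less_mono2) auto
            then show False using False T b0 by simp
          qed
          then have "x \<le> T powr s1" using t s1 powr_mono2[of s1 t T] by simp
          then have "(\<integral>\<^sup>+z\<in>Q. ennreal (x powr r z) \<partial>lebesgue) \<le> (\<integral>\<^sup>+z\<in>Q. ennreal ((T powr s1) powr r z) \<partial>lebesgue)"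
            using x r_pos(1) by (intro nn_integral_set_mono ennreal_leI powr_mono2) (auto intro: less_imp_le)
          also have "\<dots> \<le> ennreal ((T powr s1) powr m * (1 + K) * V)"
            using T b0 s1 s1_le by (intro power_bound1) auto
          also have "(T powr s1) powr m = (T powr m) powr s1" by (simp add: powr_powr mult.commute)
          also have "\<dots> = 2 powr s1 * b powr s1" unfolding T(3) using b0 by (simp add: powr_mult)
          finally show ?thesis using bs2 by blast
        qed
      qed
    next
      case x1: False
      have xm: "1 \<le> x powr m" using x1 m1 by (intro ge_one_powr_ge_zero) auto
      have cxm: "v * x powr m \<le> c * (x powr m + b powr s1)" if "v \<le> c" for v
        using that c by (intro mult_mono) auto
      show ?thesis
      proof (cases "1 \<le> V")
        case True
        then have "x \<le> 2" by (rule average_large_cube)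
        moreover have "2 powr pp \<le> c * (x powr m + b powr s1)"
          using order.trans[OF mult_left_mono[OF xm, of "2 powr pp"] cxm[OF c(4)]] by simp
        ultimately show ?thesis using const[of 2] by (intro exI[of _ "2 powr pp"]) auto
      next
        case V1: False
        \<comment> \<open>Division by \<open>2 + K\<close> turns the a priori bound into
          \<open>V * X powr m \<le> 1\<close>.\<close>
        define X where "X = x / (2 + K)"
        have X: "X powr m * (2 + K) powr m = x powr m" "0 < X" using K x x1 by (auto simp: X_def simp flip: powr_mult)
        have VX: "V * X powr m \<le> 1"
        proof -
          have "x powr m * V \<le> (2 + K) powr m" using V1 by (intro average_small_cube) auto
          then have "(X powr m * (2 + K) powr m) * V \<le> (2 + K) powr m" unfolding X(1) .
          then have "(V * X powr m) * (2 + K) powr m \<le> 1 * (2 + K) powr m" by (simp add: mult_ac)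
          then show ?thesis using K by (simp add: mult_le_cancel_right)
        qed
        show ?thesis
        proof (cases "1 \<le> X")
          case True
          have "(\<integral>\<^sup>+z\<in>Q. ennreal (x powr r z) \<partial>lebesgue) \<le> (\<integral>\<^sup>+z. ennreal ((2 + K) powr pp) * (ennreal ((X powr 1) powr r z) * indicator Q z) \<partial>lebesgue)"
          proof (rule nn_integral_mono)
            fix z
            have "x powr r z = (2 + K) powr r z * X powr r z" using K X by (simp add: X_def powr_divide)
            also have "\<dots> \<le> (2 + K) powr pp * X powr r z" using K r_le by (intro mult_right_mono powr_mono) auto
            finally have "ennreal (x powr r z) \<le> ennreal ((2 + K) powr pp) * ennreal ((X powr 1) powr r z)"
              using X by (simp add: ennreal_leI flip: ennreal_mult)
            then show "ennreal (x powr r z) * indicator Q z \<le> ennreal ((2 + K) powr pp) * (ennreal ((X powr 1) powr r z) * indicator Q z)"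
              by (cases "z \<in> Q") simp_all
          qed
          also have "\<dots> = ennreal ((2 + K) powr pp) * (\<integral>\<^sup>+z\<in>Q. ennreal ((X powr 1) powr r z) \<partial>lebesgue)"
            by (rule nn_integral_cmult) measurable
          also have "\<dots> \<le> ennreal ((2 + K) powr pp) * ennreal ((X powr 1) powr m * (1 + K) * V)"
            using True VX X s1 s1_le by (intro mult_left_mono power_bound1) auto
          also have "\<dots> = ennreal (c * X powr m * V)" using X K by (simp add: c_def mult_ac flip: ennreal_mult)
          finally have "(\<integral>\<^sup>+z\<in>Q. ennreal (x powr r z) \<partial>lebesgue) \<le> ennreal (c * X powr m * V)" .
          moreover have "X powr m \<le> x powr m" using X K m1 unfolding X_def by (intro powr_mono2) (auto simp: field_simps)
          then have "c * X powr m \<le> c * (x powr m + b powr s1)" using c by (intro mult_left_mono) (auto simp: add_increasing2)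
          ultimately show ?thesis by blast
        next
          case False
          then have "x \<le> 2 + K" using K by (simp add: X_def field_simps)
          moreover have "(2 + K) powr pp \<le> c * (x powr m + b powr s1)"
            using order.trans[OF mult_left_mono[OF xm, of "(2 + K) powr pp"] cxm[OF c(1)]] by simp
          ultimately show ?thesis using const[of "2 + K"] K by (intro exI[of _ "(2 + K) powr pp"]) auto
        qed
      qed
    qed
  qed
  then obtain v where v: "(\<integral>\<^sup>+z\<in>Q. ennreal (x powr r z) \<partial>lebesgue) \<le> ennreal (v * V)" "v \<le> c * (x powr m + b powr s1)" by blast
  have "ennreal (v * V) \<le> ennreal (c * (x powr m + b powr s1) * V)" using v V by (intro ennreal_leI mult_right_mono) auto
  then show ?thesis using v(1) unfolding c_def by (rule order.trans[rotated])
qed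

text \<open>\<open>jensen_with_error\<close> raised to the power \<open>s1\<close>, so that
  \<open>G\<close> and \<open>b\<close> appear in the power for which maximal functions are
  bounded.\<close>

lemma average_modular:
  "(\<integral>\<^sup>+z\<in>Q. ennreal (x powr r z) \<partial>lebesgue) \<le> ennreal (jensen_const * (G powr s1 + b powr s1) * V)"
proof -
  have "x powr m = (x powr (m / s1)) powr s1" using s1 by (simp add: powr_powr)
  also have "\<dots> \<le> (4 * (1 + K) / \<epsilon> * (G + b)) powr s1"
    using s1 by (intro powr_mono2 jensen_with_error) auto
  also have "\<dots> \<le> (8 * (1 + K) / \<epsilon> * max G b) powr s1"
  proof (intro powr_mono2)
    have "4 * (1 + K) / \<epsilon> * (G + b) \<le> 4 * (1 + K) / \<epsilon> * (2 * max G b)" using \<epsilon>(1) K by (intro mult_left_mono) auto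
    also have "\<dots> = 8 * (1 + K) / \<epsilon> * max G b" by (simp add: algebra_simps)
    finally show "4 * (1 + K) / \<epsilon> * (G + b) \<le> 8 * (1 + K) / \<epsilon> * max G b" .
  qed (use s1 \<epsilon>(1) K G b in auto)
  also have "\<dots> = (8 * (1 + K) / \<epsilon>) powr s1 * max G b powr s1"
    using \<epsilon>(1) K G b by (intro powr_mult) 
  also have "max G b powr s1 \<le> G powr s1 + b powr s1" by (simp add: max_def)
  finally have "x powr m \<le> (8 * (1 + K) / \<epsilon>) powr s1 * (G powr s1 + b powr s1)" by (simp add: mult_left_mono)
  then have "x powr m + b powr s1 \<le> (1 + (8 * (1 + K) / \<epsilon>) powr s1) * (G powr s1 + b powr s1)"
    by (simp add: algebra_simps add_increasing)
  then have "(2 + K) powr pp * (1 + K) * (x powr m + b powr s1) * V \<le>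
    (2 + K) powr pp * (1 + K) * ((1 + (8 * (1 + K) / \<epsilon>) powr s1) * (G powr s1 + b powr s1)) * V"
    using K V by (intro mult_left_mono mult_right_mono) auto
  then show ?thesis
    using average_power_bound unfolding jensen_const_def by (simp add: ennreal_leI mult.assoc order.trans)
qed

end

end

section \<open>Dyadic maximal functions\<close>

lemma dyadic_layer_ex1:
  assumes "0 < (y :: real)"
  shows "{k :: int. 2 powr real_of_int k < y \<and> y \<le> 2 powr (real_of_int k + 1)} = {\<lceil>log 2 y\<rceil> - 1}"
proof -
  have "2 powr real_of_int k < y \<and> y \<le> 2 powr (real_of_int k + 1) \<longleftrightarrow> k = \<lceil>log 2 y\<rceil> - 1" for k :: int
  proof -
    have "2 powr real_of_int k < y \<longleftrightarrow> k < log 2 y" "y \<le> 2 powr (real_of_int k + 1) \<longleftrightarrow> log 2 y \<le> k + 1"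
      using assms by (simp_all add: less_log_iff log_le_iff)
    then show ?thesis by linarith
  qed
  then show ?thesis by auto
qed

lemma dyadic_layer_sum:
  "(\<integral>\<^sup>+k. c * indicator {k :: int. 2 powr real_of_int k < y \<and> y \<le> 2 powr (real_of_int k + 1)} k \<partial>count_space UNIV) = (if 0 < y then c else 0)"
proof (cases "0 < y")
  case True
  show ?thesis unfolding dyadic_layer_ex1[OF True] using True by (simp add: nn_integral_cmult_indicator)
next
  case False
  have "{k :: int. 2 powr real_of_int k < y \<and> y \<le> 2 powr (real_of_int k + 1)} = {}"
  proof -
    have "\<not> 2 powr real_of_int k < y" for k
    proof -
      have "0 < 2 powr real_of_int k" by simp
      then show ?thesis using False by linarith
    qed
    then show ?thesis by simp
  qed
  then show ?thesis using False by simp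
qed

text \<open>Counted downwards from the largest \<open>k\<close> with
  \<open>2 powr k \<le> y\<close>, the integers give an ordinary geometric series.\<close>

lemma geometric_int_sum:
  assumes "0 < \<delta>" "0 < y"
  shows "(\<integral>\<^sup>+k. ennreal (2 powr (\<delta> * k)) * indicator {k :: int. 2 powr k < y} k \<partial>count_space UNIV) \<le> ennreal (y powr \<delta> / (1 - 2 powr (- \<delta>)))"
proof -
  define k0 where "k0 = \<lfloor>log 2 y\<rfloor>"
  have k0: "2 powr k0 \<le> y" using assms by (simp add: k0_def powr_le_iff)
  have sub: "k \<le> k0" if "2 powr k < y" for k :: int
  proof -
    have "k < log 2 y" using that assms by (simp add: less_log_iff)
    then show ?thesis unfolding k0_def by linarith
  qed
  have q: "2 powr (- \<delta>) < 1" "0 < 2 powr (- \<delta>)" using assms by (auto simp: powr_less_one)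
  have bij: "bij_betw (\<lambda>j. k0 - int j) UNIV {..k0}"
    by (rule bij_betw_byWitness[where f' = "\<lambda>k. nat (k0 - k)"]) auto
  have "(\<integral>\<^sup>+k. ennreal (2 powr (\<delta> * k)) * indicator {k :: int. 2 powr k < y} k \<partial>count_space UNIV) \<le>
      (\<integral>\<^sup>+k. ennreal (2 powr (\<delta> * real_of_int k)) * indicator {..k0} k \<partial>count_space UNIV)"
    by (intro nn_integral_mono) (auto simp: indicator_def sub)
  also have "\<dots> = (\<integral>\<^sup>+k. ennreal (2 powr (\<delta> * real_of_int k)) \<partial>count_space {..k0})"
    by (simp add: nn_integral_count_space_indicator)
  also have "\<dots> = (\<integral>\<^sup>+j. ennreal (2 powr (\<delta> * real_of_int (k0 - int j))) \<partial>count_space UNIV)"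
    by (rule nn_integral_bij_count_space[OF bij, symmetric])
  also have "\<dots> = (\<Sum>j. ennreal ((2 powr k0) powr \<delta> * (2 powr (- \<delta>)) ^ j))"
  proof -
    have "2 powr (\<delta> * real_of_int (k0 - int j)) = (2 powr k0) powr \<delta> * (2 powr (- \<delta>)) ^ j" for j
      by (simp add: powr_powr powr_realpow[symmetric] algebra_simps flip: powr_add)
    then show ?thesis by (simp only: nn_integral_count_space_nat)
  qed
  also have "\<dots> = ennreal ((2 powr k0) powr \<delta> * (1 / (1 - 2 powr (- \<delta>))))"
    using q by (intro suminf_ennreal_eq sums_mult geometric_sums) auto
  also have "\<dots> \<le> ennreal (y powr \<delta> / (1 - 2 powr (- \<delta>)))"
  proof (rule ennreal_leI)
    have "(2 powr k0) powr \<delta> \<le> y powr \<delta>" using k0 assms by (intro powr_mono2) auto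
    then show "(2 powr k0) powr \<delta> * (1 / (1 - 2 powr (- \<delta>))) \<le> y powr \<delta> / (1 - 2 powr (- \<delta>))"
      using q by (simp add: divide_right_mono)
  qed
  finally show ?thesis .
qed

lemma nn_integral_const_cube:
  assumes "is_cube Q" "0 \<le> c"
  shows "(\<integral>\<^sup>+x\<in>Q. ennreal c \<partial>lebesgue) = ennreal (c * vol Q)"
  unfolding nn_integral_cmult_indicator[OF is_cubeD(1)[OF assms(1)]] is_cubeD(4)[OF assms(1)]
  using assms(2) by (simp add: ennreal_mult)

text \<open>Every positive value lies in exactly one dyadic layer, and sum and integral commute for
  nonnegative functions.\<close>

lemma nn_integral_layers:
  assumes [measurable]: "u \<in> borel_measurable M" "\<phi> \<in> borel_measurable M" and "\<And>x. \<phi> x \<le> 0 \<Longrightarrow> u x = 0"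
  shows "(\<integral>\<^sup>+x. u x \<partial>M) = (\<integral>\<^sup>+k. (\<integral>\<^sup>+x\<in>{x. 2 powr real_of_int k < \<phi> x \<and> \<phi> x \<le> 2 powr (real_of_int k + 1)}. u x \<partial>M) \<partial>count_space UNIV)"
proof -
  have "(\<integral>\<^sup>+x. u x \<partial>M) = (\<integral>\<^sup>+x. (\<integral>\<^sup>+k. u x * indicator {x. 2 powr real_of_int k < \<phi> x \<and> \<phi> x \<le> 2 powr (real_of_int k + 1)} x \<partial>count_space UNIV) \<partial>M)"
  proof (rule nn_integral_cong)
    fix x
    have "(\<integral>\<^sup>+k. u x * indicator {x. 2 powr real_of_int k < \<phi> x \<and> \<phi> x \<le> 2 powr (real_of_int k + 1)} x \<partial>count_space UNIV) =
      (\<integral>\<^sup>+k. u x * indicator {k :: int. 2 powr real_of_int k < \<phi> x \<and> \<phi> x \<le> 2 powr (real_of_int k + 1)} k \<partial>count_space UNIV)"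
      by (intro nn_integral_cong) (auto simp: indicator_def)
    then show "u x = (\<integral>\<^sup>+k. u x * indicator {x. 2 powr real_of_int k < \<phi> x \<and> \<phi> x \<le> 2 powr (real_of_int k + 1)} x \<partial>count_space UNIV)"
      unfolding dyadic_layer_sum using assms(3)[of x] by auto
  qed
  also have "\<dots> = (\<integral>\<^sup>+k. (\<integral>\<^sup>+x\<in>{x. 2 powr real_of_int k < \<phi> x \<and> \<phi> x \<le> 2 powr (real_of_int k + 1)}. u x \<partial>M) \<partial>count_space UNIV)"
  proof (rule nn_integral_count_space_nn_integral)
    show "(\<lambda>x. u x * indicator {x. 2 powr real_of_int k < \<phi> x \<and> \<phi> x \<le> 2 powr (real_of_int k + 1)} x) \<in> borel_measurable M" for k
      by measurable
  qed simp
  finally show ?thesis .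
qed

lemma nn_integral_powr_levels:
  fixes \<phi> :: "'a \<Rightarrow> real"
  assumes [measurable]: "\<phi> \<in> borel_measurable M" and s: "0 < s" and \<phi>0: "\<And>x. 0 \<le> \<phi> x"
  shows "(\<integral>\<^sup>+x. ennreal (\<phi> x powr s) \<partial>M) \<le>
    (\<integral>\<^sup>+k. ennreal (2 powr (s * (real_of_int k + 1))) * emeasure M {x \<in> space M. 2 powr real_of_int k < \<phi> x} \<partial>count_space UNIV)"
proof -
  have "(\<integral>\<^sup>+x. ennreal (\<phi> x powr s) \<partial>M) =
      (\<integral>\<^sup>+k. (\<integral>\<^sup>+x\<in>{x. 2 powr real_of_int k < \<phi> x \<and> \<phi> x \<le> 2 powr (real_of_int k + 1)}. ennreal (\<phi> x powr s) \<partial>M) \<partial>count_space UNIV)"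
  proof (rule nn_integral_layers)
    fix x assume "\<phi> x \<le> 0"
    then have "\<phi> x = 0" using \<phi>0[of x] by simp
    then show "ennreal (\<phi> x powr s) = 0" by simp
  qed measurable
  also have "\<dots> \<le> (\<integral>\<^sup>+k. ennreal (2 powr (s * (real_of_int k + 1))) * emeasure M {x \<in> space M. 2 powr real_of_int k < \<phi> x} \<partial>count_space UNIV)"
  proof (rule nn_integral_mono)
    fix k :: int
    have "(\<integral>\<^sup>+x\<in>{x. 2 powr real_of_int k < \<phi> x \<and> \<phi> x \<le> 2 powr (real_of_int k + 1)}. ennreal (\<phi> x powr s) \<partial>M)
      \<le> (\<integral>\<^sup>+x. ennreal (2 powr (s * (real_of_int k + 1))) * indicator {x \<in> space M. 2 powr real_of_int k < \<phi> x} x \<partial>M)"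
    proof (rule nn_integral_mono)
      fix x assume "x \<in> space M"
      have "\<phi> x powr s \<le> 2 powr (s * (real_of_int k + 1))" if "\<phi> x \<le> 2 powr (real_of_int k + 1)"
      proof -
        have "\<phi> x powr s \<le> (2 powr (real_of_int k + 1)) powr s" using that s \<phi>0 by (intro powr_mono2) auto
        then show ?thesis by (simp add: powr_powr mult.commute)
      qed
      then show "ennreal (\<phi> x powr s) * indicator {x. 2 powr real_of_int k < \<phi> x \<and> \<phi> x \<le> 2 powr (real_of_int k + 1)} x
        \<le> ennreal (2 powr (s * (real_of_int k + 1))) * indicator {x \<in> space M. 2 powr real_of_int k < \<phi> x} x"
        using \<open>x \<in> space M\<close> by (auto simp: indicator_def ennreal_leI)
    qed
    also have "\<dots> = ennreal (2 powr (s * (real_of_int k + 1))) * emeasure M {x \<in> space M. 2 powr real_of_int k < \<phi> x}"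
      by (rule nn_integral_cmult_indicator) measurable
    finally show "(\<integral>\<^sup>+x\<in>{x. 2 powr real_of_int k < \<phi> x \<and> \<phi> x \<le> 2 powr (real_of_int k + 1)}. ennreal (\<phi> x powr s) \<partial>M)
      \<le> ennreal (2 powr (s * (real_of_int k + 1))) * emeasure M {x \<in> space M. 2 powr real_of_int k < \<phi> x}" .
  qed
  finally show ?thesis .
qed

lemmas nn_integral_powr_levels_lebesgue =
  nn_integral_powr_levels[where M = lebesgue, unfolded space_completion space_lborel space_borel eqTrueI[OF UNIV_I] simp_thms]

section \<open>Averages and maxima over finitely many generations\<close>

text \<open>Real-valued through \<open>enn2real\<close>, so an infinite integral would give average
  0; this is why \<open>avg_eq\<close> asks for finiteness.\<close>

definition avg :: "(real ^ 'n \<Rightarrow> real) \<Rightarrow> (real ^ 'n) set \<Rightarrow> real" where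
  "avg f Q = enn2real (\<integral>\<^sup>+x\<in>Q. ennreal (f x) \<partial>lebesgue) / vol Q"

lemma avg_nonneg: "0 \<le> avg f Q"
  by (simp add: avg_def)

lemma avg_eq:
  assumes "is_cube Q" "(\<integral>\<^sup>+x\<in>Q. ennreal (f x) \<partial>lebesgue) < \<infinity>"
  shows "(\<integral>\<^sup>+x\<in>Q. ennreal (f x) \<partial>lebesgue) = ennreal (avg f Q * vol Q)"
  using is_cubeD(3)[OF assms(1)] assms(2) by (simp add: avg_def)

text \<open>Finitely many generations make this a maximum of real numbers that is attained; all
  bounds are uniform in \<open>N\<close>. \<open>G\<close> is any function of cubes, so that
  averages and thresholds are treated alike.\<close>

definition dmax :: "real ^ 'n \<Rightarrow> real \<Rightarrow> nat \<Rightarrow> ((real ^ 'n) set \<Rightarrow> real) \<Rightarrow> real ^ 'n \<Rightarrow> real" where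
  "dmax a L N G x = Max ((\<lambda>k. G (dcube a L k x)) ` {..N})"

lemma dmax_ge: "k \<le> N \<Longrightarrow> G (dcube a L k x) \<le> dmax a L N G x"
  unfolding dmax_def by (rule Max_ge) auto

lemma dmax_ex: "\<exists>k\<le>N. dmax a L N G x = G (dcube a L k x)"
proof -
  have "dmax a L N G x \<in> (\<lambda>k. G (dcube a L k x)) ` {..N}" unfolding dmax_def by (rule Max_in) auto
  then show ?thesis by auto
qed

lemma dmax_nonneg: "(\<And>Q. 0 \<le> G Q) \<Longrightarrow> 0 \<le> dmax a L N G x"
  using dmax_ex by metis

lemma dmax_level: "{x. c < dmax a L N G x} = \<Union>(stop_cubes a L (\<lambda>k R. k \<le> N \<and> c < G R))"
  unfolding Union_stop_cubes using dmax_ex[of N a L G] dmax_ge[of _ N G a L] by (auto intro: less_le_trans) metis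

lemma measurable_dmax [measurable]:
  fixes a :: "real ^ 'n"
  shows "dmax a L N G \<in> borel_measurable lebesgue"
proof -
  have "(\<lambda>x. G (dcube a L k x)) \<in> borel_measurable lebesgue" for k
    using measurable_compose[OF measurable_dcube, of G borel] by simp
  then have "(\<lambda>x. Max ((\<lambda>k. G (dcube a L k x)) ` {..N})) \<in> borel_measurable lebesgue"
    by (intro borel_measurable_Max) auto
  then show ?thesis unfolding dmax_def[abs_def] .
qed

text \<open>On a stopping cube the points with \<open>g \<le> c / 2\<close> carry less than half of
  the integral, so the others carry at least \<open>c / 2 * vol Q\<close>. Restricting the
  right-hand side to these is what makes the passage to powers above 1 work.\<close>

lemma dmax_weak_type:
  assumes L: "0 < L" and [measurable]: "g \<in> borel_measurable lebesgue" and g0: "\<And>x. 0 \<le> g x" and c: "0 < c"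
    and fin: "\<And>k x. (\<integral>\<^sup>+z\<in>dcube a L k x. ennreal (g z) \<partial>lebesgue) < \<infinity>"
  shows "ennreal (c / 2) * emeasure lebesgue {x. c < dmax a L N (avg g) x} \<le> (\<integral>\<^sup>+z\<in>{z. c / 2 < g z}. ennreal (g z) \<partial>lebesgue)"
proof -
  define F where "F = stop_cubes a L (\<lambda>k R. k \<le> N \<and> c < avg g R)"
  have F: "cube_family F" unfolding F_def by (rule cube_family_stop_cubes[OF L])
  have lev: "{x. c < dmax a L N (avg g) x} = \<Union>F" unfolding F_def by (rule dmax_level)
  have "(\<integral>\<^sup>+z\<in>\<Union>F. ennreal (c / 2) \<partial>lebesgue) \<le> (\<integral>\<^sup>+z\<in>\<Union>F. ennreal (g z) * indicator {z. c / 2 < g z} z \<partial>lebesgue)"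
  proof (rule nn_integral_Union_mono[OF cube_familyD(3,2)[OF F]])
    fix Q assume Q: "Q \<in> F"
    note Qc = cube_familyD(1)[OF F Q] note Qm = is_cubeD[OF Qc]
    have [measurable]: "Q \<in> sets lebesgue" by (rule Qm)
    obtain k x where kx: "Q = dcube a L k x" "c < avg g Q" using Q unfolding F_def stop_cubes_def by blast
    define I where "I = (\<integral>\<^sup>+z\<in>Q. ennreal (g z) * indicator {z. c / 2 < g z} z \<partial>lebesgue)"
    have "ennreal (c / 2 * vol Q) + ennreal (c / 2 * vol Q) = ennreal (c * vol Q)"
      using c by (simp flip: ennreal_plus)
    also have "\<dots> \<le> ennreal (avg g Q * vol Q)"
      using kx(2) by (intro ennreal_leI mult_right_mono) auto
    also have "\<dots> = (\<integral>\<^sup>+z\<in>Q. ennreal (g z) \<partial>lebesgue)"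
      by (rule avg_eq[symmetric, OF Qc]) (unfold kx(1), rule fin)
    also have "\<dots> \<le> (\<integral>\<^sup>+z. ennreal (c / 2) * indicator Q z + ennreal (g z) * indicator {z. c / 2 < g z} z * indicator Q z \<partial>lebesgue)"
      by (rule nn_integral_mono) (auto simp: indicator_def ennreal_leI)
    also have "\<dots> = (\<integral>\<^sup>+z. ennreal (c / 2) * indicator Q z \<partial>lebesgue) + I"
      unfolding I_def by (rule nn_integral_add) measurable
    also have "(\<integral>\<^sup>+z. ennreal (c / 2) * indicator Q z \<partial>lebesgue) = ennreal (c / 2 * vol Q)"
      using c by (intro nn_integral_const_cube[OF Qc]) simp
    finally have "ennreal (c / 2 * vol Q) \<le> I"
      by (simp add: ennreal_add_left_cancel_le)
    then show "(\<integral>\<^sup>+z\<in>Q. ennreal (c / 2) \<partial>lebesgue) \<le> (\<integral>\<^sup>+z\<in>Q. ennreal (g z) * indicator {z. c / 2 < g z} z \<partial>lebesgue)"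
      unfolding I_def using c by (subst nn_integral_const_cube[OF Qc]) auto
  qed (use cube_familyD(5)[OF F] in auto)
  also have "\<dots> \<le> (\<integral>\<^sup>+z\<in>{z. c / 2 < g z}. ennreal (g z) \<partial>lebesgue)"
    by (rule nn_integral_mono) (auto simp: indicator_def)
  finally show ?thesis unfolding lev using cube_familyD(4)[OF F] by (simp add: nn_integral_cmult_indicator)
qed

text \<open>\<open>2 powr (2 * s)\<close> is \<open>2 powr (s + 1)\<close>, from the upper end of a
  layer and the halved level, times \<open>2 powr (s - 1)\<close>, from the levels up to
  \<open>2 * g\<close>; the denominator sums the geometric series.\<close>

definition max_const :: "real \<Rightarrow> real" where
  "max_const s = 2 powr (2 * s) / (1 - 2 powr (- (s - 1)))"

lemma max_const_pos: "1 < s \<Longrightarrow> 0 < max_const s"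
  unfolding max_const_def by (simp add: powr_less_one)

text \<open>A value \<open>g z\<close> contributes only to the weak bounds at levels below
  \<open>2 * g z\<close>, and since \<open>s > 1\<close> these add up to a multiple of
  \<open>g z powr s\<close>.\<close>

lemma dmax_strong_type:
  assumes L: "0 < L" and g[measurable]: "g \<in> borel_measurable lebesgue" and g0: "\<And>x. 0 \<le> g x" and s: "1 < s"
    and fin: "\<And>k x. (\<integral>\<^sup>+z\<in>dcube a L k x. ennreal (g z) \<partial>lebesgue) < \<infinity>"
  shows "(\<integral>\<^sup>+x. ennreal (dmax a L N (avg g) x powr s) \<partial>lebesgue) \<le> ennreal (max_const s) * (\<integral>\<^sup>+x. ennreal (g x powr s) \<partial>lebesgue)"
proof -
  define P where "P k z \<longleftrightarrow> 2 powr (real_of_int k) < 2 * g z" for k :: int and z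
  have Pm[measurable]: "Measurable.pred lebesgue (P k)" for k unfolding P_def by measurable
  have "(\<integral>\<^sup>+x. ennreal (dmax a L N (avg g) x powr s) \<partial>lebesgue) \<le>
    (\<integral>\<^sup>+k. ennreal (2 powr (s * (real_of_int k + 1))) * emeasure lebesgue {x. 2 powr real_of_int k < dmax a L N (avg g) x} \<partial>count_space UNIV)"
    by (rule nn_integral_powr_levels_lebesgue) (use s in \<open>auto intro: dmax_nonneg avg_nonneg\<close>)
  also have "\<dots> \<le> (\<integral>\<^sup>+k. (\<integral>\<^sup>+z. ennreal (2 powr (s + 1)) * (ennreal (2 powr ((s - 1) * real_of_int k)) * ennreal (g z) * indicator {z. P k z} z) \<partial>lebesgue) \<partial>count_space UNIV)"
  proof (rule nn_integral_mono)
    fix k :: int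
    define c :: real where "c = 2 powr k"
    have c: "0 < c" by (simp add: c_def)
    have e: "2 powr (s * (real_of_int k + 1)) = 2 powr (s + 1) * 2 powr ((s - 1) * k) * (c / 2)"
    proof -
      have "2 powr (s * (real_of_int k + 1)) = 2 powr ((s + 1) + (s - 1) * k + (real_of_int k - 1))" by (simp add: algebra_simps)
      also have "\<dots> = 2 powr (s + 1) * 2 powr ((s - 1) * k) * 2 powr (real_of_int k - 1)" by (simp only: powr_add)
      also have "2 powr (real_of_int k - 1) = c / 2" by (simp add: c_def powr_diff)
      finally show ?thesis .
    qed
    have "ennreal (2 powr (s * (real_of_int k + 1))) * emeasure lebesgue {x. c < dmax a L N (avg g) x} =
        ennreal (2 powr (s + 1) * 2 powr ((s - 1) * k)) * (ennreal (c / 2) * emeasure lebesgue {x. c < dmax a L N (avg g) x})"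
      unfolding e using c by (subst ennreal_mult) (simp_all only: mult.assoc, simp_all)
    also have "\<dots> \<le> ennreal (2 powr (s + 1) * 2 powr ((s - 1) * k)) * (\<integral>\<^sup>+z\<in>{z. c / 2 < g z}. ennreal (g z) \<partial>lebesgue)"
      by (intro mult_left_mono dmax_weak_type[OF L g g0 c fin]) simp
    also have "\<dots> = (\<integral>\<^sup>+z. ennreal (2 powr (s + 1) * 2 powr ((s - 1) * k)) * (ennreal (g z) * indicator {z. c / 2 < g z} z) \<partial>lebesgue)"
      by (rule nn_integral_cmult[symmetric]) measurable
    also have "\<dots> = (\<integral>\<^sup>+z. ennreal (2 powr (s + 1)) * (ennreal (2 powr ((s - 1) * real_of_int k)) * ennreal (g z) * indicator {z. P k z} z) \<partial>lebesgue)"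
      by (intro nn_integral_cong) (auto simp: indicator_def ennreal_mult mult.assoc c_def P_def)
    finally show "ennreal (2 powr (s * (real_of_int k + 1))) * emeasure lebesgue {x. 2 powr real_of_int k < dmax a L N (avg g) x} \<le>
        (\<integral>\<^sup>+z. ennreal (2 powr (s + 1)) * (ennreal (2 powr ((s - 1) * real_of_int k)) * ennreal (g z) * indicator {z. P k z} z) \<partial>lebesgue)"
      unfolding c_def .
  qed
  also have "\<dots> = (\<integral>\<^sup>+z. (\<integral>\<^sup>+k. ennreal (2 powr (s + 1)) * (ennreal (2 powr ((s - 1) * real_of_int k)) * ennreal (g z) * indicator {z. P k z} z) \<partial>count_space UNIV) \<partial>lebesgue)"
    by (rule nn_integral_count_space_nn_integral[symmetric]) (simp, measurable)
  also have "\<dots> \<le> (\<integral>\<^sup>+z. ennreal (max_const s) * ennreal (g z powr s) \<partial>lebesgue)"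
  proof (rule nn_integral_mono)
    fix z
    have "(\<integral>\<^sup>+k. ennreal (2 powr (s + 1)) * (ennreal (2 powr ((s - 1) * real_of_int k)) * ennreal (g z) * indicator {z. P k z} z) \<partial>count_space UNIV) =
      (\<integral>\<^sup>+k. ennreal (2 powr (s + 1) * g z) * (ennreal (2 powr ((s - 1) * real_of_int k)) * indicator {k. 2 powr real_of_int k < 2 * g z} k) \<partial>count_space UNIV)"
      using g0[of z] by (intro nn_integral_cong) (auto simp: indicator_def P_def ennreal_mult mult_ac)
    also have "\<dots> = ennreal (2 powr (s + 1) * g z) * (\<integral>\<^sup>+k. ennreal (2 powr ((s - 1) * real_of_int k)) * indicator {k. 2 powr real_of_int k < 2 * g z} k \<partial>count_space UNIV)"
      by (rule nn_integral_cmult) simp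
    also have "\<dots> \<le> ennreal (max_const s) * ennreal (g z powr s)"
    proof (cases "g z = 0")
      case False
      then have gz: "0 < g z" using g0[of z] by simp
      have "(\<integral>\<^sup>+k. ennreal (2 powr ((s - 1) * real_of_int k)) * indicator {k. 2 powr real_of_int k < 2 * g z} k \<partial>count_space UNIV)
        \<le> ennreal ((2 * g z) powr (s - 1) / (1 - 2 powr (- (s - 1))))"
        by (rule geometric_int_sum) (use s gz in auto)
      then have "ennreal (2 powr (s + 1) * g z) * (\<integral>\<^sup>+k. ennreal (2 powr ((s - 1) * real_of_int k)) * indicator {k. 2 powr real_of_int k < 2 * g z} k \<partial>count_space UNIV)
        \<le> ennreal (2 powr (s + 1) * g z) * ennreal ((2 * g z) powr (s - 1) / (1 - 2 powr (- (s - 1))))"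
        by (rule mult_left_mono) simp
      also have "\<dots> = ennreal (2 powr (s + 1) * g z * ((2 * g z) powr (s - 1) / (1 - 2 powr (- (s - 1)))))"
        using gz by (intro ennreal_mult[symmetric]) (auto simp: powr_less_one s less_imp_le)
      also have "2 powr (s + 1) * g z * ((2 * g z) powr (s - 1) / (1 - 2 powr (- (s - 1)))) = max_const s * g z powr s"
      proof -
        have "g z * (2 * g z) powr (s - 1) = 2 powr (s - 1) * g z powr s"
          using gz by (simp add: powr_mult powr_diff)
        moreover have "2 powr (s + 1) * 2 powr (s - 1) = (2 :: real) powr (2 * s)" by (simp flip: powr_add)
        ultimately show ?thesis unfolding max_const_def by (simp add: mult.assoc)
      qed
      also have "ennreal (max_const s * g z powr s) = ennreal (max_const s) * ennreal (g z powr s)"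
        using max_const_pos[OF s] by (simp add: ennreal_mult)
      finally show ?thesis .
    qed simp
    finally show "(\<integral>\<^sup>+k. ennreal (2 powr (s + 1)) * (ennreal (2 powr ((s - 1) * real_of_int k)) * ennreal (g z) * indicator {z. P k z} z) \<partial>count_space UNIV)
      \<le> ennreal (max_const s) * ennreal (g z powr s)" .
  qed
  also have "\<dots> = ennreal (max_const s) * (\<integral>\<^sup>+x. ennreal (g x powr s) \<partial>lebesgue)"
    by (rule nn_integral_cmult) measurable
  finally show ?thesis .
qed

text \<open>The level set at \<open>c\<close> is a disjoint union of cubes with
  \<open>\<beta> > c\<close>, hence of measure at most \<open>T / c\<close>. As
  \<open>\<beta> \<le> 1\<close>, only levels below 1 occur, and there a weak \<open>L^1\<close>
  bound controls every power above 1.\<close>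

lemma dmax_thresholds:
  fixes a :: "real ^ 'n"
  assumes L: "0 < L" and th: "thresholds {dcube a L k x | k x. True} T \<beta>" and s: "1 < s"
  shows "(\<integral>\<^sup>+x. ennreal (dmax a L N \<beta> x powr s) \<partial>lebesgue) \<le> ennreal (T * max_const s)"
proof -
  have \<beta>: "0 \<le> \<beta> Q" "\<beta> Q \<le> 1" for Q using th unfolding thresholds_def by auto
  have T0: "0 \<le> T" by (rule thresholds_nonneg[OF th])
  have weak: "emeasure lebesgue {x. c < dmax a L N \<beta> x} \<le> ennreal (T / c)" if c: "0 < c" for c
  proof -
    define F where "F = stop_cubes a L (\<lambda>k R. k \<le> N \<and> c < \<beta> R)"
    have F: "cube_family F" unfolding F_def by (rule cube_family_stop_cubes[OF L])
    have FD: "F \<subseteq> {dcube a L k x | k x. True}" unfolding F_def stop_cubes_def by blast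
    \<comment> \<open>The threshold condition speaks of finite families; the whole union is reached
      as a limit.\<close>
    have bd: "vol (\<Union>H) \<le> T / c" if H: "H \<subseteq> F" "finite H" for H
    proof -
      have HF: "cube_family H" by (rule cube_family_subset[OF F H(1)])
      have "vol (\<Union>H) \<le> (\<Sum>Q\<in>H. vol Q)"
        using H(2) cube_familyD(5)[OF HF] by (rule measure_Union_le)
      also have "\<dots> \<le> (\<Sum>Q\<in>H. vol Q * \<beta> Q / c)"
      proof (rule sum_mono)
        fix Q assume "Q \<in> H"
        then have "c < \<beta> Q" using H(1) unfolding F_def stop_cubes_def by blast
        then show "vol Q \<le> vol Q * \<beta> Q / c"
          using c mult_right_mono[of c "\<beta> Q" "vol Q"] by (simp add: field_simps)
      qed
      also have "\<dots> = (\<Sum>Q\<in>H. vol Q * \<beta> Q) / c" by (rule sum_divide_distrib[symmetric])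
      also have "\<dots> \<le> T / c"
      proof (rule divide_right_mono)
        show "(\<Sum>Q\<in>H. vol Q * \<beta> Q) \<le> T"
          using th H HF FD unfolding thresholds_def by (meson order.trans)
      qed (use c in auto)
      finally show ?thesis .
    qed
    have "(\<Union>Q\<in>F. Q) \<in> lmeasurable" "vol (\<Union>Q\<in>F. Q) \<le> T / c"
      by (rule fmeasurable_UN_bound[where B = "T / c"] measure_UN_bound[where B = "T / c"];
          use bd cube_familyD(3)[OF F] is_cubeD(2)[OF cube_familyD(1)[OF F]] in simp)+
    then show ?thesis unfolding dmax_level F_def[symmetric] by (simp add: emeasure_eq_measure2 ennreal_leI)
  qed
  have le1: "dmax a L N \<beta> x \<le> 1" for x using dmax_ex[of N a L \<beta> x] \<beta> by metis
  have "(\<integral>\<^sup>+x. ennreal (dmax a L N \<beta> x powr s) \<partial>lebesgue) \<le>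
    (\<integral>\<^sup>+k. ennreal (2 powr (s * (real_of_int k + 1))) * emeasure lebesgue {x. 2 powr real_of_int k < dmax a L N \<beta> x} \<partial>count_space UNIV)"
    by (rule nn_integral_powr_levels_lebesgue) (use s \<beta> in \<open>auto intro: dmax_nonneg\<close>)
  also have "\<dots> \<le> (\<integral>\<^sup>+k. ennreal (2 powr s * T) * (ennreal (2 powr ((s - 1) * real_of_int k)) * indicator {k :: int. 2 powr real_of_int k < 1} k) \<partial>count_space UNIV)"
  proof (rule nn_integral_mono)
    fix k :: int
    show "ennreal (2 powr (s * (real_of_int k + 1))) * emeasure lebesgue {x. 2 powr real_of_int k < dmax a L N \<beta> x} \<le>
        ennreal (2 powr s * T) * (ennreal (2 powr ((s - 1) * real_of_int k)) * indicator {k :: int. 2 powr real_of_int k < 1} k)"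
    proof (cases "2 powr real_of_int k < 1")
      case True
      have "ennreal (2 powr (s * (real_of_int k + 1))) * emeasure lebesgue {x. 2 powr real_of_int k < dmax a L N \<beta> x}
        \<le> ennreal (2 powr (s * (real_of_int k + 1))) * ennreal (T / 2 powr real_of_int k)"
        by (intro mult_left_mono weak) auto
      also have "\<dots> = ennreal (2 powr (s * (real_of_int k + 1)) * (T / 2 powr real_of_int k))"
        using T0 by (intro ennreal_mult[symmetric]) auto
      also have "2 powr (s * (real_of_int k + 1)) * (T / 2 powr real_of_int k) = 2 powr s * T * 2 powr ((s - 1) * real_of_int k)"
      proof -
        have "2 powr (s * (real_of_int k + 1)) = 2 powr s * 2 powr ((s - 1) * real_of_int k) * 2 powr real_of_int k"
          by (simp add: algebra_simps flip: powr_add)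
        then show ?thesis by simp
      qed
      also have "ennreal (2 powr s * T * 2 powr ((s - 1) * real_of_int k)) = ennreal (2 powr s * T) * ennreal (2 powr ((s - 1) * real_of_int k))"
        using T0 by (intro ennreal_mult) auto
      finally have "ennreal (2 powr (s * (real_of_int k + 1))) * emeasure lebesgue {x. 2 powr real_of_int k < dmax a L N \<beta> x} \<le>
        ennreal (2 powr s * T) * ennreal (2 powr ((s - 1) * real_of_int k))" .
      moreover have "indicator {k :: int. 2 powr real_of_int k < 1} k = (1 :: ennreal)" using True by simp
      ultimately show ?thesis by (simp only: mult_1_right)
    next
      case False
      have "\<not> 2 powr real_of_int k < dmax a L N \<beta> x" for x using le1[of x] False by linarith
      then have e: "{x. 2 powr real_of_int k < dmax a L N \<beta> x} = {}" by blast
      show ?thesis unfolding e emeasure_empty mult_zero_right by (rule zero_le)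
    qed
  qed
  also have "\<dots> = ennreal (2 powr s * T) * (\<integral>\<^sup>+k. ennreal (2 powr ((s - 1) * real_of_int k)) * indicator {k :: int. 2 powr real_of_int k < 1} k \<partial>count_space UNIV)"
    by (rule nn_integral_cmult) simp
  also have "\<dots> \<le> ennreal (2 powr s * T) * ennreal (1 powr (s - 1) / (1 - 2 powr (- (s - 1))))"
    by (intro mult_left_mono geometric_int_sum) (use s in auto)
  also have "\<dots> = ennreal (2 powr s * T * (1 / (1 - 2 powr (- (s - 1)))))"
    using T0 s by (subst ennreal_mult[symmetric]) (auto simp: powr_less_one less_imp_le)
  also have "\<dots> \<le> ennreal (T * max_const s)"
  proof (rule ennreal_leI)
    have "2 powr s \<le> (2 :: real) powr (2 * s)" using s by (intro powr_mono) auto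
    then have "2 powr s * (T * (1 / (1 - 2 powr (- (s - 1))))) \<le> 2 powr (2 * s) * (T * (1 / (1 - 2 powr (- (s - 1)))))"
      using T0 s by (intro mult_right_mono mult_nonneg_nonneg) (auto simp: powr_less_one less_imp_le)
    then show "2 powr s * T * (1 / (1 - 2 powr (- (s - 1)))) \<le> T * max_const s"
      by (simp add: max_const_def mult_ac)
  qed
  finally show ?thesis .
qed

text \<open>Cubes have finite measure and
  \<open>f x powr \<sigma> x \<le> 1 + f x powr r x\<close>.\<close>

lemma (in exponent) powr_integrable_cube:
  assumes [measurable]: "f \<in> borel_measurable lebesgue" and f0: "\<And>x. 0 \<le> f x" and Q: "is_cube Q"
    and f1: "modular r UNIV f \<le> 1" and \<sigma>: "\<And>x. 0 \<le> \<sigma> x" "\<And>x. \<sigma> x \<le> r x"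
  shows "(\<integral>\<^sup>+x\<in>Q. ennreal (f x powr \<sigma> x) \<partial>lebesgue) < \<infinity>"
proof -
  note Qm = is_cubeD[OF Q]
  have [measurable]: "Q \<in> sets lebesgue" by (rule Qm)
  have "(\<integral>\<^sup>+x\<in>Q. ennreal (f x powr \<sigma> x) \<partial>lebesgue) \<le> (\<integral>\<^sup>+x. indicator Q x + ennreal (f x powr r x) \<partial>lebesgue)"
  proof (rule nn_integral_mono)
    fix x
    have "f x powr \<sigma> x \<le> 1 + f x powr r x"
    proof (cases "f x \<le> 1")
      case True
      then have "f x powr \<sigma> x \<le> 1" using f0 \<sigma> by (intro powr_le1) auto
      then show ?thesis by (simp add: add_increasing2)
    next
      case False
      then have "f x powr \<sigma> x \<le> f x powr r x" using \<sigma> by (intro powr_mono) auto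
      then show ?thesis by simp
    qed
    then have "ennreal (f x powr \<sigma> x) \<le> 1 + ennreal (f x powr r x)"
      by (metis ennreal_1 ennreal_leI ennreal_plus powr_ge_zero zero_le_one)
    then show "ennreal (f x powr \<sigma> x) * indicator Q x \<le> indicator Q x + ennreal (f x powr r x)"
      by (cases "x \<in> Q") auto
  qed
  also have "\<dots> = emeasure lebesgue Q + modular r UNIV f"
    unfolding modular_def by (subst nn_integral_add) auto
  also have "\<dots> < \<infinity>" using Qm(4) f1 by (auto simp: top_unique less_top[symmetric])
  finally show ?thesis .
qed

text \<open>Each level set of the maximal function is split into stopping cubes; on at least half of each cube the
  maximal function is comparable to its average over the cube, so that the levels have bounded overlap.\<close>

lemma (in exponent) dmax_modular:
  fixes a :: "real ^ 'n"
  assumes L: "0 < L" and f[measurable]: "f \<in> borel_measurable lebesgue" and f0: "\<And>x. 0 \<le> f x"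
    and f1: "modular r UNIV f \<le> 1" and s1: "1 < s1" "s1 < pm" and J: "0 \<le> J"
    and th: "thresholds {dcube a L k x | k x. True} T \<beta>"
    and jen: "\<And>k x. (\<integral>\<^sup>+z\<in>dcube a L k x. ennreal (avg f (dcube a L k x) powr r z) \<partial>lebesgue) \<le>
      ennreal (J * (avg (\<lambda>z. f z powr (r z / s1)) (dcube a L k x) powr s1 + \<beta> (dcube a L k x) powr s1) * vol (dcube a L k x))"
  shows "modular r UNIV (dmax a L N (avg f)) \<le> ennreal (4 * 2 powr pp * J * max_const s1 * (1 + T))"
proof -
  have \<beta>: "0 \<le> \<beta> Q" for Q using th unfolding thresholds_def by auto
  have T0: "0 \<le> T" by (rule thresholds_nonneg[OF th])
  define M where "M = dmax a L N (avg f)"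
  have M[measurable]: "M \<in> borel_measurable lebesgue" by (simp add: M_def)
  have M0: "0 \<le> M x" for x by (simp add: M_def dmax_nonneg avg_nonneg)
  define g where "g z = f z powr (r z / s1)" for z
  have g[measurable]: "g \<in> borel_measurable lebesgue" unfolding g_def by measurable
  \<comment> \<open>Dominates the bracket in \<open>jen\<close> for every dyadic cube of generation
    at most \<open>N\<close> that contains \<open>x\<close>, and is integrable by the two maximal
    estimates.\<close>
  define H where "H x = dmax a L N (avg g) x powr s1 + dmax a L N \<beta> x powr s1" for x
  have H[measurable]: "H \<in> borel_measurable lebesgue" unfolding H_def by measurable
  have H0: "0 \<le> H x" for x by (simp add: H_def)
  have finf: "(\<integral>\<^sup>+z\<in>dcube a L k x. ennreal (f z) \<partial>lebesgue) < \<infinity>" for k x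
    using powr_integrable_cube[OF f f0 is_cube_dcube[OF L] f1, of "\<lambda>_. 1"] f0 r_pos(2) by (simp add: less_imp_le)
  have fing: "(\<integral>\<^sup>+z\<in>dcube a L k x. ennreal (g z) \<partial>lebesgue) < \<infinity>" for k x
    unfolding g_def
  proof (rule powr_integrable_cube[OF f f0 is_cube_dcube[OF L] f1])
    fix x
    show "0 \<le> r x / s1" using r_pos(1)[of x] s1 by simp
    show "r x / s1 \<le> r x" using r_pos(1)[of x] s1 by (simp add: divide_le_eq)
  qed
  have intH: "(\<integral>\<^sup>+x. ennreal (H x) \<partial>lebesgue) \<le> ennreal (max_const s1 * (1 + T))"
  proof -
    have "(\<integral>\<^sup>+x. ennreal (H x) \<partial>lebesgue) =
        (\<integral>\<^sup>+x. ennreal (dmax a L N (avg g) x powr s1) + ennreal (dmax a L N \<beta> x powr s1) \<partial>lebesgue)"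
      by (intro nn_integral_cong) (simp add: H_def)
    also have "\<dots> = (\<integral>\<^sup>+x. ennreal (dmax a L N (avg g) x powr s1) \<partial>lebesgue) + (\<integral>\<^sup>+x. ennreal (dmax a L N \<beta> x powr s1) \<partial>lebesgue)"
      by (rule nn_integral_add) measurable
    also have "\<dots> \<le> ennreal (max_const s1) * (\<integral>\<^sup>+x. ennreal (g x powr s1) \<partial>lebesgue) + ennreal (T * max_const s1)"
      by (intro add_mono dmax_strong_type[OF L g _ s1(1) fing] dmax_thresholds[OF L th s1(1)]) (simp add: g_def)
    also have "(\<integral>\<^sup>+x. ennreal (g x powr s1) \<partial>lebesgue) = modular r UNIV f"
      unfolding modular_def g_def using s1 by (simp add: powr_powr)
    also have "ennreal (max_const s1) * modular r UNIV f + ennreal (T * max_const s1) \<le> ennreal (max_const s1) * 1 + ennreal (T * max_const s1)"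
      using f1 by (intro add_right_mono mult_left_mono) auto
    also have "\<dots> = ennreal (max_const s1 * (1 + T))"
      using max_const_pos[OF s1(1)] T0 by (simp add: algebra_simps flip: ennreal_plus)
    finally show ?thesis .
  qed
  define B where "B k = {x. 2 powr real_of_int k < M x \<and> M x \<le> 2 powr (real_of_int k + 1)}" for k
  have Bm[measurable]: "B k \<in> sets lebesgue" for k
  proof -
    have "B k = {x \<in> space lebesgue. 2 powr real_of_int k < M x \<and> M x \<le> 2 powr (real_of_int k + 1)}" by (simp add: B_def)
    then show ?thesis by (rule ssubst) measurable
  qed
  \<comment> \<open>The factor 2 is the loss from \<open>Q\<close> to \<open>E \<inter> Q\<close>,
    and \<open>2 powr pp\<close> the loss from \<open>M \<le> 2 * avg f Q\<close> on
    \<open>B k\<close>.\<close>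
  define D where "D = 2 * (2 powr pp * J)"
  have D0: "0 \<le> D" using J by (simp add: D_def)
  have level: "(\<integral>\<^sup>+x\<in>B k. ennreal (M x powr r x) \<partial>lebesgue) \<le>
      (\<integral>\<^sup>+x. ennreal D * (ennreal (H x) * indicator (B k) x + ennreal (H x) * indicator (B (k + 1)) x) \<partial>lebesgue)" for k
  proof -
    define c :: real where "c = 2 powr k"
    have c: "0 < c" by (simp add: c_def)
    have c2: "2 powr (real_of_int k + 1) = 2 * c" "2 powr (real_of_int (k + 1) + 1) = 4 * c" "2 powr (real_of_int (k + 1)) = 2 * c"
      by (simp_all add: c_def powr_add)
    have Bc: "B k = {x. c < M x \<and> M x \<le> 2 * c}" "B (k + 1) = {x. 2 * c < M x \<and> M x \<le> 4 * c}"
      unfolding B_def c2 by (simp_all add: c_def)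
    \<comment> \<open>A stopping cube with average above \<open>2 * c\<close> has
      \<open>M > 2 * c\<close> throughout and does not meet \<open>B k\<close>.\<close>
    define F where "F = {Q \<in> stop_cubes a L (\<lambda>j R. j \<le> N \<and> c < avg f R). avg f Q \<le> 2 * c}"
    have F: "cube_family F"
      by (rule cube_family_subset[OF cube_family_stop_cubes[OF L]]) (auto simp: F_def)
    have BF: "B k \<subseteq> \<Union>F"
    proof
      fix x assume x: "x \<in> B k"
      then have "c < M x" by (simp add: Bc)
      then obtain Q where Q: "Q \<in> stop_cubes a L (\<lambda>j R. j \<le> N \<and> c < avg f R)" "x \<in> Q"
        using dmax_level[of c a L N "avg f"] unfolding M_def by blast
      obtain j y where j: "Q = dcube a L j y" "j \<le> N" using Q(1) unfolding stop_cubes_def by blast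
      have "Q = dcube a L j x" using j(1) Q(2) dcube_eq by blast
      then have "avg f Q \<le> M x" unfolding M_def using dmax_ge[OF j(2)] by metis
      then show "x \<in> \<Union>F" using x Q by (auto simp: F_def Bc)
    qed
    define E where "E = {x. c < M x \<and> M x \<le> 4 * c}"
    have Em[measurable]: "E \<in> sets lebesgue"
    proof -
      have "E = {x \<in> space lebesgue. c < M x \<and> M x \<le> 4 * c}" by (simp add: E_def)
      then show ?thesis by (rule ssubst) measurable
    qed
    have "(\<integral>\<^sup>+x\<in>\<Union>F. ennreal (M x powr r x) * indicator (B k) x \<partial>lebesgue) \<le> (\<integral>\<^sup>+x\<in>\<Union>F. ennreal D * (ennreal (H x) * indicator E x) \<partial>lebesgue)"
    proof (rule nn_integral_Union_mono[OF cube_familyD(3,2)[OF F]])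
      fix Q assume QF: "Q \<in> F"
      then have Qst: "Q \<in> stop_cubes a L (\<lambda>j R. j \<le> N \<and> c < avg f R)" and Q2: "avg f Q \<le> 2 * c" by (auto simp: F_def)
      obtain j y where j: "Q = dcube a L j y" "y \<in> Q" "j \<le> N" "c < avg f Q"
        and min: "\<And>i. i < j \<Longrightarrow> \<not> (i \<le> N \<and> c < avg f (dcube a L i y))"
        using stop_cubes_props[OF Qst] by blast
      note Qc = cube_familyD(1)[OF F QF] note Qm = is_cubeD[OF Qc]
      have [measurable]: "Q \<in> sets lebesgue" by (rule Qm)
      define h where "h = avg g Q powr s1 + \<beta> Q powr s1"
      have h0: "0 \<le> h" by (simp add: h_def)
      have Qx: "dcube a L i x = dcube a L i y" if "x \<in> Q" "i \<le> j" for x i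
        using dcube_mono[OF that(2), of a L y] that(1) j(1) dcube_eq by blast
      have hH: "h \<le> H x" if "x \<in> Q" for x
      proof -
        have "dcube a L j x = Q" using Qx[OF that order.refl] j(1) by simp
        then have "avg g Q \<le> dmax a L N (avg g) x" "\<beta> Q \<le> dmax a L N \<beta> x" using dmax_ge[OF j(3)] by metis+
        then show ?thesis unfolding h_def H_def using s1 \<beta> avg_nonneg by (intro add_mono powr_mono2) auto
      qed
      have QM: "c < M x" if "x \<in> Q" for x
      proof -
        have "dcube a L j x = Q" using Qx[OF that order.refl] j(1) by simp
        then have "avg f Q \<le> M x" using dmax_ge[OF j(3), of "avg f" a L x] by (simp add: M_def)
        then show ?thesis using j(4) by simp
      qed
      \<comment> \<open>Where \<open>M > 4 * c\<close> on \<open>Q\<close>, the responsible cube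
        lies inside \<open>Q\<close>, since the larger ones have averages at most \<open>c\<close>.
        Such cubes have averages above \<open>4 * c\<close>, against at most \<open>2 * c\<close> on
        \<open>Q\<close>, so together they fill at most half of \<open>Q\<close>.\<close>
      have half: "vol Q \<le> 2 * vol (E \<inter> Q)"
      proof -
        define R where "R = {R \<in> stop_cubes a L (\<lambda>j R. j \<le> N \<and> 4 * c < avg f R). R \<subseteq> Q}"
        have Rf: "cube_family R"
          by (rule cube_family_subset[OF cube_family_stop_cubes[OF L]]) (auto simp: R_def)
        have UR: "\<Union>R \<subseteq> Q" by (auto simp: R_def)
        have cover: "Q - E \<subseteq> \<Union>R"
        proof
          fix x assume x: "x \<in> Q - E"
          then have "4 * c < M x" using QM[of x] by (auto simp: E_def)
          then obtain S where S: "S \<in> stop_cubes a L (\<lambda>j R. j \<le> N \<and> 4 * c < avg f R)" "x \<in> S"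
            using dmax_level[of "4 * c" a L N "avg f"] unfolding M_def by blast
          obtain i z where i: "S = dcube a L i z" "i \<le> N" "4 * c < avg f S" using S(1) unfolding stop_cubes_def by blast
          have Sx: "S = dcube a L i x" using i(1) S(2) dcube_eq by blast
          have "j \<le> i"
          proof (rule ccontr)
            assume "\<not> j \<le> i"
            then have "S = dcube a L i y" "i < j" using Sx Qx[of x i] x by auto
            then show False using min[of i] i c by auto
          qed
          then have "S \<subseteq> dcube a L j x" unfolding Sx by (rule dcube_mono)
          then have "S \<subseteq> Q" using Qx[of x j] x j(1) by auto
          then show "x \<in> \<Union>R" using S by (auto simp: R_def)
        qed
        have "(\<integral>\<^sup>+x\<in>\<Union>R. ennreal (4 * c) \<partial>lebesgue) \<le> (\<integral>\<^sup>+x\<in>\<Union>R. ennreal (f x) \<partial>lebesgue)"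
        proof (rule nn_integral_Union_mono[OF cube_familyD(3,2)[OF Rf]])
          fix S assume S: "S \<in> R"
          then obtain i z where i: "S = dcube a L i z" "4 * c < avg f S" unfolding R_def stop_cubes_def by blast
          note Sc = cube_familyD(1)[OF Rf S] note Sm = is_cubeD[OF Sc]
          have "(\<integral>\<^sup>+x\<in>S. ennreal (4 * c) \<partial>lebesgue) = ennreal (4 * c * vol S)"
            using c by (intro nn_integral_const_cube[OF Sc]) simp
          also have "\<dots> \<le> ennreal (avg f S * vol S)" using i by (intro ennreal_leI mult_right_mono) auto
          also have "\<dots> = (\<integral>\<^sup>+x\<in>S. ennreal (f x) \<partial>lebesgue)"
            by (rule avg_eq[symmetric, OF Sc]) (unfold i(1), rule finf)
          finally show "(\<integral>\<^sup>+x\<in>S. ennreal (4 * c) \<partial>lebesgue) \<le> (\<integral>\<^sup>+x\<in>S. ennreal (f x) \<partial>lebesgue)" .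
        qed (use cube_familyD(5)[OF Rf] in auto)
        also have "\<dots> \<le> (\<integral>\<^sup>+x\<in>Q. ennreal (f x) \<partial>lebesgue)" by (rule nn_integral_set_mono[OF UR]) simp
        also have "\<dots> = ennreal (avg f Q * vol Q)" by (rule avg_eq[OF Qc]) (unfold j(1), rule finf)
        also have "\<dots> \<le> ennreal (2 * c * vol Q)" using Q2 by (intro ennreal_leI mult_right_mono) auto
        also have "(\<integral>\<^sup>+x\<in>\<Union>R. ennreal (4 * c) \<partial>lebesgue) = ennreal (4 * c * vol (\<Union>R))"
        proof -
          have "\<Union>R \<in> lmeasurable" by (rule fmeasurableI2[OF Qm(2) UR cube_familyD(4)[OF Rf]])
          then show ?thesis using cube_familyD(4)[OF Rf] c
            by (simp add: nn_integral_cmult_indicator ennreal_mult emeasure_eq_measure2)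
        qed
        finally have "4 * c * vol (\<Union>R) \<le> 2 * c * vol Q" using c by (simp add: ennreal_le_iff)
        then have "2 * vol (\<Union>R) \<le> vol Q" using c by simp
        moreover have "vol Q \<le> vol (E \<inter> Q) + vol (\<Union>R)"
        proof -
          have 1: "E \<inter> Q \<in> lmeasurable" by (rule fmeasurable_Int_fmeasurable2[OF Em Qm(2)])
          have 2: "\<Union>R \<in> lmeasurable" by (rule fmeasurableI2[OF Qm(2) UR cube_familyD(4)[OF Rf]])
          have "vol Q \<le> vol (E \<inter> Q \<union> \<Union>R)"
            by (rule measure_mono_fmeasurable) (use cover Qm 1 2 in \<open>auto intro: fmeasurable.Un\<close>)
          also have "\<dots> \<le> vol (E \<inter> Q) + vol (\<Union>R)"
            using 1 2 by (intro measure_Un_le) (auto simp: fmeasurableD)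
          finally show ?thesis .
        qed
        ultimately show ?thesis by simp
      qed
      have "(\<integral>\<^sup>+x\<in>Q. ennreal (M x powr r x) * indicator (B k) x \<partial>lebesgue) \<le> (\<integral>\<^sup>+x. ennreal (2 powr pp) * (ennreal (avg f Q powr r x) * indicator Q x) \<partial>lebesgue)"
      proof (rule nn_integral_mono)
        fix x
        have "M x powr r x \<le> 2 powr pp * avg f Q powr r x" if "x \<in> B k"
        proof -
          have "M x \<le> 2 * avg f Q" using that j(4) by (simp add: Bc)
          then have "M x powr r x \<le> (2 * avg f Q) powr r x" using M0 r_pos(1)[of x] by (intro powr_mono2) auto
          also have "\<dots> = 2 powr r x * avg f Q powr r x" by (simp add: powr_mult avg_nonneg)
          also have "\<dots> \<le> 2 powr pp * avg f Q powr r x" using r_le by (intro mult_right_mono powr_mono) auto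
          finally show ?thesis .
        qed
        then have "ennreal (M x powr r x) \<le> ennreal (2 powr pp) * ennreal (avg f Q powr r x)" if "x \<in> B k"
          using that by (simp add: ennreal_leI flip: ennreal_mult)
        then show "ennreal (M x powr r x) * indicator (B k) x * indicator Q x \<le> ennreal (2 powr pp) * (ennreal (avg f Q powr r x) * indicator Q x)"
          by (cases "x \<in> B k"; cases "x \<in> Q") simp_all
      qed
      also have "\<dots> = ennreal (2 powr pp) * (\<integral>\<^sup>+x\<in>Q. ennreal (avg f Q powr r x) \<partial>lebesgue)"
        by (rule nn_integral_cmult) measurable
      also have "\<dots> \<le> ennreal (2 powr pp) * ennreal (J * h * vol Q)"
        unfolding h_def g_def j(1) by (intro mult_left_mono jen) simp
      also have "\<dots> = ennreal (2 powr pp * J * h * vol Q)"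
        using J h0 by (simp add: mult.assoc flip: ennreal_mult)
      also have "\<dots> \<le> ennreal (2 powr pp * J * h * (2 * vol (E \<inter> Q)))"
        using half J h0 by (intro ennreal_leI mult_left_mono mult_nonneg_nonneg) auto
      also have "\<dots> = ennreal (D * h) * emeasure lebesgue (E \<inter> Q)"
      proof -
        have "E \<inter> Q \<in> lmeasurable" by (rule fmeasurable_Int_fmeasurable2[OF Em Qm(2)])
        then have "emeasure lebesgue (E \<inter> Q) = ennreal (vol (E \<inter> Q))" by (rule emeasure_eq_measure2)
        moreover have "2 powr pp * J * h * (2 * vol (E \<inter> Q)) = (D * h) * vol (E \<inter> Q)"
          by (simp add: D_def)
        ultimately show ?thesis using D0 h0 by (simp only: ennreal_mult mult_nonneg_nonneg measure_nonneg)
      qed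
      also have "\<dots> = (\<integral>\<^sup>+x. ennreal (D * h) * indicator (E \<inter> Q) x \<partial>lebesgue)"
        by (rule nn_integral_cmult_indicator[symmetric]) simp
      also have "\<dots> \<le> (\<integral>\<^sup>+x\<in>Q. ennreal D * (ennreal (H x) * indicator E x) \<partial>lebesgue)"
      proof (rule nn_integral_mono)
        fix x
        have "ennreal (D * h) \<le> ennreal D * ennreal (H x)" if "x \<in> Q"
          using hH[OF that] D0 H0[of x] by (simp add: ennreal_leI mult_left_mono flip: ennreal_mult)
        then show "ennreal (D * h) * indicator (E \<inter> Q) x \<le> ennreal D * (ennreal (H x) * indicator E x) * indicator Q x"
          by (cases "x \<in> E"; cases "x \<in> Q") simp_all
      qed
      finally show "(\<integral>\<^sup>+x\<in>Q. ennreal (M x powr r x) * indicator (B k) x \<partial>lebesgue) \<le> (\<integral>\<^sup>+x\<in>Q. ennreal D * (ennreal (H x) * indicator E x) \<partial>lebesgue)" .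
    qed (use cube_familyD(5)[OF F] in \<open>auto\<close>)
    \<comment> \<open>\<open>E\<close> is covered by the layers \<open>B k\<close> and
      \<open>B (k + 1)\<close>, so after summation over \<open>k\<close> every point is counted at
      most twice.\<close>
    also have "\<dots> \<le> (\<integral>\<^sup>+x. ennreal D * (ennreal (H x) * indicator (B k) x + ennreal (H x) * indicator (B (k + 1)) x) \<partial>lebesgue)"
      by (rule nn_integral_mono) (auto simp: indicator_def Bc E_def intro!: mult_left_mono)
    also have "(\<integral>\<^sup>+x\<in>\<Union>F. ennreal (M x powr r x) * indicator (B k) x \<partial>lebesgue) = (\<integral>\<^sup>+x\<in>B k. ennreal (M x powr r x) \<partial>lebesgue)"
      using BF by (intro nn_integral_cong) (auto simp: indicator_def)
    finally show ?thesis .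
  qed
  have sumB: "(\<integral>\<^sup>+k. (\<integral>\<^sup>+x. ennreal (H x) * indicator (B k) x \<partial>lebesgue) \<partial>count_space UNIV) \<le> (\<integral>\<^sup>+x. ennreal (H x) \<partial>lebesgue)"
  proof -
    have "(\<integral>\<^sup>+x. ennreal (H x) * indicator {x. 0 < M x} x \<partial>lebesgue) =
      (\<integral>\<^sup>+k. (\<integral>\<^sup>+x\<in>B k. ennreal (H x) * indicator {x. 0 < M x} x \<partial>lebesgue) \<partial>count_space UNIV)"
      unfolding B_def
    proof (rule nn_integral_layers[OF _ M])
      show "(\<lambda>x. ennreal (H x) * indicator {x. 0 < M x} x) \<in> borel_measurable lebesgue" by measurable
    qed (auto simp: indicator_def)
    also have "\<dots> = (\<integral>\<^sup>+k. (\<integral>\<^sup>+x. ennreal (H x) * indicator (B k) x \<partial>lebesgue) \<partial>count_space UNIV)"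
    proof (intro nn_integral_cong)
      fix k :: int and x
      have "0 < M x" if "x \<in> B k"
      proof -
        have "0 < 2 powr real_of_int k" by simp
        then show ?thesis using that unfolding B_def by (metis (mono_tags, lifting) less_trans mem_Collect_eq)
      qed
      then show "ennreal (H x) * indicator {x. 0 < M x} x * indicator (B k) x = ennreal (H x) * indicator (B k) x"
        by (auto simp: indicator_def)
    qed
    finally have "(\<integral>\<^sup>+k. (\<integral>\<^sup>+x. ennreal (H x) * indicator (B k) x \<partial>lebesgue) \<partial>count_space UNIV) = (\<integral>\<^sup>+x. ennreal (H x) * indicator {x. 0 < M x} x \<partial>lebesgue)" by simp
    also have "\<dots> \<le> (\<integral>\<^sup>+x. ennreal (H x) \<partial>lebesgue)" by (rule nn_integral_mono) (auto simp: indicator_def)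
    finally show ?thesis .
  qed
  have "modular r UNIV M = (\<integral>\<^sup>+x. ennreal (M x powr r x) \<partial>lebesgue)" by (simp add: modular_def)
  also have "\<dots> = (\<integral>\<^sup>+k. (\<integral>\<^sup>+x\<in>B k. ennreal (M x powr r x) \<partial>lebesgue) \<partial>count_space UNIV)"
    unfolding B_def
  proof (rule nn_integral_layers)
    fix x assume "M x \<le> 0"
    then have "M x = 0" using M0[of x] by simp
    then show "ennreal (M x powr r x) = 0" by simp
  qed measurable
  also have "\<dots> \<le> (\<integral>\<^sup>+k. (\<integral>\<^sup>+x. ennreal D * (ennreal (H x) * indicator (B k) x + ennreal (H x) * indicator (B (k + 1)) x) \<partial>lebesgue) \<partial>count_space UNIV)"
    by (rule nn_integral_mono) (rule level)
  also have "\<dots> = (\<integral>\<^sup>+k. ennreal D * ((\<integral>\<^sup>+x. ennreal (H x) * indicator (B k) x \<partial>lebesgue) + (\<integral>\<^sup>+x. ennreal (H x) * indicator (B (k + 1)) x \<partial>lebesgue)) \<partial>count_space UNIV)"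
  proof (rule nn_integral_cong)
    fix k :: int
    have "(\<integral>\<^sup>+x. ennreal D * (ennreal (H x) * indicator (B k) x + ennreal (H x) * indicator (B (k + 1)) x) \<partial>lebesgue) =
       ennreal D * (\<integral>\<^sup>+x. ennreal (H x) * indicator (B k) x + ennreal (H x) * indicator (B (k + 1)) x \<partial>lebesgue)"
      by (rule nn_integral_cmult) measurable
    also have "(\<integral>\<^sup>+x. ennreal (H x) * indicator (B k) x + ennreal (H x) * indicator (B (k + 1)) x \<partial>lebesgue) =
      (\<integral>\<^sup>+x. ennreal (H x) * indicator (B k) x \<partial>lebesgue) + (\<integral>\<^sup>+x. ennreal (H x) * indicator (B (k + 1)) x \<partial>lebesgue)"
      by (rule nn_integral_add) measurable
    finally show "(\<integral>\<^sup>+x. ennreal D * (ennreal (H x) * indicator (B k) x + ennreal (H x) * indicator (B (k + 1)) x) \<partial>lebesgue) =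
      ennreal D * ((\<integral>\<^sup>+x. ennreal (H x) * indicator (B k) x \<partial>lebesgue) + (\<integral>\<^sup>+x. ennreal (H x) * indicator (B (k + 1)) x \<partial>lebesgue))" .
  qed
  also have "\<dots> = ennreal D * ((\<integral>\<^sup>+k. (\<integral>\<^sup>+x. ennreal (H x) * indicator (B k) x \<partial>lebesgue) \<partial>count_space UNIV) +
      (\<integral>\<^sup>+k. (\<integral>\<^sup>+x. ennreal (H x) * indicator (B (k + 1)) x \<partial>lebesgue) \<partial>count_space UNIV))"
    by (simp add: nn_integral_cmult nn_integral_add)
  also have "(\<integral>\<^sup>+k. (\<integral>\<^sup>+x. ennreal (H x) * indicator (B (k + 1)) x \<partial>lebesgue) \<partial>count_space UNIV) =
      (\<integral>\<^sup>+k. (\<integral>\<^sup>+x. ennreal (H x) * indicator (B k) x \<partial>lebesgue) \<partial>count_space UNIV)"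
    by (rule nn_integral_bij_count_space[of "\<lambda>k. k + 1" UNIV UNIV "\<lambda>k. \<integral>\<^sup>+x. ennreal (H x) * indicator (B k) x \<partial>lebesgue"])
      (rule bij_betw_byWitness[where f' = "\<lambda>k. k - 1"], auto)
  also have "ennreal D * ((\<integral>\<^sup>+k. (\<integral>\<^sup>+x. ennreal (H x) * indicator (B k) x \<partial>lebesgue) \<partial>count_space UNIV) +
      (\<integral>\<^sup>+k. (\<integral>\<^sup>+x. ennreal (H x) * indicator (B k) x \<partial>lebesgue) \<partial>count_space UNIV)) \<le>
      ennreal D * (ennreal (max_const s1 * (1 + T)) + ennreal (max_const s1 * (1 + T)))"
    using order.trans[OF sumB intH] by (intro mult_left_mono add_mono) auto
  also have "\<dots> = ennreal (4 * 2 powr pp * J * max_const s1 * (1 + T))"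
  proof -
    define X where "X = max_const s1 * (1 + T)"
    have X: "0 \<le> X" unfolding X_def using max_const_pos[OF s1(1)] T0 by simp
    have "ennreal D * (ennreal X + ennreal X) = ennreal (D * (X + X))"
      using X D0 by (simp only: ennreal_plus ennreal_mult add_nonneg_nonneg)
    also have "D * (X + X) = 4 * 2 powr pp * J * X" by (simp add: D_def)
    finally show ?thesis by (simp only: X_def mult.assoc)
  qed
  finally show ?thesis unfolding M_def .
qed

section \<open>The dyadic maximal functions are bounded\<close>

text \<open>Brings the inequalities for an exponent and its conjugate to common \<open>s\<close>,
  \<open>K\<close> and \<open>b\<close>. Lowering \<open>s\<close> costs the summand 1 in
  \<open>K'\<close>.\<close>

lemma rev_holder_mono:
  assumes rh: "rev_holder \<rho> s K Q m b" and Q: "is_cube Q" and \<rho>: "\<rho> \<in> borel_measurable lebesgue"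
    and s': "0 \<le> s'" "s' \<le> s" and K: "0 \<le> K" "1 + K \<le> K'" and b: "b \<le> b'"
  shows "rev_holder \<rho> s' K' Q m b'"
  unfolding rev_holder_def
proof (intro allI impI)
  fix t :: real
  assume t: "0 < t" "t \<le> 1 \<and> b' < t powr m \<or> 1 \<le> t \<and> vol Q * t powr m \<le> 1"
  have "(\<integral>\<^sup>+x\<in>Q. ennreal (t powr (s' * (\<rho> x - m))) \<partial>lebesgue) \<le> ennreal (1 * (1 + K) * vol Q)"
    using t b s' by (intro rev_holder_bound[OF rh Q \<rho> t(1) _ _ K(1)]) (auto simp: powr_le_one_plus)
  also have "\<dots> \<le> ennreal (K' * vol Q)"
    using K by (intro ennreal_leI mult_right_mono) auto
  finally show "(\<integral>\<^sup>+x\<in>Q. ennreal (t powr (s' * (\<rho> x - m))) \<partial>lebesgue) \<le> ennreal (K' * vol Q)" .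
qed

lemma thresholds_max:
  assumes "thresholds \<D> T \<beta>" "thresholds \<D> T' \<beta>'"
  shows "thresholds \<D> (T + T') (\<lambda>Q. max (\<beta> Q) (\<beta>' Q))"
proof -
  have \<beta>: "0 \<le> \<beta> Q \<and> \<beta> Q \<le> 1" "0 \<le> \<beta>' Q \<and> \<beta>' Q \<le> 1" for Q
    using assms unfolding thresholds_def by blast+
  show ?thesis
    unfolding thresholds_def
  proof (intro conjI allI impI)
    fix F assume F: "finite F" "cube_family F" "F \<subseteq> \<D>"
    have "(\<Sum>Q\<in>F. vol Q * max (\<beta> Q) (\<beta>' Q)) \<le> (\<Sum>Q\<in>F. vol Q * \<beta> Q + vol Q * \<beta>' Q)"
    proof (rule sum_mono)
      fix Q assume "Q \<in> F"
      have "vol Q * max (\<beta> Q) (\<beta>' Q) \<le> vol Q * (\<beta> Q + \<beta>' Q)"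
        using \<beta>[of Q] by (intro mult_left_mono) auto
      then show "vol Q * max (\<beta> Q) (\<beta>' Q) \<le> vol Q * \<beta> Q + vol Q * \<beta>' Q"
        by (simp add: algebra_simps)
    qed
    also have "\<dots> \<le> T + T'"
      using assms F unfolding thresholds_def by (simp add: sum.distrib add_mono)
    finally show "(\<Sum>Q\<in>F. vol Q * max (\<beta> Q) (\<beta>' Q)) \<le> T + T'" .
  qed (use \<beta> in \<open>auto simp: max_def\<close>)
qed

context exponent
begin

lemma conj_antimono: "1 < u \<Longrightarrow> u \<le> v \<Longrightarrow> v / (v - 1) \<le> u / (u - (1 :: real))"
  by (simp add: field_simps)

lemma exponent_conj: "exponent (\<lambda>x. r x / (r x - 1)) (pp / (pp - 1)) (pm / (pm - 1))"
proof
  show "1 < pp / (pp - 1)" using pp by simp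
  show "pp / (pp - 1) \<le> r x / (r x - 1)" for x using conj_antimono[of "r x" pp] r_pos(2) r_le by blast
  show "r x / (r x - 1) \<le> pm / (pm - 1)" for x using conj_antimono[of pm "r x"] pm r_ge by blast
qed measurable

text \<open>\<open>u / (u - 1)\<close> is decreasing for \<open>u > 1\<close>, so the two
  half-measure conditions change places.\<close>

lemma is_median_conj:
  assumes Q: "is_cube Q" and m: "is_median r Q m"
  shows "is_median (\<lambda>x. r x / (r x - 1)) Q (m / (m - 1))"
proof -
  have m1: "1 < m" using median_bounds(1)[OF Q m] pm by simp
  have "r x / (r x - 1) \<le> m / (m - 1) \<longleftrightarrow> m \<le> r x" "m / (m - 1) \<le> r x / (r x - 1) \<longleftrightarrow> r x \<le> m" for x
    using m1 r_pos(2)[of x] by (auto simp: field_simps)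
  then show ?thesis using m unfolding is_median_def by simp
qed

text \<open>At \<open>s1 = 1\<close> the left-hand side equals 1, so by continuity it stays below
  \<open>S\<close> slightly to the right of 1.\<close>

lemma ex_bump:
  assumes "1 < S"
  obtains s1 where "1 < s1" "s1 < pm" "s1 * ((pm - 1) / (pm - s1)) ^ 2 \<le> S"
proof -
  define \<phi> where "\<phi> u = u * ((pm - 1) / (pm - u)) ^ 2" for u
  have "isCont \<phi> 1" unfolding \<phi>_def using pm by (intro continuous_intros) auto
  then have "(\<phi> \<longlongrightarrow> \<phi> 1) (at_right 1)"
    by (simp add: continuous_at filterlim_at_split isCont_def)
  moreover have "\<phi> 1 < S" using assms pm by (simp add: \<phi>_def)
  ultimately have "\<forall>\<^sub>F u in at_right 1. \<phi> u < S" by (rule order_tendstoD)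
  moreover have "\<forall>\<^sub>F u in at_right 1. u \<in> {1<..<pm}" using pm by (rule eventually_at_right_real)
  ultimately have "\<forall>\<^sub>F u in at_right (1 :: real). \<phi> u < S \<and> u \<in> {1<..<pm}" by (rule eventually_conj)
  then obtain u where "\<phi> u < S \<and> u \<in> {1<..<pm}"
    using eventually_happens trivial_limit_at_right_real by blast
  then show ?thesis using that[of u] by (auto simp: \<phi>_def)
qed

lemma dmax_bounded:
  assumes A: "A_mod r l C" "0 < l" "l < 1" "1 \<le> C"
    and A': "A_mod (\<lambda>x. r x / (r x - 1)) l' C'" "0 < l'" "l' < 1" "1 \<le> C'"
  shows "\<exists>D\<ge>0. \<forall>a L N f. 0 < L \<longrightarrow> f \<in> borel_measurable lebesgue \<longrightarrow> (\<forall>x. 0 \<le> f x) \<longrightarrow> modular r UNIV f \<le> 1 \<longrightarrow>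
    modular r UNIV (dmax a L N (avg f)) \<le> ennreal D"
proof -
  interpret c: exponent "\<lambda>x. r x / (r x - 1)" "pp / (pp - 1)" "pm / (pm - 1)" by (rule exponent_conj)
  obtain C2 where C2: "1 \<le> C2" "A_mod r (1 / 2) C2" using A_mod_improve[OF A, of "1 / 2"] by auto
  obtain C2' where C2': "1 \<le> C2'" "A_mod (\<lambda>x. r x / (r x - 1)) (1 / 2) C2'" using c.A_mod_improve[OF A', of "1 / 2"] by auto
  obtain s K where sK: "1 < s" "1 \<le> K" and rh: "\<forall>\<mu> a L. 0 < L \<longrightarrow> (\<forall>Q. is_cube Q \<longrightarrow> is_median r Q (\<mu> Q)) \<longrightarrow>
      (\<exists>\<beta>. thresholds {dcube a L k x | k x. True} 2 \<beta> \<and>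
        (\<forall>k x. rev_holder r s K (dcube a L k x) (\<mu> (dcube a L k x)) (\<beta> (dcube a L k x))))"
    by (rule reverse_holder[OF C2(2,1)]) (rule that)
  obtain s' K' where sK': "1 < s'" "1 \<le> K'" and rh': "\<forall>\<mu> a L. 0 < L \<longrightarrow> (\<forall>Q. is_cube Q \<longrightarrow> is_median (\<lambda>x. r x / (r x - 1)) Q (\<mu> Q)) \<longrightarrow>
      (\<exists>\<beta>. thresholds {dcube a L k x | k x. True} 2 \<beta> \<and>
        (\<forall>k x. rev_holder (\<lambda>x. r x / (r x - 1)) s' K' (dcube a L k x) (\<mu> (dcube a L k x)) (\<beta> (dcube a L k x))))"
    by (rule c.reverse_holder[OF C2'(2,1)]) (rule that)
  \<comment> \<open>One choice of medians serves both exponents, through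
    \<open>\<mu> Q / (\<mu> Q - 1)\<close>; Young's inequality needs the two medians to be
    conjugate.\<close>
  define \<mu> where "\<mu> Q = (SOME m. is_median r Q m)" for Q
  have \<mu>: "is_median r Q (\<mu> Q)" if "is_cube Q" for Q unfolding \<mu>_def using ex_median[OF that] by (rule someI_ex)
  define S where "S = min s s'"
  define K0 where "K0 = 1 + max K K'"
  obtain s1 where s1: "1 < s1" "s1 < pm" "s1 * ((pm - 1) / (pm - s1)) ^ 2 \<le> S"
    using ex_bump[of S] sK sK' by (auto simp: S_def)
  \<comment> \<open>The constant depends only on \<open>pp\<close>, \<open>K0\<close> and
    \<open>s1\<close>, so it can be named before any grid or cube is given; \<open>max 0\<close>
    supplies its sign.\<close>
  define J where "J = max 0 (good_cube.jensen_const pp K0 s1)"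
  define D where "D = 4 * 2 powr pp * J * max_const s1 * (1 + 4)"
  have D: "0 \<le> D" using max_const_pos[OF s1(1)] by (simp add: D_def J_def)
  have "modular r UNIV (dmax a L N (avg f)) \<le> ennreal D"
    if L: "0 < L" and f[measurable]: "f \<in> borel_measurable lebesgue" and f0: "\<And>x. 0 \<le> f x" and f1: "modular r UNIV f \<le> 1"
    for a :: "real ^ 'n" and L N f
  proof -
    obtain \<beta> where \<beta>: "thresholds {dcube a L k x | k x. True} 2 \<beta>"
      "\<And>k x. rev_holder r s K (dcube a L k x) (\<mu> (dcube a L k x)) (\<beta> (dcube a L k x))"
      using rh[rule_format, of L \<mu> a, OF L \<mu>] by blast
    obtain \<beta>' where \<beta>': "thresholds {dcube a L k x | k x. True} 2 \<beta>'"
      "\<And>k x. rev_holder (\<lambda>x. r x / (r x - 1)) s' K' (dcube a L k x) (\<mu> (dcube a L k x) / (\<mu> (dcube a L k x) - 1)) (\<beta>' (dcube a L k x))"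
      using rh'[rule_format, of L "\<lambda>Q. \<mu> Q / (\<mu> Q - 1)" a, OF L is_median_conj[OF _ \<mu>]] by blast
    define B where "B Q = max (\<beta> Q) (\<beta>' Q)" for Q
    have th: "thresholds {dcube a L k x | k x. True} (2 + 2) B"
      using thresholds_max[OF \<beta>(1) \<beta>'(1)] by (simp add: B_def[abs_def])
    then have B01: "0 \<le> B Q" "B Q \<le> 1" for Q unfolding thresholds_def by auto
    have gc: "good_cube r pm pp S K0 s1 (\<mu> Q) (B Q) Q" if Q: "Q = dcube a L k x" for Q k x
    proof
      show Qc: "is_cube Q" unfolding Q by (rule is_cube_dcube[OF L])
      show "pm \<le> \<mu> Q" "\<mu> Q \<le> pp" using median_bounds[OF Qc \<mu>[OF Qc]] by auto
      show "rev_holder r S K0 Q (\<mu> Q) (B Q)"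
        by (rule rev_holder_mono[OF \<beta>(2)[of k x, folded Q] Qc r_meas]) (use sK sK' in \<open>auto simp: S_def K0_def B_def\<close>)
      show "rev_holder (\<lambda>x. r x / (r x - 1)) S K0 Q (\<mu> Q / (\<mu> Q - 1)) (B Q)"
        by (rule rev_holder_mono[OF \<beta>'(2)[of k x, folded Q] Qc c.r_meas]) (use sK sK' in \<open>auto simp: S_def K0_def B_def\<close>)
    qed (use s1 sK B01 in \<open>auto simp: K0_def\<close>)
    have "modular r UNIV (dmax a L N (avg f)) \<le> ennreal (4 * 2 powr pp * J * max_const s1 * (1 + (2 + 2)))"
    proof (rule dmax_modular[OF L f f0 f1 s1(1,2) _ th])
      show "0 \<le> J" by (simp add: J_def)
      fix k x
      define Q where "Q = dcube a L k x"
      have Qc: "is_cube Q" unfolding Q_def by (rule is_cube_dcube[OF L])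
      define G where "G = avg (\<lambda>z. f z powr (r z / s1)) Q"
      have fin1: "(\<integral>\<^sup>+x\<in>Q. ennreal (f x) \<partial>lebesgue) < \<infinity>"
        using powr_integrable_cube[OF f f0 Qc f1, of "\<lambda>_. 1"] f0 r_pos(2) by (simp add: less_imp_le)
      have fin2: "(\<integral>\<^sup>+x\<in>Q. ennreal (f x powr (r x / s1)) \<partial>lebesgue) < \<infinity>"
      proof (rule powr_integrable_cube[OF f f0 Qc f1])
        show "0 \<le> r x / s1" for x using r_pos(1)[of x] s1 by simp
        show "r x / s1 \<le> r x" for x using r_pos(1)[of x] s1 by (simp add: divide_le_eq)
      qed
      have "(\<integral>\<^sup>+x\<in>Q. ennreal (f x powr r x) \<partial>lebesgue) \<le> 1"
        using f1 modular_mono_set[of Q UNIV r f] unfolding modular_def by simp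
      then have "(\<integral>\<^sup>+z\<in>Q. ennreal (avg f Q powr r z) \<partial>lebesgue) \<le>
          ennreal (good_cube.jensen_const pp K0 s1 * (G powr s1 + B Q powr s1) * vol Q)"
        by (rule good_cube.average_modular[OF gc[OF Q_def] f f0 _ avg_nonneg avg_eq[OF Qc fin1] avg_nonneg
              avg_eq[OF Qc fin2], folded G_def])
      also have "\<dots> \<le> ennreal (J * (G powr s1 + B Q powr s1) * vol Q)"
        unfolding J_def by (intro ennreal_leI mult_right_mono) auto
      finally show "(\<integral>\<^sup>+z\<in>dcube a L k x. ennreal (avg f (dcube a L k x) powr r z) \<partial>lebesgue) \<le>
        ennreal (J * (avg (\<lambda>z. f z powr (r z / s1)) (dcube a L k x) powr s1 + B (dcube a L k x) powr s1) * vol (dcube a L k x))"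
        unfolding Q_def G_def .
    qed
    then show ?thesis by (simp add: D_def)
  qed
  then show ?thesis using D by blast
qed

end

section \<open>Shifted grids\<close>

text \<open>Every cube lies in a comparable dyadic cube of one of the grids shifted by \<open>0\<close> or \<open>2\<^sup>N / 3\<close> in each coordinate:
  the two one-dimensional grids of step \<open>2\<^sup>N / 2\<^sup>k\<close> keep a distance of a third of the step.\<close>

definition shift :: "'n set \<Rightarrow> nat \<Rightarrow> real ^ 'n" where
  "shift \<alpha> N = (\<chi> i. if i \<in> \<alpha> then 2 ^ N / 3 else 0)"

text \<open>If both grids cut the interval, a grid point of each lies in it, and these are less than
  \<open>h / 3\<close> apart. Their distance is \<open>h / 3\<close> times the absolute value of the
  integer \<open>3 * (z - w) - 2 ^ k\<close>, which would have to vanish although 3 does not divide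
  \<open>2 ^ k\<close>. So a single shift by \<open>L / 3\<close> works at every generation.\<close>

lemma interval_in_shifted_grid:
  fixes c l h :: real
  assumes l: "0 < l" and h: "3 * l \<le> h" and L: "L = 2 ^ k * h"
  shows "\<lfloor>(c - 0) / h\<rfloor> = \<lfloor>(c + l - 0) / h\<rfloor> \<or> \<lfloor>(c - L / 3) / h\<rfloor> = \<lfloor>(c + l - L / 3) / h\<rfloor>"
proof (rule ccontr)
  assume neg: "\<not> ?thesis"
  have h0: "0 < h" using l h by simp
  have ex: "\<exists>z :: int. c < z * h + \<sigma> \<and> z * h + \<sigma> \<le> c + l" if "\<lfloor>(c - \<sigma>) / h\<rfloor> \<noteq> \<lfloor>(c + l - \<sigma>) / h\<rfloor>" for \<sigma>
  proof -
    have "\<lfloor>(c - \<sigma>) / h\<rfloor> \<le> \<lfloor>(c + l - \<sigma>) / h\<rfloor>" using l h0 by (intro floor_mono divide_right_mono) auto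
    then have lt: "\<lfloor>(c - \<sigma>) / h\<rfloor> < \<lfloor>(c + l - \<sigma>) / h\<rfloor>" using that by simp
    define z where "z = \<lfloor>(c + l - \<sigma>) / h\<rfloor>"
    have "(c - \<sigma>) / h < z" using lt unfolding z_def by linarith
    moreover have "z \<le> (c + l - \<sigma>) / h" by (simp add: z_def)
    ultimately show ?thesis using h0 by (intro exI[of _ z]) (simp add: field_simps)
  qed
  obtain z where z: "c < real_of_int z * h + 0" "real_of_int z * h + 0 \<le> c + l" using ex[of 0] neg by blast
  obtain w where w: "c < real_of_int w * h + L / 3" "real_of_int w * h + L / 3 \<le> c + l" using ex[of "L / 3"] neg by blast
  have "\<bar>real_of_int z * h - (real_of_int w * h + L / 3)\<bar> < h / 3" using z w h by linarith
  also have "real_of_int z * h - (real_of_int w * h + L / 3) = h / 3 * real_of_int (3 * (z - w) - 2 ^ k)"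
    by (simp add: L field_simps)
  finally have "h / 3 * \<bar>real_of_int (3 * (z - w) - 2 ^ k)\<bar> < h / 3 * 1" using h0 by (simp add: abs_mult)
  then have "\<bar>real_of_int (3 * (z - w) - 2 ^ k)\<bar> < 1" using h0 by (simp add: mult_less_cancel_left)
  then have "3 * (z - w) = 2 ^ k" by linarith
  then have "(3 :: int) dvd 2 ^ k" by (metis dvd_triv_left)
  then have "(3 :: int) dvd 2"
    using prime_dvd_power[of "3 :: int" 2 k] by simp
  then show False by simp
qed

text \<open>\<open>N\<close> must be large for both ends of the scale: the side \<open>2 ^ N\<close>
  of generation 0 has to exceed \<open>3 * l\<close>, and the side
  \<open>2 ^ N / 2 ^ (2 * N)\<close> of generation \<open>2 * N\<close> has to fall below
  it.\<close>

lemma cube_in_shifted_dyadic: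
  fixes R :: "(real ^ 'n) set"
  assumes R: "is_cube R" and x: "x \<in> R"
  shows "\<forall>\<^sub>F N in sequentially. \<exists>\<alpha>. \<exists>k\<le>2 * N. R \<subseteq> dcube (shift \<alpha> N) (2 ^ N) k x \<and>
    vol (dcube (shift \<alpha> N) (2 ^ N) k x) \<le> 6 ^ CARD('n) * vol R"
proof -
  obtain c l where l: "0 < l" and Rc: "R \<subseteq> cbox c (c + (\<chi> i. l))" and mR: "vol R = l ^ CARD('n)"
    using is_cube_obtain[OF R] by metis
  obtain N0 where N0: "3 * l < 2 ^ N0" using real_arch_pow[of 2 "3 * l"] by auto
  obtain N1 where N1: "1 / (3 * l) < 2 ^ N1" using real_arch_pow[of 2 "1 / (3 * l)"] by auto
  have "\<exists>\<alpha>. \<exists>k\<le>2 * N. R \<subseteq> dcube (shift \<alpha> N) (2 ^ N) k x \<and>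
    vol (dcube (shift \<alpha> N) (2 ^ N) k x) \<le> 6 ^ CARD('n) * vol R" if N: "N \<ge> max N0 N1" for N
  proof -
    have "2 ^ N0 \<le> (2 :: real) ^ N" "2 ^ N1 \<le> (2 :: real) ^ N" using N by (auto intro!: power_increasing)
    then have a: "3 * l < 2 ^ N" and "1 / (3 * l) < 2 ^ N" using N0 N1 by linarith+
    from this(2) have "1 / 2 ^ N < 3 * l" using l by (simp add: field_simps)
    moreover have "(2 :: real) ^ (2 * N) = 2 ^ N * 2 ^ N" unfolding mult_2 by (rule power_add)
    ultimately have b: "2 ^ N / 2 ^ (2 * N) < 3 * l" by simp
    \<comment> \<open>\<open>k'\<close> will be the first generation with step below
      \<open>3 * l\<close>; the preceding step \<open>h\<close> lies between \<open>3 * l\<close>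
      and \<open>6 * l\<close>, whence the factor \<open>6 ^ CARD('n)\<close>.\<close>
    define P where "P k \<longleftrightarrow> 2 ^ N / 2 ^ k < 3 * l" for k :: nat
    obtain k' where k': "P k'" "\<And>i. i < k' \<Longrightarrow> \<not> P i" using exists_least_iff[of P] b unfolding P_def by blast
    have "k' \<noteq> 0" using k'(1) a unfolding P_def by (cases k') auto
    then obtain k where k: "k' = Suc k" by (cases k') auto
    have k2: "k \<le> 2 * N" using k'(2)[of "2 * N"] b k unfolding P_def by (meson Suc_leD not_less)
    define h :: real where "h = 2 ^ N / 2 ^ k"
    have h: "3 * l \<le> h" "h < 6 * l" using k'(2)[of k] k'(1) k unfolding P_def h_def by (auto simp: field_simps)
    have h0: "0 < h" using h l by simp
    have Lh: "2 ^ N = 2 ^ k * h" by (simp add: h_def)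
    \<comment> \<open>The shift is decided in each coordinate separately: it is used exactly where
      the unshifted grid cuts the projection of the cube.\<close>
    define \<alpha> where "\<alpha> = {i. \<lfloor>(c $ i - 0) / h\<rfloor> \<noteq> \<lfloor>(c $ i + l - 0) / h\<rfloor>}"
    have fl: "\<lfloor>(c $ i - shift \<alpha> N $ i) / h\<rfloor> = \<lfloor>(c $ i + l - shift \<alpha> N $ i) / h\<rfloor>" for i
      using interval_in_shifted_grid[OF l h(1) Lh, of "c $ i"] by (auto simp: shift_def \<alpha>_def)
    have eq: "\<lfloor>(y $ i - shift \<alpha> N $ i) / h\<rfloor> = \<lfloor>(c $ i - shift \<alpha> N $ i) / h\<rfloor>" if "y \<in> R" for y i
    proof -
      have "c $ i \<le> y $ i" "y $ i \<le> c $ i + l" using Rc that by (auto simp: mem_box_cart)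
      then have "\<lfloor>(c $ i - shift \<alpha> N $ i) / h\<rfloor> \<le> \<lfloor>(y $ i - shift \<alpha> N $ i) / h\<rfloor>"
        "\<lfloor>(y $ i - shift \<alpha> N $ i) / h\<rfloor> \<le> \<lfloor>(c $ i + l - shift \<alpha> N $ i) / h\<rfloor>"
        using h0 by (auto intro!: floor_mono divide_right_mono)
      then show ?thesis using fl[of i] by simp
    qed
    have hh: "u * 2 ^ k / 2 ^ N = u / h" for u :: real by (simp add: h_def)
    have "R \<subseteq> dcube (shift \<alpha> N) (2 ^ N) k x"
      unfolding dcube_def hh using eq eq[OF x] by auto
    moreover have "vol (dcube (shift \<alpha> N) (2 ^ N) k x) \<le> 6 ^ CARD('n) * vol R"
    proof -
      have "vol (dcube (shift \<alpha> N) (2 ^ N) k x) = h ^ CARD('n)" unfolding h_def by (rule measure_dcube) simp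
      also have "\<dots> \<le> (6 * l) ^ CARD('n)" using h h0 by (intro power_mono) auto
      finally show ?thesis by (simp add: mR power_mult_distrib)
    qed
    ultimately show ?thesis using k2 by blast
  qed
  then show ?thesis unfolding eventually_sequentially by blast
qed

text \<open>A sum over the finitely many shifts, comparable to their maximum. Both the largest side
  and the number of generations grow with \<open>N\<close>, so that every cube is eventually
  captured.\<close>

definition grid_max :: "nat \<Rightarrow> (real ^ 'n \<Rightarrow> real) \<Rightarrow> real ^ 'n \<Rightarrow> real" where
  "grid_max N f x = (\<Sum>\<alpha>\<in>UNIV. dmax (shift \<alpha> N) (2 ^ N) (2 * N) (avg f) x)"

lemma measurable_grid_max [measurable]: "grid_max N f \<in> borel_measurable lebesgue"
proof -
  have "(\<lambda>x. \<Sum>\<alpha>\<in>UNIV. dmax (shift \<alpha> N) (2 ^ N) (2 * N) (avg f) x) \<in> borel_measurable lebesgue"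
    by (intro borel_measurable_sum measurable_dmax)
  then show ?thesis unfolding grid_max_def[abs_def] .
qed

lemma grid_max_nonneg: "0 \<le> grid_max N f x"
  unfolding grid_max_def by (intro sum_nonneg dmax_nonneg avg_nonneg)

lemma avg_le_grid_max:
  fixes R :: "(real ^ 'n) set"
  assumes R: "is_cube R" "x \<in> R" and f0: "\<And>x. 0 \<le> f x"
    and fin: "\<And>Q. is_cube Q \<Longrightarrow> (\<integral>\<^sup>+z\<in>Q. ennreal (f z) \<partial>lebesgue) < \<infinity>"
  shows "\<forall>\<^sub>F N in sequentially. avg f R \<le> 6 ^ CARD('n) * grid_max N f x"
  using cube_in_shifted_dyadic[OF R]
proof eventually_elim
  case (elim N)
  then obtain \<alpha> k where k: "k \<le> 2 * N" "R \<subseteq> dcube (shift \<alpha> N) (2 ^ N) k x"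
    "vol (dcube (shift \<alpha> N) (2 ^ N) k x) \<le> 6 ^ CARD('n) * vol R" by blast
  define Q where "Q = dcube (shift \<alpha> N) (2 ^ N) k x"
  have Q: "is_cube Q" unfolding Q_def by (rule is_cube_dcube) simp
  have "ennreal (avg f R * vol R) = (\<integral>\<^sup>+z\<in>R. ennreal (f z) \<partial>lebesgue)"
    by (rule avg_eq[symmetric, OF R(1) fin[OF R(1)]])
  also have "\<dots> \<le> (\<integral>\<^sup>+z\<in>Q. ennreal (f z) \<partial>lebesgue)"
    by (rule nn_integral_set_mono) (use k in \<open>auto simp: Q_def\<close>)
  also have "\<dots> = ennreal (avg f Q * vol Q)" by (rule avg_eq[OF Q fin[OF Q]])
  finally have "avg f R * vol R \<le> avg f Q * vol Q"
    by (subst (asm) ennreal_le_iff) (auto simp: avg_nonneg)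
  also have "\<dots> \<le> avg f Q * (6 ^ CARD('n) * vol R)"
    using k(3) by (intro mult_left_mono avg_nonneg) (simp add: Q_def)
  finally have "avg f R * vol R \<le> (6 ^ CARD('n) * avg f Q) * vol R" by (simp add: mult_ac)
  then have "avg f R \<le> 6 ^ CARD('n) * avg f Q" using is_cubeD(3)[OF R(1)] by (simp add: mult_le_cancel_right)
  also have "avg f Q \<le> dmax (shift \<alpha> N) (2 ^ N) (2 * N) (avg f) x"
    unfolding Q_def by (rule dmax_ge[OF k(1)])
  also have "\<dots> \<le> grid_max N f x"
    unfolding grid_max_def by (rule member_le_sum) (auto intro: dmax_nonneg avg_nonneg)
  finally show ?case by simp
qed

lemma (in exponent) grid_max_bounded:
  assumes A: "A_mod r l C" "0 < l" "l < 1" "1 \<le> C"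
    and A': "A_mod (\<lambda>x. r x / (r x - 1)) l' C'" "0 < l'" "l' < 1" "1 \<le> C'"
  shows "\<exists>D\<ge>1. \<forall>N f. f \<in> borel_measurable lebesgue \<longrightarrow> (\<forall>x. 0 \<le> f x) \<longrightarrow> modular r UNIV f \<le> 1 \<longrightarrow>
    modular r UNIV (\<lambda>x. grid_max N f x / D) \<le> 1"
proof -
  obtain D where D: "0 \<le> D" and bound: "\<And>a L N f. 0 < L \<Longrightarrow> f \<in> borel_measurable lebesgue \<Longrightarrow> (\<And>x. 0 \<le> f x) \<Longrightarrow>
      modular r UNIV f \<le> 1 \<Longrightarrow> modular r UNIV (dmax a L N (avg f)) \<le> ennreal D"
    using dmax_bounded[OF assms] by blast
  define n where "n = real (card (UNIV :: 'n set set))"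
  have n: "1 \<le> n" unfolding n_def by (simp add: Suc_leI)
  \<comment> \<open>Dividing by the number \<open>n\<close> of shifts brings the sum below its
    largest term, whose modular is at most \<open>n * D\<close>; dividing by
    \<open>1 + n * D\<close> then brings the modular below 1.\<close>
  define D' where "D' = n * (1 + n * D)"
  have D': "1 \<le> D'" unfolding D'_def using n D mult_mono[of 1 n 1 "1 + n * D"] by simp
  have "modular r UNIV (\<lambda>x. grid_max N f x / D') \<le> 1"
    if f: "f \<in> borel_measurable lebesgue" "\<And>x. 0 \<le> f x" "modular r UNIV f \<le> 1" for N f
  proof -
    define d where "d \<alpha> = dmax (shift \<alpha> N) (2 ^ N) (2 * N) (avg f)" for \<alpha> :: "'n set"
    have dm[measurable]: "d \<alpha> \<in> borel_measurable lebesgue" for \<alpha> by (simp add: d_def)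
    have g: "grid_max N f x = (\<Sum>\<alpha>\<in>UNIV. d \<alpha> x)" for x by (simp add: grid_max_def d_def)
    have "modular r UNIV (\<lambda>x. grid_max N f x / n) \<le> (\<integral>\<^sup>+x. (\<Sum>\<alpha>\<in>UNIV. ennreal (d \<alpha> x powr r x)) \<partial>lebesgue)"
      unfolding modular_def
    proof (rule nn_integral_mono)
      fix x
      define M where "M = Max ((\<lambda>\<alpha>. d \<alpha> x) ` UNIV)"
      have "M \<in> (\<lambda>\<alpha>. d \<alpha> x) ` UNIV" unfolding M_def by (rule Max_in) auto
      then obtain \<alpha>0 where \<alpha>0: "M = d \<alpha>0 x" by auto
      have "d \<alpha> x \<le> M" for \<alpha> unfolding M_def by (rule Max_ge) auto
      then have "(\<Sum>\<alpha>\<in>UNIV. d \<alpha> x) \<le> (\<Sum>\<alpha>\<in>(UNIV :: 'n set set). M)" by (intro sum_mono)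
      then have "grid_max N f x \<le> n * M" by (simp add: g n_def)
      then have "grid_max N f x / n \<le> M" using n by (simp add: field_simps)
      then have "(grid_max N f x / n) powr r x \<le> d \<alpha>0 x powr r x"
        unfolding \<alpha>0 using grid_max_nonneg[of N f x] n r_pos(1)[of x] by (intro powr_mono2) auto
      also have "\<dots> \<le> (\<Sum>\<alpha>\<in>UNIV. d \<alpha> x powr r x)" by (rule member_le_sum) auto
      finally show "ennreal ((grid_max N f x / n) powr r x) * indicator UNIV x \<le> (\<Sum>\<alpha>\<in>UNIV. ennreal (d \<alpha> x powr r x))"
        by (simp add: sum_ennreal ennreal_leI)
    qed
    also have "\<dots> = (\<Sum>\<alpha>\<in>UNIV. \<integral>\<^sup>+x. ennreal (d \<alpha> x powr r x) \<partial>lebesgue)"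
      by (rule nn_integral_sum) measurable
    also have "\<dots> \<le> (\<Sum>\<alpha>\<in>(UNIV :: 'n set set). ennreal D)"
      using bound[of "2 ^ N" f] f by (intro sum_mono) (simp add: d_def modular_def)
    also have "\<dots> = ennreal (\<Sum>\<alpha>\<in>(UNIV :: 'n set set). D)" using D by (intro sum_ennreal)
    also have "\<dots> = ennreal (n * D)" by (simp only: sum_constant n_def)
    finally have le: "modular r UNIV (\<lambda>x. grid_max N f x / n) \<le> ennreal (n * D)" .
    have nD: "0 \<le> n * D" using n D by simp
    have "modular r UNIV (\<lambda>x. (1 / (1 + n * D)) * (grid_max N f x / n)) \<le> ennreal (1 / (1 + n * D)) * modular r UNIV (\<lambda>x. grid_max N f x / n)"
      by (rule modular_shrink) (use nD n in \<open>auto simp: grid_max_nonneg\<close>)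
    also have "\<dots> \<le> ennreal (1 / (1 + n * D)) * ennreal (n * D)" by (intro mult_left_mono le) simp
    also have "\<dots> = ennreal (1 / (1 + n * D) * (n * D))" using nD by (subst ennreal_mult) auto
    also have "\<dots> \<le> ennreal 1" using nD by (intro ennreal_leI) (simp add: field_simps)
    finally show ?thesis by (simp add: D'_def mult.commute)
  qed
  then show ?thesis using D' by blast
qed

section \<open>Averaging operators and duality\<close>

definition avg_bounded :: "(real ^ 'n \<Rightarrow> real) \<Rightarrow> real \<Rightarrow> bool" where
  "avg_bounded r C \<longleftrightarrow> (\<forall>F f v. step_fun F v \<longrightarrow> f \<in> borel_measurable lebesgue \<longrightarrow> (\<forall>x. 0 \<le> f x) \<longrightarrow> modular r UNIV f \<le> 1 \<longrightarrow>
     (\<forall>Q\<in>F. \<forall>x\<in>Q. v x = avg f Q) \<longrightarrow> modular r (\<Union>F) (\<lambda>x. v x / C) \<le> 1)"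

lemma avg_boundedD:
  assumes "avg_bounded r C" "step_fun F v" "f \<in> borel_measurable lebesgue" "\<And>x. 0 \<le> f x" "modular r UNIV f \<le> 1"
    "\<And>Q x. Q \<in> F \<Longrightarrow> x \<in> Q \<Longrightarrow> v x = avg f Q"
  shows "modular r (\<Union>F) (\<lambda>x. v x / C) \<le> 1"
  using assms unfolding avg_bounded_def by blast

lemma ex_step_fun_nonneg:
  assumes F: "cube_family F" and g: "\<And>Q. Q \<in> F \<Longrightarrow> 0 \<le> g Q"
  obtains v where "step_fun F v" "\<And>Q x. Q \<in> F \<Longrightarrow> x \<in> Q \<Longrightarrow> v x = g Q" "\<And>x. x \<notin> \<Union>F \<Longrightarrow> v x = 0"
proof -
  obtain v where v: "v \<in> borel_measurable lebesgue" "\<And>Q x. Q \<in> F \<Longrightarrow> x \<in> Q \<Longrightarrow> v x = g Q" "\<And>x. x \<notin> \<Union>F \<Longrightarrow> v x = 0"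
    using ex_step_fun[OF F, of g thesis] by blast
  have "0 \<le> v x" for x
  proof (cases "x \<in> \<Union>F")
    case True
    then obtain Q where "Q \<in> F" "x \<in> Q" by blast
    then show ?thesis using v(2) g by simp
  qed (simp add: v(3))
  moreover have "v x = v y" if "Q \<in> F" "x \<in> Q" "y \<in> Q" for Q x y using v(2) that by simp
  ultimately have "step_fun F v" unfolding step_fun_def using F v(1) by blast
  then show ?thesis using that v by blast
qed

lemma modular_indicator: "modular r UNIV (\<lambda>x. t x * indicator S x) = modular r S t"
  unfolding modular_def by (intro nn_integral_cong) (auto simp: indicator_def)

lemma avg_step:
  assumes Q: "is_cube Q" and E: "E \<in> sets lebesgue" and c: "0 \<le> c" and f: "\<And>x. x \<in> Q \<Longrightarrow> f x = c * indicator E x"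
  shows "avg f Q * vol Q = c * vol (E \<inter> Q)"
proof -
  note Qm = is_cubeD[OF Q]
  have m: "E \<inter> Q \<in> lmeasurable" by (rule fmeasurable_Int_fmeasurable2[OF E Qm(2)])
  have "(\<integral>\<^sup>+x\<in>Q. ennreal (f x) \<partial>lebesgue) = (\<integral>\<^sup>+x. ennreal c * indicator (E \<inter> Q) x \<partial>lebesgue)"
    using f by (intro nn_integral_cong) (auto simp: indicator_def)
  also have "\<dots> = ennreal c * emeasure lebesgue (E \<inter> Q)"
    by (rule nn_integral_cmult_indicator) (use m in auto)
  also have "\<dots> = ennreal (c * vol (E \<inter> Q))"
    unfolding emeasure_eq_measure2[OF m] using c by (simp add: ennreal_mult)
  finally show ?thesis using Qm(3) c by (simp add: avg_def)
qed

text \<open>Monotone convergence along an enumeration of \<open>F\<close>. It reduces the dual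
  estimate to finite families, whose modular is known to be finite.\<close>

lemma nn_integral_Union_le:
  assumes F: "countable F" "\<And>Q. Q \<in> F \<Longrightarrow> Q \<in> sets M" and u[measurable]: "u \<in> borel_measurable M"
    and le: "\<And>G. finite G \<Longrightarrow> G \<subseteq> F \<Longrightarrow> (\<integral>\<^sup>+x\<in>\<Union>G. u x \<partial>M) \<le> B"
  shows "(\<integral>\<^sup>+x\<in>\<Union>F. u x \<partial>M) \<le> B"
proof (cases "F = {}")
  case False
  define A where "A i = \<Union>(from_nat_into F ` {..i})" for i :: nat
  have sub: "from_nat_into F ` {..i} \<subseteq> F" for i using from_nat_into[OF False] by auto
  have As: "A i \<in> sets M" for i unfolding A_def using sub F(2) by (intro sets.finite_Union) auto
  have UA: "(\<Union>i. A i) = \<Union>F"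
  proof
    show "(\<Union>i. A i) \<subseteq> \<Union>F" unfolding A_def using sub by (meson UN_least Union_mono)
    show "\<Union>F \<subseteq> (\<Union>i. A i)"
    proof
      fix x assume "x \<in> \<Union>F"
      then obtain Q where Q: "Q \<in> F" "x \<in> Q" by blast
      obtain i where "Q = from_nat_into F i" using range_from_nat_into[OF False F(1)] Q(1) by (metis imageE)
      then have "x \<in> A i" unfolding A_def using Q(2) by blast
      then show "x \<in> (\<Union>i. A i)" by blast
    qed
  qed
  have "incseq A" unfolding A_def by (intro incseq_SucI Union_mono image_mono) auto
  then have "(SUP i. emeasure (density M u) (A i)) = emeasure (density M u) (\<Union>i. A i)"
    using As by (intro SUP_emeasure_incseq) auto
  moreover have "emeasure (density M u) (A i) \<le> B" for i
    using le[of "from_nat_into F ` {..i}"] sub As[of i] by (simp add: emeasure_density A_def)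
  ultimately have "emeasure (density M u) (\<Union>F) \<le> B" unfolding UA by (metis SUP_least)
  moreover have "\<Union>F \<in> sets M" using F by (meson sets.countable_Union subsetI)
  ultimately show ?thesis by (simp add: emeasure_density)
qed (use le[of "{}"] in simp)

context exponent
begin

text \<open>Averaging is tested on \<open>t\<close> restricted to \<open>E\<close>: on each cube the
  average is at least \<open>t / 2\<close>.\<close>

lemma avg_bounded_A_mod:
  assumes B: "avg_bounded r C" and C: "1 \<le> C"
  shows "A_mod r (1 / 2) (2 * C)"
  unfolding A_mod_def
proof (intro allI impI)
  fix F t E
  assume t: "step_fun F t" and E[measurable]: "E \<in> sets lebesgue"
    and EQ: "\<forall>Q\<in>F. 1 / 2 * vol Q \<le> vol (E \<inter> Q)"
    and le1: "modular r (E \<inter> \<Union>F) t \<le> 1"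
  note F = step_funD(1)[OF t] and tm[measurable] = step_funD(2)[OF t] and t0 = step_funD(3)[OF t]
  note UF[measurable] = cube_familyD(4)[OF F]
  define f where "f x = t x * indicator (E \<inter> \<Union>F) x" for x
  have f[measurable]: "f \<in> borel_measurable lebesgue" unfolding f_def by measurable
  have f0: "0 \<le> f x" for x using t0 by (simp add: f_def)
  have f1: "modular r UNIV f \<le> 1" using le1 unfolding f_def[abs_def] modular_indicator .
  obtain v where v: "step_fun F v" "\<And>Q x. Q \<in> F \<Longrightarrow> x \<in> Q \<Longrightarrow> v x = avg f Q"
    using ex_step_fun_nonneg[OF F, of "avg f"] avg_nonneg by metis
  have "t x / 2 \<le> v x" if Q: "Q \<in> F" "x \<in> Q" for Q x
  proof -
    note Qc = cube_familyD(1)[OF F Q(1)]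
    have "f z = t x * indicator E z" if "z \<in> Q" for z
      using step_fun_const[OF t Q(1) that Q(2)] that Q(1) by (auto simp: f_def indicator_def)
    then have "avg f Q * vol Q = t x * vol (E \<inter> Q)"
      by (rule avg_step[OF Qc E t0])
    also have "\<dots> \<ge> t x * (1 / 2 * vol Q)" using EQ Q(1) t0 by (intro mult_left_mono) auto
    finally have "t x / 2 * vol Q \<le> avg f Q * vol Q" by simp
    then show ?thesis using is_cubeD(3)[OF Qc] v(2)[OF Q] by (simp add: mult_le_cancel_right)
  qed
  then have "modular r (\<Union>F) (\<lambda>x. t x / (2 * C)) \<le> modular r (\<Union>F) (\<lambda>x. v x / C)"
    using C t0 by (intro modular_mono) (auto simp: field_simps)
  also have "\<dots> \<le> 1" by (rule avg_boundedD[OF B v(1) f f0 f1 v(2)])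
  finally show "modular r (\<Union>F) (\<lambda>x. t x / (2 * C)) \<le> 1" .
qed

text \<open>The averaging operators are self-adjoint, hence also bounded in the dual modular.  The dual extremal function
  of \<open>\<tau>\<close> is \<open>\<tau>\<^bsup>r' - 1\<^esup>\<close>.\<close>

lemma avg_bounded_A_mod_conj:
  assumes B: "avg_bounded r C" and C: "1 \<le> C"
  shows "A_mod (\<lambda>x. r x / (r x - 1)) (1 / 2) (4 * C)"
  unfolding A_mod_def
proof (intro allI impI)
  define \<rho> where "\<rho> x = r x / (r x - 1)" for x
  have \<rho>1: "1 < \<rho> x" "\<rho> x \<le> pm / (pm - 1)" for x
    using r_pos(2)[of x] conj_antimono[OF pm r_ge[of x]] by (auto simp: \<rho>_def)
  have \<rho>[measurable]: "\<rho> \<in> borel_measurable lebesgue" unfolding \<rho>_def by measurable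
  have \<rho>r: "(\<rho> x - 1) * r x = \<rho> x" for x using r_pos(2)[of x] by (simp add: \<rho>_def field_simps)
  fix F0 t E
  assume t0F: "step_fun F0 t" and E[measurable]: "E \<in> sets lebesgue"
    and EQ0: "\<forall>Q\<in>F0. 1 / 2 * vol Q \<le> vol (E \<inter> Q)"
    and le10: "modular (\<lambda>x. r x / (r x - 1)) (E \<inter> \<Union>F0) t \<le> 1"
  note F0 = step_funD(1)[OF t0F] and tm[measurable] = step_funD(2)[OF t0F] and t0 = step_funD(3)[OF t0F]
  define \<tau> where "\<tau> x = t x / (4 * C)" for x
  have \<tau>[measurable]: "\<tau> \<in> borel_measurable lebesgue" unfolding \<tau>_def by measurable
  have \<tau>0: "0 \<le> \<tau> x" for x using t0 C by (simp add: \<tau>_def)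
  have "(\<integral>\<^sup>+x\<in>\<Union>F. ennreal (\<tau> x powr \<rho> x) \<partial>lebesgue) \<le> 1" if fin: "finite F" and FF: "F \<subseteq> F0" for F
  proof (rule ccontr)
    assume neg: "\<not> ?thesis"
    have F: "cube_family F" by (rule cube_family_subset[OF F0 FF])
    have t: "step_fun F t" by (rule step_fun_refine[OF t0F F]) (use FF in auto)
    note UF[measurable] = cube_familyD(4)[OF F]
    have "(\<integral>\<^sup>+x\<in>Q. ennreal (\<tau> x powr \<rho> x) \<partial>lebesgue) < top" if Q: "Q \<in> F" for Q
    proof -
      note Qc = cube_familyD(1)[OF F Q]
      obtain q where q: "q \<in> Q" using is_cube_has_point[OF Qc] by blast
      define c where "c = max 1 (\<tau> q) powr (pm / (pm - 1))"
      have "\<tau> x powr \<rho> x \<le> c" if "x \<in> Q" for x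
      proof -
        have "\<tau> x = \<tau> q" using step_fun_const[OF t Q that q] by (simp add: \<tau>_def)
        then have "\<tau> x powr \<rho> x \<le> max 1 (\<tau> q) powr \<rho> x" using \<tau>0 \<rho>1(1)[of x] by (intro powr_mono2) auto
        also have "\<dots> \<le> c" unfolding c_def by (intro powr_mono \<rho>1(2)) auto
        finally show ?thesis .
      qed
      then have "(\<integral>\<^sup>+x\<in>Q. ennreal (\<tau> x powr \<rho> x) \<partial>lebesgue) \<le> (\<integral>\<^sup>+x\<in>Q. ennreal c \<partial>lebesgue)"
        by (intro nn_integral_set_mono ennreal_leI) auto
      also have "\<dots> = ennreal (c * vol Q)" by (rule nn_integral_const_cube[OF Qc]) (simp add: c_def)
      also have "\<dots> < top" by simp
      finally show ?thesis .
    qed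
    then have "(\<integral>\<^sup>+x\<in>\<Union>F. ennreal (\<tau> x powr \<rho> x) \<partial>lebesgue) < top"
      using fin by (subst nn_integral_finite_Union[OF fin cube_familyD(2)[OF F] cube_familyD(5)[OF F]]) auto
    then obtain S where S: "0 \<le> S" "(\<integral>\<^sup>+x\<in>\<Union>F. ennreal (\<tau> x powr \<rho> x) \<partial>lebesgue) = ennreal S"
      by (auto simp: less_top_ennreal)
    have S1: "1 < S" using neg S by (simp add: not_le ennreal_1[symmetric] ennreal_less_iff del: ennreal_1)
    \<comment> \<open>Normalises the dual extremal function: as \<open>S > 1\<close>,
      \<open>\<kappa> powr r x \<le> 1 / S\<close> for every exponent \<open>r x \<ge> pm\<close>.
      Nevertheless \<open>\<kappa> * S = S powr (1 - 1 / pm)\<close> exceeds 1, which will be the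
      contradiction.\<close>
    define \<kappa> where "\<kappa> = S powr (- (1 / pm))"
    have \<kappa>: "0 < \<kappa>" using S1 by (simp add: \<kappa>_def)
    define f where "f x = \<kappa> * \<tau> x powr (\<rho> x - 1) * indicator (\<Union>F) x" for x
    have f[measurable]: "f \<in> borel_measurable lebesgue" unfolding f_def by measurable
    have f0: "0 \<le> f x" for x using \<kappa> by (simp add: f_def)
    have "modular r UNIV f = modular r (\<Union>F) (\<lambda>x. \<kappa> * \<tau> x powr (\<rho> x - 1))"
      unfolding f_def[abs_def] by (rule modular_indicator)
    also have "\<dots> \<le> (\<integral>\<^sup>+x. ennreal (1 / S) * (ennreal (\<tau> x powr \<rho> x) * indicator (\<Union>F) x) \<partial>lebesgue)"
      unfolding modular_def
    proof (rule nn_integral_mono)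
      fix x
      have "\<kappa> powr r x \<le> 1 / S"
      proof -
        have "\<kappa> powr r x = S powr (- (r x / pm))" by (simp add: \<kappa>_def powr_powr)
        also have "\<dots> \<le> S powr (- 1)" using S1 pm r_ge[of x] by (intro powr_mono) auto
        finally show ?thesis using S1 by (simp add: powr_minus_divide)
      qed
      moreover have "(\<kappa> * \<tau> x powr (\<rho> x - 1)) powr r x = \<kappa> powr r x * \<tau> x powr \<rho> x"
        using \<kappa> by (simp add: powr_mult powr_powr \<rho>r)
      ultimately have "(\<kappa> * \<tau> x powr (\<rho> x - 1)) powr r x \<le> 1 / S * \<tau> x powr \<rho> x" by (simp only: mult_right_mono powr_ge_zero)
      then have "ennreal ((\<kappa> * \<tau> x powr (\<rho> x - 1)) powr r x) \<le> ennreal (1 / S) * ennreal (\<tau> x powr \<rho> x)"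
        using S1 by (subst ennreal_mult[symmetric]) (auto intro: ennreal_leI)
      then show "ennreal ((\<kappa> * \<tau> x powr (\<rho> x - 1)) powr r x) * indicator (\<Union>F) x \<le>
          ennreal (1 / S) * (ennreal (\<tau> x powr \<rho> x) * indicator (\<Union>F) x)"
        by (cases "x \<in> \<Union>F") simp_all
    qed
    also have "\<dots> = ennreal (1 / S) * ennreal S"
      unfolding S(2)[symmetric] by (rule nn_integral_cmult) measurable
    also have "\<dots> = 1" using S1 by (simp flip: ennreal_mult)
    finally have f1: "modular r UNIV f \<le> 1" .
    obtain v where v: "step_fun F v" "\<And>Q x. Q \<in> F \<Longrightarrow> x \<in> Q \<Longrightarrow> v x = avg f Q"
      using ex_step_fun_nonneg[OF F, of "avg f"] avg_nonneg by metis
    note vm[measurable] = step_funD(2)[OF v(1)] and v0 = step_funD(3)[OF v(1)]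
    have vC: "modular r (\<Union>F) (\<lambda>x. v x / C) \<le> 1" by (rule avg_boundedD[OF B v(1) f f0 f1 v(2)])
    have "ennreal (4 * C * (\<kappa> * S)) = ennreal (4 * C * \<kappa>) * ennreal S"
      using C \<kappa> S(1) by (subst ennreal_mult[symmetric]) (auto simp: mult.assoc)
    also have "\<dots> = (\<integral>\<^sup>+x. ennreal (4 * C * \<kappa>) * (ennreal (\<tau> x powr \<rho> x) * indicator (\<Union>F) x) \<partial>lebesgue)"
      unfolding S(2)[symmetric] by (rule nn_integral_cmult[symmetric]) measurable
    also have "\<dots> = (\<integral>\<^sup>+x\<in>\<Union>F. ennreal (t x) * ennreal (f x) \<partial>lebesgue)"
    proof (rule nn_integral_cong)
      fix x
      have "ennreal (4 * C * \<kappa>) * ennreal (\<tau> x powr \<rho> x) = ennreal (t x) * ennreal (f x)" if "x \<in> \<Union>F"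
      proof -
        have "\<tau> x * \<tau> x powr (\<rho> x - 1) = \<tau> x powr \<rho> x"
          using \<tau>0[of x] \<rho>1(1)[of x] by (cases "\<tau> x = 0") (auto simp: powr_diff)
        moreover have "t x = 4 * C * \<tau> x" using C by (simp add: \<tau>_def)
        ultimately have "t x * f x = 4 * C * \<kappa> * \<tau> x powr \<rho> x" using that by (simp add: f_def)
        then show ?thesis using t0[of x] f0[of x] C \<kappa> by (simp flip: ennreal_mult)
      qed
      then show "ennreal (4 * C * \<kappa>) * (ennreal (\<tau> x powr \<rho> x) * indicator (\<Union>F) x) = ennreal (t x) * ennreal (f x) * indicator (\<Union>F) x"
        by (cases "x \<in> \<Union>F") simp_all
    qed
    also have "\<dots> \<le> (\<integral>\<^sup>+x\<in>\<Union>F. ennreal 2 * (ennreal (t x) * ennreal (v x)) * indicator E x \<partial>lebesgue)"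
    \<comment> \<open>On a cube \<open>t\<close> is constant, so \<open>f\<close> may be replaced by
      its average \<open>v\<close>, and then the integral over \<open>Q\<close> by twice that over
      \<open>E \<inter> Q\<close>.\<close>
    proof (rule nn_integral_Union_mono[OF cube_familyD(3,2)[OF F]])
      fix Q assume Q: "Q \<in> F"
      note Qc = cube_familyD(1)[OF F Q] note Qm = is_cubeD[OF Qc]
      have [measurable]: "Q \<in> sets lebesgue" by (rule Qm)
      obtain q where q: "q \<in> Q" using is_cube_has_point[OF Qc] by blast
      have tq: "t x = t q" "v x = avg f Q" if "x \<in> Q" for x using step_fun_const[OF t Q that q] v(2)[OF Q that] by auto
      have EQm: "E \<inter> Q \<in> lmeasurable" by (rule fmeasurable_Int_fmeasurable2[OF E Qm(2)])
      have finQ: "(\<integral>\<^sup>+x\<in>Q. ennreal (f x) \<partial>lebesgue) < \<infinity>"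
        using powr_integrable_cube[OF f f0 Qc f1, of "\<lambda>_. 1"] f0 r_pos(2) by (simp add: less_imp_le)
      have "(\<integral>\<^sup>+x\<in>Q. ennreal (t x) * ennreal (f x) \<partial>lebesgue) = (\<integral>\<^sup>+x. ennreal (t q) * (ennreal (f x) * indicator Q x) \<partial>lebesgue)"
        using tq by (intro nn_integral_cong) (auto simp: indicator_def)
      also have "\<dots> = ennreal (t q) * (\<integral>\<^sup>+x\<in>Q. ennreal (f x) \<partial>lebesgue)" by (rule nn_integral_cmult) measurable
      also have "\<dots> = ennreal (t q * avg f Q * vol Q)"
        unfolding avg_eq[OF Qc finQ] using t0 avg_nonneg[of f Q] by (simp add: mult.assoc flip: ennreal_mult)
      also have "\<dots> \<le> ennreal (t q * avg f Q * (2 * vol (E \<inter> Q)))"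
      proof (intro ennreal_leI mult_left_mono)
        have "1 / 2 * vol Q \<le> vol (E \<inter> Q)" using EQ0 Q FF by blast
        then show "vol Q \<le> 2 * vol (E \<inter> Q)" by simp
      qed (use t0 avg_nonneg[of f Q] in simp)
      also have "\<dots> = ennreal (2 * (t q * avg f Q)) * emeasure lebesgue (E \<inter> Q)"
        unfolding emeasure_eq_measure2[OF EQm] using t0 avg_nonneg[of f Q]
        by (subst ennreal_mult[symmetric]) (auto simp: mult_ac)
      also have "\<dots> = (\<integral>\<^sup>+x. ennreal (2 * (t q * avg f Q)) * indicator (E \<inter> Q) x \<partial>lebesgue)"
        by (rule nn_integral_cmult_indicator[symmetric]) measurable
      also have "\<dots> = (\<integral>\<^sup>+x\<in>Q. ennreal 2 * (ennreal (t x) * ennreal (v x)) * indicator E x \<partial>lebesgue)"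
      proof (rule nn_integral_cong)
        fix x
        have "ennreal (2 * (t q * avg f Q)) = ennreal 2 * (ennreal (t q) * ennreal (avg f Q))"
          using t0[of q] avg_nonneg[of f Q] by (simp only: ennreal_mult mult_nonneg_nonneg zero_le_numeral)
        then show "ennreal (2 * (t q * avg f Q)) * indicator (E \<inter> Q) x = ennreal 2 * (ennreal (t x) * ennreal (v x)) * indicator E x * indicator Q x"
          using tq[of x] by (cases "x \<in> Q") (simp_all add: indicator_def)
      qed
      finally show "(\<integral>\<^sup>+x\<in>Q. ennreal (t x) * ennreal (f x) \<partial>lebesgue) \<le> (\<integral>\<^sup>+x\<in>Q. ennreal 2 * (ennreal (t x) * ennreal (v x)) * indicator E x \<partial>lebesgue)" .
    qed (use cube_familyD(5)[OF F] in auto)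
    also have "\<dots> \<le> (\<integral>\<^sup>+x. ennreal (2 * C) * (ennreal ((v x / C) powr r x) * indicator (\<Union>F) x + ennreal (t x powr \<rho> x) * indicator (E \<inter> \<Union>F0) x) \<partial>lebesgue)"
    proof (rule nn_integral_mono)
      fix x
      \<comment> \<open>The pairing is split between \<open>v / C\<close>, controlled by the
        averaging bound, and \<open>t\<close> on \<open>E\<close>, controlled by assumption. The
        outcome is at most \<open>4 * C\<close>, against \<open>4 * C * (\<kappa> * S)\<close> on
        the left.\<close>
      have "v x / C * t x \<le> (v x / C) powr r x + t x powr \<rho> x"
        by (rule young_le) (use r_pos(2) v0 t0 C in \<open>auto simp: \<rho>_def\<close>)
      then have "2 * (t x * v x) \<le> 2 * C * ((v x / C) powr r x + t x powr \<rho> x)" using C by (simp add: field_simps)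
      then have "ennreal (2 * (t x * v x)) \<le> ennreal (2 * C * ((v x / C) powr r x + t x powr \<rho> x))" by (rule ennreal_leI)
      then have "ennreal 2 * (ennreal (t x) * ennreal (v x)) \<le> ennreal (2 * C) * (ennreal ((v x / C) powr r x) + ennreal (t x powr \<rho> x))"
        using t0[of x] v0[of x] C by (simp only: ennreal_mult ennreal_plus mult_nonneg_nonneg zero_le_numeral powr_ge_zero add_nonneg_nonneg)
      then show "ennreal 2 * (ennreal (t x) * ennreal (v x)) * indicator E x * indicator (\<Union>F) x \<le>
          ennreal (2 * C) * (ennreal ((v x / C) powr r x) * indicator (\<Union>F) x + ennreal (t x powr \<rho> x) * indicator (E \<inter> \<Union>F0) x)"
        using FF by (cases "x \<in> E \<and> x \<in> \<Union>F") (auto simp: indicator_def)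
    qed
    also have "\<dots> = ennreal (2 * C) * (modular r (\<Union>F) (\<lambda>x. v x / C) + modular \<rho> (E \<inter> \<Union>F0) t)"
    proof -
      have [measurable]: "\<Union>F0 \<in> sets lebesgue" by (rule cube_familyD(4)[OF F0])
      define I where "I = (\<integral>\<^sup>+x. ennreal ((v x / C) powr r x) * indicator (\<Union>F) x + ennreal (t x powr \<rho> x) * indicator (E \<inter> \<Union>F0) x \<partial>lebesgue)"
      have "I = modular r (\<Union>F) (\<lambda>x. v x / C) + modular \<rho> (E \<inter> \<Union>F0) t"
        unfolding I_def modular_def by (rule nn_integral_add) measurable
      moreover have "(\<integral>\<^sup>+x. ennreal (2 * C) * (ennreal ((v x / C) powr r x) * indicator (\<Union>F) x + ennreal (t x powr \<rho> x) * indicator (E \<inter> \<Union>F0) x) \<partial>lebesgue) = ennreal (2 * C) * I"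
        unfolding I_def by (rule nn_integral_cmult) measurable
      ultimately show ?thesis by (simp only:)
    qed
    also have "\<dots> \<le> ennreal (2 * C) * (1 + 1)"
      using vC le10 unfolding \<rho>_def[abs_def] by (intro mult_left_mono add_mono) auto
    also have "\<dots> = ennreal (2 * C * 2)"
    proof -
      have "(1 + 1 :: ennreal) = ennreal 2" by (simp add: one_add_one)
      then show ?thesis using C by (simp only: ennreal_mult zero_le_numeral mult_nonneg_nonneg)
    qed
    finally have "4 * C * (\<kappa> * S) \<le> 2 * C * 2" using C by (subst (asm) ennreal_le_iff) auto
    then have "\<kappa> * S \<le> 1" using C by simp
    moreover have "\<kappa> * S = S powr (1 - 1 / pm)"
    proof -
      have "\<kappa> * S = S powr (- (1 / pm)) * S powr 1" using S1 by (simp add: \<kappa>_def)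
      also have "\<dots> = S powr (- (1 / pm) + 1)" by (rule powr_add[symmetric])
      finally show ?thesis by simp
    qed
    moreover have "1 < S powr (1 - 1 / pm)" using S1 pm by (intro gr_one_powr) auto
    ultimately show False by simp
  qed
  then have "(\<integral>\<^sup>+x\<in>\<Union>F0. ennreal (\<tau> x powr \<rho> x) \<partial>lebesgue) \<le> 1"
    by (intro nn_integral_Union_le[OF cube_familyD(3,5)[OF F0]]) auto
  then show "modular (\<lambda>x. r x / (r x - 1)) (\<Union>F0) (\<lambda>x. t x / (4 * C)) \<le> 1"
    unfolding modular_def \<tau>_def \<rho>_def .
qed

end

section \<open>Norms and modulars\<close>

lemma ennreal_divide_eq_mult: "0 < c \<Longrightarrow> y / ennreal c = y * ennreal (1 / c)"
  by (simp add: divide_ennreal_def inverse_ennreal inverse_eq_divide)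

lemma ennpow_mono:
  assumes "a \<le> b" "0 \<le> q"
  shows "ennpow a (ennreal q) \<le> ennpow b (ennreal q)"
  using assms by (cases a; cases b) (auto simp: ennpow_def top_unique intro!: ennreal_leI powr_mono2)

lemma ennpow_ennreal: "0 \<le> a \<Longrightarrow> 0 \<le> q \<Longrightarrow> ennpow (ennreal a) (ennreal q) = ennreal (a powr q)"
  by (simp add: ennpow_def)

text \<open>Continuity from below in the base. Testing only finite \<open>u\<close> below
  \<open>y\<close> covers the value \<open>\<infinity>\<close> and suits a maximal function, which
  is a supremum.\<close>

lemma ennpow_le:
  assumes q: "1 \<le> q" and le: "\<And>u. 0 \<le> u \<Longrightarrow> ennreal u < y \<Longrightarrow> ennreal (u powr q) \<le> B"
  shows "ennpow y (ennreal q) \<le> B"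
proof (cases y)
  case (real a)
  show ?thesis
  proof (cases "a = 0")
    case False
    then have a: "0 < a" using real by simp
    have lim: "(\<lambda>k. ennreal ((a * (1 - inverse (real (Suc k)))) powr q)) \<longlonglongrightarrow> ennreal ((a * (1 - 0)) powr q)"
      using a q by (intro tendsto_ennrealI tendsto_powr tendsto_mult tendsto_diff tendsto_const LIMSEQ_inverse_real_of_nat) auto
    have leB: "ennreal ((a * (1 - inverse (real (Suc k)))) powr q) \<le> B" for k
    proof (rule le)
      have i: "0 < inverse (real (Suc k))" "inverse (real (Suc k)) \<le> 1" by (simp_all add: field_simps)
      then show "0 \<le> a * (1 - inverse (real (Suc k)))" using a by simp
      have "a * (1 - inverse (real (Suc k))) < a * 1" using a i by (intro mult_strict_left_mono) auto
      then show "ennreal (a * (1 - inverse (real (Suc k)))) < y" using real i a by (simp add: ennreal_less_iff)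
    qed
    have "ennreal ((a * (1 - 0)) powr q) \<le> B" by (rule LIMSEQ_le_const2[OF lim]) (use leB in blast)
    then show ?thesis using real q by (simp add: ennpow_ennreal)
  qed (use real q in \<open>simp add: ennpow_def\<close>)
next
  case top
  have "of_nat k \<le> B" for k
  proof (cases "k = 0")
    case False
    have "real k powr 1 \<le> real k powr q" using False q by (intro powr_mono) auto
    then have "ennreal (real k) \<le> ennreal (real k powr q)" using False by (intro ennreal_leI) simp
    also have "\<dots> \<le> B" by (rule le) (use top in auto)
    finally show ?thesis by (simp add: ennreal_of_nat_eq_real_of_nat)
  qed simp
  note kB = this
  have "B = top"
  proof (cases B)
    case (real b)
    obtain k where "b < real k" using reals_Archimedean2 by blast
    moreover have "ennreal (real k) \<le> ennreal b" using kB[of k] real by (simp add: ennreal_of_nat_eq_real_of_nat)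
    then have "real k \<le> b" using real by (subst (asm) ennreal_le_iff) auto
    ultimately show ?thesis by simp
  qed
  then show ?thesis by simp
qed

lemma Lp_norm_leI:
  assumes "0 < c" "(\<integral>\<^sup>+x. ennpow (g x / ennreal c) (p x) \<partial>lebesgue) \<le> 1"
  shows "Lp_norm p g \<le> ennreal c"
  unfolding Lp_norm_def using assms by (intro Inf_lower) blast

text \<open>At each point at most one term differs from 0, by disjointness.\<close>

lemma infsum_cube_family:
  fixes t :: "(real ^ 'n) set \<Rightarrow> real"
  assumes F: "cube_family F" and A: "\<And>Q. Q \<in> F \<Longrightarrow> A Q \<subseteq> Q" and v: "\<And>Q x. Q \<in> F \<Longrightarrow> x \<in> Q \<Longrightarrow> v x = t Q"
  shows "(\<Sum>\<^sub>\<infinity>Q\<in>F. ennreal (t Q) * indicator (A Q) x) = ennreal (v x * indicator (\<Union>Q\<in>F. A Q) x)"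
proof -
  define a where "a = (\<lambda>R. ennreal (t R) * indicator (A R) x)"
  have "infsum a F = ennreal (v x * indicator (\<Union>Q\<in>F. A Q) x)"
  proof (cases "\<exists>Q\<in>F. x \<in> A Q")
    case True
    then obtain Q where Q: "Q \<in> F" "x \<in> A Q" by blast
    have xQ: "x \<in> Q" using A Q by blast
    have "infsum a F = infsum a {Q}"
    proof (rule infsum_cong_neutral)
      fix R assume R: "R \<in> F - {Q}"
      then have "R \<inter> Q = {}" using cube_familyD(2)[OF F] Q(1) unfolding disjoint_def by (metis DiffE insertI1)
      then have "x \<notin> A R" using A[of R] R xQ by blast
      then show "a R = 0" by (simp add: a_def)
    qed (use Q in auto)
    also have "\<dots> = a Q" by simp
    also have "\<dots> = ennreal (v x * indicator (\<Union>Q\<in>F. A Q) x)" using v[OF Q(1) xQ] Q by (auto simp: a_def indicator_def)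
    finally show ?thesis .
  next
    case False
    then have "infsum a F = 0" by (intro infsum_0) (simp add: a_def)
    then show ?thesis using False by simp
  qed
  then show ?thesis unfolding a_def .
qed

context exponent
begin

context
  fixes p :: "real ^ 'n \<Rightarrow> ennreal"
  assumes pr: "AE x in lebesgue. p x = ennreal (r x)"
begin

lemma ennpow_integral:
  assumes "\<And>x. 0 \<le> f x" "0 < c"
  shows "(\<integral>\<^sup>+x. ennpow (ennreal (f x) / ennreal c) (p x) \<partial>lebesgue) = modular r UNIV (\<lambda>x. f x / c)"
  unfolding modular_def
proof (rule nn_integral_cong_AE)
  show "AE x in lebesgue. ennpow (ennreal (f x) / ennreal c) (p x) = ennreal ((f x / c) powr r x) * indicator UNIV x"
    using pr
  proof eventually_elim
    case (elim x)
    show ?case unfolding elim divide_ennreal[OF assms] using assms r_pos(1)[of x] by (simp add: ennpow_ennreal)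
  qed
qed

lemma ennpow_integral_mono:
  assumes "\<And>x. g x \<le> h x"
  shows "(\<integral>\<^sup>+x. ennpow (g x) (p x) \<partial>lebesgue) \<le> (\<integral>\<^sup>+x. ennpow (h x) (p x) \<partial>lebesgue)"
proof (rule nn_integral_mono_AE)
  show "AE x in lebesgue. ennpow (g x) (p x) \<le> ennpow (h x) (p x)"
    using pr
  proof eventually_elim
    case (elim x)
    show ?case unfolding elim by (rule ennpow_mono) (use assms r_pos(1)[of x] in auto)
  qed
qed

text \<open>Strict inequality, because the infimum need not be attained; above an admissible value
  every \<open>c\<close> is admissible by monotonicity.\<close>

lemma Lp_norm_lessD:
  assumes "Lp_norm p g < ennreal c"
  shows "0 < c" "(\<integral>\<^sup>+x. ennpow (g x / ennreal c) (p x) \<partial>lebesgue) \<le> 1"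
proof -
  obtain b where b: "0 < b" "ennreal b < ennreal c" "(\<integral>\<^sup>+x. ennpow (g x / ennreal b) (p x) \<partial>lebesgue) \<le> 1"
    using assms unfolding Lp_norm_def Inf_less_iff by blast
  have bc: "b < c" using b(1,2) by (simp add: ennreal_less_iff)
  then show "0 < c" using b(1) by simp
  have "(\<integral>\<^sup>+x. ennpow (g x / ennreal c) (p x) \<partial>lebesgue) \<le> (\<integral>\<^sup>+x. ennpow (g x / ennreal b) (p x) \<partial>lebesgue)"
  proof (rule ennpow_integral_mono)
    fix x
    have "ennreal (1 / c) \<le> ennreal (1 / b)" using b(1) bc by (intro ennreal_leI) (simp add: frac_le)
    then show "g x / ennreal c \<le> g x / ennreal b"
      using b(1) bc by (simp add: ennreal_divide_eq_mult mult_left_mono)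
  qed
  then show "(\<integral>\<^sup>+x. ennpow (g x / ennreal c) (p x) \<partial>lebesgue) \<le> 1" using b(3) by simp
qed

text \<open>Reduces a norm inequality to an implication between modulars at every scale
  \<open>c\<close>; the infimum is approached up to \<open>e\<close>, and an infinite right-hand
  side is trivial.\<close>

lemma Lp_norm_le_mult:
  assumes C: "0 < C" and *: "\<And>c. 0 < c \<Longrightarrow> (\<integral>\<^sup>+x. ennpow (g x / ennreal c) (p x) \<partial>lebesgue) \<le> 1 \<Longrightarrow>
    (\<integral>\<^sup>+x. ennpow (h x / ennreal (C * c)) (p x) \<partial>lebesgue) \<le> 1"
  shows "Lp_norm p h \<le> ennreal C * Lp_norm p g"
proof (rule ennreal_le_epsilon)
  fix e :: real
  assume fin: "ennreal C * Lp_norm p g < top" and e: "0 < e"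
  then have "Lp_norm p g < top" using C by (auto simp: ennreal_mult_less_top)
  then obtain n where n: "0 \<le> n" "Lp_norm p g = ennreal n" by (auto simp: less_top_ennreal)
  define c where "c = n + e / C"
  have "Lp_norm p g < ennreal c" using n e C by (simp add: c_def ennreal_less_iff)
  from Lp_norm_lessD[OF this] have c: "0 < c" "(\<integral>\<^sup>+x. ennpow (h x / ennreal (C * c)) (p x) \<partial>lebesgue) \<le> 1"
    using * by auto
  then have "Lp_norm p h \<le> ennreal (C * c)" using C by (intro Lp_norm_leI) auto
  also have "C * c = C * n + e" using C by (simp add: c_def field_simps)
  also have "ennreal (C * n + e) = ennreal C * Lp_norm p g + ennreal e"
    using n C e by (simp add: ennreal_mult)
  finally show "Lp_norm p h \<le> ennreal C * Lp_norm p g + ennreal e" .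
qed

section \<open>Transfer of the conditions between norms and modulars\<close>

lemma A_infty_imp_A_mod:
  assumes "A_infty p"
  obtains l C where "0 < l" "l < 1" "1 \<le> C" "A_mod r l C"
proof -
  obtain l C0 where l: "0 < l" "l < 1" and C0: "0 < C0" and
    *: "\<And>(F::(real ^ 'n) set set) (t::(real ^ 'n) set \<Rightarrow> real) (E::(real ^ 'n) set \<Rightarrow> (real ^ 'n) set).
           (\<forall>Q\<in>F. is_cube Q) \<Longrightarrow> disjoint F \<Longrightarrow> (\<forall>Q\<in>F. 0 \<le> t Q) \<Longrightarrow>
           (\<forall>Q\<in>F. E Q \<in> sets lebesgue \<and> E Q \<subseteq> Q \<and> vol (E Q) \<ge> l * vol Q) \<Longrightarrow>
           Lp_norm p (\<lambda>x. \<Sum>\<^sub>\<infinity>Q\<in>F. ennreal (t Q) * indicator Q x)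
             \<le> ennreal C0 * Lp_norm p (\<lambda>x. \<Sum>\<^sub>\<infinity>Q\<in>F. ennreal (t Q) * indicator (E Q) x)"
    using assms unfolding A_infty_def by blast
  \<comment> \<open>Strictly above \<open>C0\<close>, since the modular bound at \<open>C\<close> is
    drawn from a norm strictly below \<open>C\<close>.\<close>
  define C where "C = max 1 (2 * C0)"
  have C: "1 \<le> C" "C0 < C" using C0 by (auto simp: C_def)
  have "A_mod r l C"
    unfolding A_mod_def
  proof (intro allI impI)
    fix F t E
    assume t: "step_fun F t" and E: "E \<in> sets lebesgue"
      and EQ: "\<forall>Q\<in>F. l * vol Q \<le> vol (E \<inter> Q)"
      and le1: "modular r (E \<inter> \<Union>F) t \<le> 1"
    note F = step_funD(1)[OF t] and t0 = step_funD(3)[OF t]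
    define tq where "tq Q = t (SOME x. x \<in> Q)" for Q
    have tq: "tq Q = t x" if "Q \<in> F" "x \<in> Q" for Q x
      unfolding tq_def using someI[of "\<lambda>x. x \<in> Q" x, OF that(2)] step_fun_const[OF t that(1) _ that(2)] by blast
    have s1: "(\<Sum>\<^sub>\<infinity>Q\<in>F. ennreal (tq Q) * indicator Q x) = ennreal (t x * indicator (\<Union>F) x)" for x
      using infsum_cube_family[OF F, of "\<lambda>Q. Q" t tq] tq by simp
    have s2: "(\<Sum>\<^sub>\<infinity>Q\<in>F. ennreal (tq Q) * indicator (E \<inter> Q) x) = ennreal (t x * indicator (E \<inter> \<Union>F) x)" for x
      using infsum_cube_family[OF F, of "\<lambda>Q. E \<inter> Q" t tq] tq unfolding Int_Union by simp
    have "Lp_norm p (\<lambda>x. ennreal (t x * indicator (\<Union>F) x)) \<le> ennreal C0 * Lp_norm p (\<lambda>x. ennreal (t x * indicator (E \<inter> \<Union>F) x))"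
    proof -
      have t0q: "\<forall>Q\<in>F. 0 \<le> tq Q" using t0 by (simp add: tq_def)
      have EQ': "\<forall>Q\<in>F. E \<inter> Q \<in> sets lebesgue \<and> E \<inter> Q \<subseteq> Q \<and> vol (E \<inter> Q) \<ge> l * vol Q"
        using EQ sets.Int[OF E cube_familyD(5)[OF F]] by blast
      show ?thesis
        using *[of F tq "\<lambda>Q. E \<inter> Q", OF _ cube_familyD(2)[OF F] t0q EQ'] cube_familyD(1)[OF F] unfolding s1 s2 by blast
    qed
    also have "\<dots> \<le> ennreal C0 * ennreal 1"
    proof (intro mult_left_mono Lp_norm_leI)
      have "(\<integral>\<^sup>+x. ennpow (ennreal (t x * indicator (E \<inter> \<Union>F) x) / ennreal 1) (p x) \<partial>lebesgue) = modular r UNIV (\<lambda>x. t x * indicator (E \<inter> \<Union>F) x / 1)"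
        by (rule ennpow_integral) (use t0 in auto)
      also have "\<dots> \<le> 1" using le1 by (simp only: div_by_1 modular_indicator)
      finally show "(\<integral>\<^sup>+x. ennpow (ennreal (t x * indicator (E \<inter> \<Union>F) x) / ennreal 1) (p x) \<partial>lebesgue) \<le> 1" .
    qed auto
    also have "\<dots> < ennreal C" using C C0 by (simp add: ennreal_less_iff)
    finally have "(\<integral>\<^sup>+x. ennpow (ennreal (t x * indicator (\<Union>F) x) / ennreal C) (p x) \<partial>lebesgue) \<le> 1"
      by (rule Lp_norm_lessD)
    then have "modular r UNIV (\<lambda>x. t x * indicator (\<Union>F) x / C) \<le> 1"
      by (subst (asm) ennpow_integral) (use t0 C in auto)
    then have "modular r UNIV (\<lambda>x. (t x / C) * indicator (\<Union>F) x) \<le> 1" by (simp only: times_divide_eq_left)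
    then show "modular r (\<Union>F) (\<lambda>x. t x / C) \<le> 1" unfolding modular_indicator .
  qed
  then show ?thesis using that l C by blast
qed

lemma A_mod_imp_A_infty:
  assumes A: "A_mod r l C" and l: "0 < l" "l < 1" and C: "1 \<le> C"
  shows "A_infty p"
  unfolding A_infty_def
proof (rule exI[of _ l], rule exI[of _ C], intro conjI allI impI l)
  show "0 < C" using C by simp
  fix F :: "(real ^ 'n) set set" and t :: "(real ^ 'n) set \<Rightarrow> real" and E :: "(real ^ 'n) set \<Rightarrow> (real ^ 'n) set"
  assume cF: "\<forall>Q\<in>F. is_cube Q" and dF: "disjoint F" and t0: "\<forall>Q\<in>F. 0 \<le> t Q"
    and E: "\<forall>Q\<in>F. E Q \<in> sets lebesgue \<and> E Q \<subseteq> Q \<and> l * vol Q \<le> vol (E Q)"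
  have F: "cube_family F" using cF dF by (simp add: cube_family_def)
  obtain v where v: "step_fun F v" "\<And>Q x. Q \<in> F \<Longrightarrow> x \<in> Q \<Longrightarrow> v x = t Q" "\<And>x. x \<notin> \<Union>F \<Longrightarrow> v x = 0"
    using ex_step_fun_nonneg[OF F, of t thesis] t0 by blast
  note v0 = step_funD(3)[OF v(1)]
  define U where "U = (\<Union>Q\<in>F. E Q)"
  have U: "U \<in> sets lebesgue" unfolding U_def using E cube_familyD(3)[OF F] by (intro sets.countable_UN') auto
  have UQ: "U \<inter> Q = E Q" if "Q \<in> F" for Q
    unfolding U_def by (rule UN_Int_cube[OF F that]) (use E in blast)
  have UF: "U \<inter> \<Union>F = U" unfolding U_def using E by blast
  have s1: "(\<Sum>\<^sub>\<infinity>Q\<in>F. ennreal (t Q) * indicator Q x) = ennreal (v x * indicator (\<Union>F) x)" for x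
    using infsum_cube_family[OF F, of "\<lambda>Q. Q" v t] v(2) by simp
  have s2: "(\<Sum>\<^sub>\<infinity>Q\<in>F. ennreal (t Q) * indicator (E Q) x) = ennreal (v x * indicator (U \<inter> \<Union>F) x)" for x
    unfolding UF unfolding U_def by (rule infsum_cube_family[OF F]) (use E v(2) in auto)
  show "Lp_norm p (\<lambda>x. \<Sum>\<^sub>\<infinity>Q\<in>F. ennreal (t Q) * indicator Q x)
      \<le> ennreal C * Lp_norm p (\<lambda>x. \<Sum>\<^sub>\<infinity>Q\<in>F. ennreal (t Q) * indicator (E Q) x)"
    unfolding s1 s2
  proof (rule Lp_norm_le_mult)
    show "0 < C" using C by simp
    fix c :: real
    assume c: "0 < c" and le1: "(\<integral>\<^sup>+x. ennpow (ennreal (v x * indicator (U \<inter> \<Union>F) x) / ennreal c) (p x) \<partial>lebesgue) \<le> 1"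
    have "modular r UNIV (\<lambda>x. v x * indicator (U \<inter> \<Union>F) x / c) \<le> 1"
      using le1 by (subst (asm) ennpow_integral) (use v0 c in auto)
    then have "modular r UNIV (\<lambda>x. (v x / c) * indicator (U \<inter> \<Union>F) x) \<le> 1" by (simp only: times_divide_eq_left)
    then have "modular r (U \<inter> \<Union>F) (\<lambda>x. v x / c) \<le> 1" unfolding modular_indicator .
    then have "modular r (\<Union>F) (\<lambda>x. v x / c / C) \<le> 1"
      by (intro A_modD[OF A step_fun_divide[OF v(1)] U]) (use c UQ E in auto)
    then have "modular r UNIV (\<lambda>x. (v x / c / C) * indicator (\<Union>F) x) \<le> 1" unfolding modular_indicator .
    moreover have "(v x / c / C) * indicator (\<Union>F) x = v x * indicator (\<Union>F) x / (C * c)" for x by (simp add: mult.commute)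
    ultimately have "modular r UNIV (\<lambda>x. v x * indicator (\<Union>F) x / (C * c)) \<le> 1" by (simp only:)
    then show "(\<integral>\<^sup>+x. ennpow (ennreal (v x * indicator (\<Union>F) x) / ennreal (C * c)) (p x) \<partial>lebesgue) \<le> 1"
      by (subst ennpow_integral) (use v0 c C in auto)
  qed
qed

text \<open>On each cube of the family the average of \<open>f\<close> is one of the competitors in
  \<open>maximal f\<close>.\<close>

lemma maximal_bounded_imp_avg_bounded:
  assumes "maximal_bounded p"
  obtains C where "1 \<le> C" "avg_bounded r C"
proof -
  obtain C0 where C0: "0 < C0" and
    *: "\<And>f. f \<in> Lp_space p \<Longrightarrow> Lp_norm p (maximal f) \<le> ennreal C0 * Lp_norm p (\<lambda>x. ennreal \<bar>f x\<bar>)"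
    using assms unfolding maximal_bounded_def by blast
  define C where "C = max 1 (2 * C0)"
  have C: "1 \<le> C" "C0 < C" using C0 by (auto simp: C_def)
  have "avg_bounded r C"
    unfolding avg_bounded_def
  proof (intro allI impI)
    fix F f v
    assume v: "step_fun F v" and f: "f \<in> borel_measurable lebesgue" and f0: "\<forall>x. 0 \<le> f x"
      and f1: "modular r UNIV f \<le> 1" and va: "\<forall>Q\<in>F. \<forall>x\<in>Q. v x = avg f Q"
    note F = step_funD(1)[OF v] and v0 = step_funD(3)[OF v]
    have nf: "Lp_norm p (\<lambda>x. ennreal \<bar>f x\<bar>) \<le> ennreal 1"
    proof (rule Lp_norm_leI)
      have "(\<integral>\<^sup>+x. ennpow (ennreal \<bar>f x\<bar> / ennreal 1) (p x) \<partial>lebesgue) = modular r UNIV (\<lambda>x. \<bar>f x\<bar> / 1)"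
        by (rule ennpow_integral) auto
      then show "(\<integral>\<^sup>+x. ennpow (ennreal \<bar>f x\<bar> / ennreal 1) (p x) \<partial>lebesgue) \<le> 1" using f1 f0 by simp
    qed simp
    then have "f \<in> Lp_space p" using f unfolding Lp_space_def by (auto intro: le_less_trans)
    then have "Lp_norm p (maximal f) \<le> ennreal C0 * Lp_norm p (\<lambda>x. ennreal \<bar>f x\<bar>)" by (rule *)
    also have "\<dots> \<le> ennreal C0 * ennreal 1" using nf by (rule mult_left_mono) simp
    also have "\<dots> < ennreal C" using C C0 by (simp add: ennreal_less_iff)
    finally have le1: "(\<integral>\<^sup>+x. ennpow (maximal f x / ennreal C) (p x) \<partial>lebesgue) \<le> 1" by (rule Lp_norm_lessD)
    have "ennreal (v x * indicator (\<Union>F) x) \<le> maximal f x" for x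
    proof (cases "x \<in> \<Union>F")
      case True
      then obtain Q where Q: "Q \<in> F" "x \<in> Q" by blast
      note Qc = cube_familyD(1)[OF F Q(1)]
      have "(\<integral>\<^sup>+y\<in>Q. ennreal (f y) \<partial>lebesgue) < \<infinity>"
        using powr_integrable_cube[OF f f0[rule_format] Qc f1, of "\<lambda>_. 1"] f0 r_pos(2) by (simp add: less_imp_le)
      from avg_eq[OF Qc this]
      have "(\<integral>\<^sup>+y\<in>Q. ennreal \<bar>f y\<bar> \<partial>lebesgue) / emeasure lebesgue Q = ennreal (avg f Q)"
        using f0 is_cubeD(3)[OF Qc] avg_nonneg[of f Q] unfolding is_cubeD(4)[OF Qc] by (simp add: divide_ennreal)
      moreover have "(\<integral>\<^sup>+y\<in>Q. ennreal \<bar>f y\<bar> \<partial>lebesgue) / emeasure lebesgue Q \<le> maximal f x"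
        unfolding maximal_def by (rule SUP_upper) (use Qc Q in simp)
      ultimately show ?thesis using va Q True by simp
    qed simp
    then have "(\<integral>\<^sup>+x. ennpow (ennreal (v x * indicator (\<Union>F) x) / ennreal C) (p x) \<partial>lebesgue) \<le> (\<integral>\<^sup>+x. ennpow (maximal f x / ennreal C) (p x) \<partial>lebesgue)"
      using C by (intro ennpow_integral_mono) (simp add: ennreal_divide_eq_mult mult_right_mono)
    then have "(\<integral>\<^sup>+x. ennpow (ennreal (v x * indicator (\<Union>F) x) / ennreal C) (p x) \<partial>lebesgue) \<le> 1" using le1 by simp
    then have "modular r UNIV (\<lambda>x. v x * indicator (\<Union>F) x / C) \<le> 1"
      by (subst (asm) ennpow_integral) (use v0 C in auto)
    then have "modular r UNIV (\<lambda>x. (v x / C) * indicator (\<Union>F) x) \<le> 1" by (simp only: times_divide_eq_left)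
    then show "modular r (\<Union>F) (\<lambda>x. v x / C) \<le> 1" unfolding modular_indicator .
  qed
  then show ?thesis using that C by blast
qed

text \<open>Each competitor in \<open>maximal f x\<close> is eventually at most
  \<open>6 ^ CARD('n) * grid_max N f x\<close>. So the power of the maximal function is bounded by a
  lower limit in \<open>N\<close>, and Fatou's lemma transfers the uniform bound.\<close>

lemma maximal_modular:
  assumes D: "1 \<le> D" and f: "f \<in> borel_measurable lebesgue" and f0: "\<And>x. 0 \<le> f x" and f1: "modular r UNIV f \<le> 1"
    and grid: "\<And>N. modular r UNIV (\<lambda>x. grid_max N f x / D) \<le> 1"
  shows "(\<integral>\<^sup>+x. ennpow (maximal f x / ennreal (6 ^ CARD('n) * D)) (p x) \<partial>lebesgue) \<le> 1"
proof -
  define A where "A = 6 ^ CARD('n) * D"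
  have A: "0 < A" using D by (simp add: A_def)
  have fin: "(\<integral>\<^sup>+y\<in>Q. ennreal (f y) \<partial>lebesgue) < \<infinity>" if "is_cube Q" for Q
    using powr_integrable_cube[OF f f0 that f1, of "\<lambda>_. 1"] f0 r_pos(2) by (simp add: less_imp_le)
  have "ennpow (maximal f x / ennreal A) (ennreal (r x)) \<le> liminf (\<lambda>N. ennreal ((grid_max N f x / D) powr r x))" for x
  proof (rule ennpow_le)
    show "1 \<le> r x" using r_pos(2)[of x] by simp
    fix u :: real
    assume u: "0 \<le> u" "ennreal u < maximal f x / ennreal A"
    have "ennreal (u * A) < maximal f x"
    proof (rule ccontr)
      assume "\<not> ?thesis"
      then have "maximal f x * ennreal (1 / A) \<le> ennreal (u * A) * ennreal (1 / A)" by (intro mult_right_mono) auto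
      also have "\<dots> = ennreal u" using u A by (simp flip: ennreal_mult)
      finally show False using u(2) A by (simp add: ennreal_divide_eq_mult)
    qed
    then obtain Q where Q: "is_cube Q" "x \<in> Q" "ennreal (u * A) < (\<integral>\<^sup>+y\<in>Q. ennreal \<bar>f y\<bar> \<partial>lebesgue) / emeasure lebesgue Q"
      unfolding maximal_def less_SUP_iff by blast
    have "(\<integral>\<^sup>+y\<in>Q. ennreal \<bar>f y\<bar> \<partial>lebesgue) / emeasure lebesgue Q = ennreal (avg f Q)"
      using avg_eq[OF Q(1) fin[OF Q(1)]] f0 is_cubeD(3)[OF Q(1)] avg_nonneg[of f Q]
      unfolding is_cubeD(4)[OF Q(1)] by (simp add: divide_ennreal)
    then have uA: "u * A < avg f Q" using Q(3) u A by (simp add: ennreal_less_iff)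
    have "\<forall>\<^sub>F N in sequentially. avg f Q \<le> 6 ^ CARD('n) * grid_max N f x"
      by (rule avg_le_grid_max[OF Q(1,2) f0 fin])
    then have "\<forall>\<^sub>F N in sequentially. ennreal (u powr r x) \<le> ennreal ((grid_max N f x / D) powr r x)"
    proof eventually_elim
      case (elim N)
      then have "u * A \<le> 6 ^ CARD('n) * grid_max N f x" using uA by linarith
      moreover have "u * A = 6 ^ CARD('n) * (u * D)" by (simp add: A_def)
      ultimately have "u * D \<le> grid_max N f x" by simp
      then have "u \<le> grid_max N f x / D" using D by (simp add: field_simps)
      then show ?case using u r_pos(1)[of x] by (intro ennreal_leI powr_mono2) auto
    qed
    then show "ennreal (u powr r x) \<le> liminf (\<lambda>N. ennreal ((grid_max N f x / D) powr r x))"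
      by (rule Liminf_bounded)
  qed
  then have "(\<integral>\<^sup>+x. ennpow (maximal f x / ennreal A) (p x) \<partial>lebesgue) \<le> (\<integral>\<^sup>+x. liminf (\<lambda>N. ennreal ((grid_max N f x / D) powr r x)) \<partial>lebesgue)"
    using pr by (intro nn_integral_mono_AE) (auto elim: eventually_mono)
  also have "\<dots> \<le> liminf (\<lambda>N. \<integral>\<^sup>+x. ennreal ((grid_max N f x / D) powr r x) \<partial>lebesgue)"
    by (rule nn_integral_liminf) measurable
  also have "\<dots> \<le> liminf (\<lambda>N :: nat. 1)"
    by (rule Liminf_mono) (use grid in \<open>simp add: modular_def\<close>)
  also have "\<dots> = 1" by (rule Liminf_const) simp
  finally show ?thesis unfolding A_def .
qed

lemma maximal_le_scaled:
  assumes "0 < c" and [measurable]: "f \<in> borel_measurable lebesgue"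
  shows "maximal f x \<le> ennreal c * maximal (\<lambda>x. \<bar>f x\<bar> / c) x"
  unfolding maximal_def
proof (rule SUP_least)
  fix Q assume Q: "Q \<in> {Q. is_cube Q \<and> x \<in> Q}"
  have [measurable]: "Q \<in> sets lebesgue" using Q is_cubeD(1) by blast
  define h where "h y = ennreal \<bar>\<bar>f y\<bar> / c\<bar>" for y
  have h: "ennreal \<bar>f y\<bar> = ennreal c * h y" for y
    using assms(1) by (simp add: h_def flip: ennreal_mult)
  have "(\<integral>\<^sup>+y\<in>Q. ennreal \<bar>f y\<bar> \<partial>lebesgue) = (\<integral>\<^sup>+y. ennreal c * (h y * indicator Q y) \<partial>lebesgue)"
    by (simp add: h mult.assoc)
  also have "\<dots> = ennreal c * (\<integral>\<^sup>+y\<in>Q. h y \<partial>lebesgue)"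
    unfolding h_def by (rule nn_integral_cmult) measurable
  finally have "(\<integral>\<^sup>+y\<in>Q. ennreal \<bar>f y\<bar> \<partial>lebesgue) / emeasure lebesgue Q = ennreal c * ((\<integral>\<^sup>+y\<in>Q. h y \<partial>lebesgue) / emeasure lebesgue Q)"
    by (simp add: ennreal_times_divide)
  also have "\<dots> \<le> ennreal c * (SUP Q\<in>{Q. is_cube Q \<and> x \<in> Q}. (\<integral>\<^sup>+y\<in>Q. h y \<partial>lebesgue) / emeasure lebesgue Q)"
    using Q by (intro mult_left_mono SUP_upper) auto
  finally show "(\<integral>\<^sup>+y\<in>Q. ennreal \<bar>f y\<bar> \<partial>lebesgue) / emeasure lebesgue Q \<le>
      ennreal c * (SUP Q\<in>{Q. is_cube Q \<and> x \<in> Q}. (\<integral>\<^sup>+y\<in>Q. ennreal \<bar>\<bar>f y\<bar> / c\<bar> \<partial>lebesgue) / emeasure lebesgue Q)"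
    unfolding h_def .
qed

lemma A_mod_imp_maximal_bounded:
  assumes A: "A_mod r l C" "0 < l" "l < 1" "1 \<le> C"
    and A': "A_mod (\<lambda>x. r x / (r x - 1)) l' C'" "0 < l'" "l' < 1" "1 \<le> C'"
  shows "maximal_bounded p"
proof -
  obtain D where D: "1 \<le> D" and grid: "\<And>N f. f \<in> borel_measurable lebesgue \<Longrightarrow> (\<And>x. 0 \<le> f x) \<Longrightarrow> modular r UNIV f \<le> 1 \<Longrightarrow>
    modular r UNIV (\<lambda>x. grid_max N f x / D) \<le> 1"
    using grid_max_bounded[OF assms] by blast
  define B where "B = 6 ^ CARD('n) * D"
  have B: "0 < B" using D by (simp add: B_def)
  have "Lp_norm p (maximal f) \<le> ennreal B * Lp_norm p (\<lambda>x. ennreal \<bar>f x\<bar>)" if f: "f \<in> Lp_space p" for f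
  proof (rule Lp_norm_le_mult[OF B])
    fix c :: real
    assume c: "0 < c" and le1: "(\<integral>\<^sup>+x. ennpow (ennreal \<bar>f x\<bar> / ennreal c) (p x) \<partial>lebesgue) \<le> 1"
    define g where "g x = \<bar>f x\<bar> / c" for x
    have fm[measurable]: "f \<in> borel_measurable lebesgue" using f by (simp add: Lp_space_def)
    have g[measurable]: "g \<in> borel_measurable lebesgue" unfolding g_def by measurable
    have g0: "0 \<le> g x" for x using c by (simp add: g_def)
    have g1: "modular r UNIV g \<le> 1" using le1 unfolding g_def[abs_def] by (subst (asm) ennpow_integral) (use c in auto)
    have "(\<integral>\<^sup>+x. ennpow (maximal f x / ennreal (B * c)) (p x) \<partial>lebesgue) \<le> (\<integral>\<^sup>+x. ennpow (maximal g x / ennreal B) (p x) \<partial>lebesgue)"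
    proof (rule ennpow_integral_mono)
      fix x
      have "maximal f x * ennreal (1 / (B * c)) \<le> (ennreal c * maximal g x) * ennreal (1 / (B * c))"
        unfolding g_def by (intro mult_right_mono maximal_le_scaled c fm) simp
      also have "\<dots> = maximal g x * (ennreal c * ennreal (1 / (B * c)))" by (simp add: mult_ac)
      also have "ennreal c * ennreal (1 / (B * c)) = ennreal (1 / B)" using c B by (simp flip: ennreal_mult)
      finally show "maximal f x / ennreal (B * c) \<le> maximal g x / ennreal B"
        using B c by (simp add: ennreal_divide_eq_mult)
    qed
    also have "\<dots> \<le> 1" unfolding B_def by (rule maximal_modular[OF D g g0 g1 grid[OF g g0 g1]])
    finally show "(\<integral>\<^sup>+x. ennpow (maximal f x / ennreal (B * c)) (p x) \<partial>lebesgue) \<le> 1" .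
  qed
  then show ?thesis unfolding maximal_bounded_def using B by blast
qed

lemma conj_exponent_AE: "AE x in lebesgue. conj_exponent p x = ennreal (r x / (r x - 1))"
  using pr
proof eventually_elim
  case (elim x)
  have "ennreal (r x) - 1 = ennreal (r x - 1)" using r_pos(2)[of x] by (simp add: ennreal_minus flip: ennreal_1)
  then show ?case using r_pos(2)[of x] by (simp add: conj_exponent_def elim divide_ennreal)
qed

end

end

theorem theorem1p3:
  fixes p :: "real ^ 'n \<Rightarrow> ennreal"
  assumes "p \<in> borel_measurable lebesgue"
    and "\<And>x. 1 \<le> p x"
    and "1 < essinf lebesgue p"
    and "esssup lebesgue p < \<infinity>"
  shows "maximal_bounded p \<longleftrightarrow> A_infty p \<and> A_infty (conj_exponent p)"
proof -
  obtain z where z: "1 < z" "AE x in lebesgue. z \<le> p x"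
    using assms(3) unfolding essinf_def less_Sup_iff by blast
  \<comment> \<open>Truncation at 2 ensures a finite lower bound that is still above 1.\<close>
  define pm where "pm = enn2real (min z 2)"
  have mz: "min z 2 = ennreal pm" 
  proof -
    have "min z 2 < top" by (rule le_less_trans[of _ 2]) auto
    then show ?thesis by (simp add: pm_def)
  qed
  have pm: "1 < pm"
  proof -
    have "ennreal 1 < ennreal pm" unfolding mz[symmetric] using z(1) by simp
    then show ?thesis by (simp add: ennreal_less_iff)
  qed
  define pp where "pp = max pm (enn2real (esssup lebesgue p))"
  \<comment> \<open>Clamped between \<open>pm\<close> and \<open>pp\<close>, so that the bounds hold
    at every point; this alters \<open>p\<close> only on a null set.\<close>
  define r where "r x = max pm (min pp (enn2real (p x)))" for x
  interpret exponent r pm pp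
  proof
    show "r \<in> borel_measurable lebesgue" unfolding r_def using assms(1) by measurable
  qed (use pm in \<open>auto simp: r_def pp_def\<close>)
  have pr: "AE x in lebesgue. p x = ennreal (r x)"
    using z(2) esssup_AE[of p lebesgue]
  proof eventually_elim
    case (elim x)
    have fin: "p x < top" using elim(2) assms(4) by (auto intro: le_less_trans)
    have "ennreal pm \<le> p x" unfolding mz[symmetric] using elim(1) by (meson min.coboundedI1)
    then have "pm \<le> enn2real (p x)" using fin pm by (metis enn2real_ennreal enn2real_mono less_eq_real_def less_trans zero_less_one)
    moreover have "enn2real (p x) \<le> pp" using elim(2) assms(4) unfolding pp_def by (simp add: enn2real_mono le_max_iff_disj)
    ultimately have "r x = enn2real (p x)" by (simp add: r_def)
    then show ?case using fin by simp
  qed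
  interpret c: exponent "\<lambda>x. r x / (r x - 1)" "pp / (pp - 1)" "pm / (pm - 1)" by (rule exponent_conj)
  note pr' = conj_exponent_AE[OF pr]
  show ?thesis
  proof
    assume "maximal_bounded p"
    then obtain C where C: "1 \<le> C" "avg_bounded r C" using maximal_bounded_imp_avg_bounded[OF pr] by blast
    have "A_infty p"
      by (rule A_mod_imp_A_infty[OF pr avg_bounded_A_mod[OF C(2,1)]]) (use C in auto)
    moreover have "A_infty (conj_exponent p)"
      by (rule c.A_mod_imp_A_infty[OF pr' avg_bounded_A_mod_conj[OF C(2,1)]]) (use C in auto)
    ultimately show "A_infty p \<and> A_infty (conj_exponent p)" ..
  next
    assume A: "A_infty p \<and> A_infty (conj_exponent p)"
    obtain l C where "0 < l" "l < 1" "1 \<le> C" "A_mod r l C" using A_infty_imp_A_mod[OF pr] A by blast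
    moreover obtain l' C' where "0 < l'" "l' < 1" "1 \<le> C'" "A_mod (\<lambda>x. r x / (r x - 1)) l' C'"
      using c.A_infty_imp_A_mod[OF pr'] A by blast
    ultimately show "maximal_bounded p" using A_mod_imp_maximal_bounded[OF pr] by blast
  qed
qed

end
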